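(* Let $\mathbb{J}$ be a small pseudo-filtered category in which every morphism is a monomorphism. Consider the adjunction $Colim\dashv\Delta$, $Colim:Set^\mathbb{J}\rightarrow Set$, and the derived full reflection $I:Set^\mathbb{J}\rightarrow Mono(Colim)$. Then there is a monotone-light factorization system $(\mathcal{E}'_I,\mathcal{M}^*_I)$ on $Set^\mathbb{J}$.
   Context: A category is pseudo-filtered if its connected components are filtered. $\Delta:Set\rightarrow Set^\mathbb{J}$ is the diagonal (constant functor) functor and $\theta:1\rightarrow\Delta\circ Colim$ is the unit of the adjunction. $Mono(Colim)$ is the full subcategory of $Set^\mathbb{J}$ determined by the $M$ for which $\theta_M$ is a monomorphism (componentwise injective). The reflection $I$, left adjoint to the full inclusion, has unit $\eta$ obtained by factorizing each $\theta_M=\mu_M\circ\eta_M$ componentwise as a surjection followed by an injection. For a full reflection $I$ of a category $\mathbb{C}$ with pullbacks onto a full subcategory: $\mathcal{E}_I$ is the class of morphisms $f$ of $\mathbb{C}$ with $If$ an isomorphism; $\mathcal{M}_I$ is the class of morphisms $m$ right orthogonal to every $e\in\mathcal{E}_I$ (for every commutative square $v\circ e=m\circ u$ there is a unique $w$ with $w\circ e=u$, $m\circ w=v$); $\mathcal{E}'_I$ is the class of morphisms all of whose pullbacks lie in $\mathcal{E}_I$; $\mathcal{M}^*_I$ is the class of morphisms $f:A\rightarrow B$ for which there is an effective descent morphism $p:E\rightarrow B$ (i.e. $p^*:\mathbb{C}/B\rightarrow\mathbb{C}/E$ is monadic) such that the pullback $p^*(f)$ of $f$ along $p$ lies in $\mathcal{M}_I$.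 A monotone-light factorization system exists when $(\mathcal{E}'_I,\mathcal{M}^*_I)$ is an (orthogonal) factorization system on $\mathbb{C}$. *)

theory Defs
  imports "HOL-Library.FuncSet"
begin

unbundle cardinal_syntax

section \<open>Categories, functors, natural transformations\<close>

record ('o, 'a) cat =
  Obj :: "'o set"
  Arr :: "'a set"
  Dom :: "'a \<Rightarrow> 'o"
  Cod :: "'a \<Rightarrow> 'o"
  Ident :: "'o \<Rightarrow> 'a"
  Comp :: "'a \<Rightarrow> 'a \<Rightarrow> 'a" (infixl "\<cdot>\<index>" 70)

text \<open>Composition is in applicative order: \<open>g \<cdot>\<^bsub>C\<^esub> f\<close> is \<open>f\<close> followed by \<open>g\<close>.
  The operations are only meaningful on \<open>Obj C\<close>, \<open>Arr C\<close> and composable pairs.\<close>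

definition hom :: "('o, 'a) cat \<Rightarrow> 'o \<Rightarrow> 'o \<Rightarrow> 'a set" where
  "hom C A B = {f \<in> Arr C. Dom C f = A \<and> Cod C f = B}"

definition category :: "('o, 'a) cat \<Rightarrow> bool" where
  "category C \<longleftrightarrow>
     (\<forall>f\<in>Arr C. Dom C f \<in> Obj C \<and> Cod C f \<in> Obj C) \<and>
     (\<forall>A\<in>Obj C. Ident C A \<in> hom C A A) \<and>
     (\<forall>f\<in>Arr C. \<forall>g\<in>Arr C. Dom C g = Cod C f \<longrightarrow> g \<cdot>\<^bsub>C\<^esub> f \<in> hom C (Dom C f) (Cod C g)) \<and>
     (\<forall>f\<in>Arr C. f \<cdot>\<^bsub>C\<^esub> Ident C (Dom C f) = f \<and> Ident C (Cod C f) \<cdot>\<^bsub>C\<^esub> f = f) \<and>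
     (\<forall>f\<in>Arr C. \<forall>g\<in>Arr C. \<forall>h\<in>Arr C. Dom C g = Cod C f \<and> Dom C h = Cod C g \<longrightarrow>
        h \<cdot>\<^bsub>C\<^esub> (g \<cdot>\<^bsub>C\<^esub> f) = (h \<cdot>\<^bsub>C\<^esub> g) \<cdot>\<^bsub>C\<^esub> f)"

definition monic :: "('o, 'a) cat \<Rightarrow> 'a \<Rightarrow> bool" where
  "monic C m \<longleftrightarrow> m \<in> Arr C \<and>
     (\<forall>f\<in>Arr C. \<forall>g\<in>Arr C. Cod C f = Dom C m \<and> Cod C g = Dom C m \<and> Dom C f = Dom C g \<and>
        m \<cdot>\<^bsub>C\<^esub> f = m \<cdot>\<^bsub>C\<^esub> g \<longrightarrow> f = g)"

definition iso :: "('o, 'a) cat \<Rightarrow> 'a \<Rightarrow> bool" where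
  "iso C f \<longleftrightarrow> f \<in> Arr C \<and>
     (\<exists>g\<in>hom C (Cod C f) (Dom C f).
        g \<cdot>\<^bsub>C\<^esub> f = Ident C (Dom C f) \<and> f \<cdot>\<^bsub>C\<^esub> g = Ident C (Cod C f))"

definition full_subcategory :: "('o, 'a) cat \<Rightarrow> 'o set \<Rightarrow> ('o, 'a) cat" where
  "full_subcategory C S =
     C\<lparr>Obj := Obj C \<inter> S, Arr := {f \<in> Arr C. Dom C f \<in> S \<and> Cod C f \<in> S}\<rparr>"

record ('o, 'a, 'p, 'b) func =
  omap :: "'o \<Rightarrow> 'p"
  amap :: "'a \<Rightarrow> 'b"

definition is_functor :: "('o, 'a) cat \<Rightarrow> ('p, 'b) cat \<Rightarrow> ('o, 'a, 'p, 'b) func \<Rightarrow> bool" where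
  "is_functor C D F \<longleftrightarrow> category C \<and> category D \<and>
     (\<forall>A\<in>Obj C. omap F A \<in> Obj D) \<and>
     (\<forall>f\<in>Arr C. amap F f \<in> hom D (omap F (Dom C f)) (omap F (Cod C f))) \<and>
     (\<forall>A\<in>Obj C. amap F (Ident C A) = Ident D (omap F A)) \<and>
     (\<forall>f\<in>Arr C. \<forall>g\<in>Arr C. Dom C g = Cod C f \<longrightarrow>
        amap F (g \<cdot>\<^bsub>C\<^esub> f) = amap F g \<cdot>\<^bsub>D\<^esub> amap F f)"

text \<open>Also serves as the inclusion functor of a full subcategory.\<close>

definition id_func :: "('o, 'a, 'o, 'a) func" where
  "id_func = \<lparr>omap = (\<lambda>A. A), amap = (\<lambda>f. f)\<rparr>"

definition comp_func ::
  "('p, 'b, 'q, 'c) func \<Rightarrow> ('o, 'a, 'p, 'b) func \<Rightarrow> ('o, 'a, 'q, 'c) func" where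
  "comp_func G F = \<lparr>omap = (\<lambda>A. omap G (omap F A)), amap = (\<lambda>f. amap G (amap F f))\<rparr>"

definition nat_trans :: "('o, 'a) cat \<Rightarrow> ('p, 'b) cat \<Rightarrow> ('o, 'a, 'p, 'b) func \<Rightarrow>
    ('o, 'a, 'p, 'b) func \<Rightarrow> ('o \<Rightarrow> 'b) \<Rightarrow> bool" where
  "nat_trans C D F G t \<longleftrightarrow> is_functor C D F \<and> is_functor C D G \<and>
     (\<forall>A\<in>Obj C. t A \<in> hom D (omap F A) (omap G A)) \<and>
     (\<forall>f\<in>Arr C. t (Cod C f) \<cdot>\<^bsub>D\<^esub> amap F f = amap G f \<cdot>\<^bsub>D\<^esub> t (Dom C f))"

definition nat_iso :: "('o, 'a) cat \<Rightarrow> ('p, 'b) cat \<Rightarrow> ('o, 'a, 'p, 'b) func \<Rightarrow>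
    ('o, 'a, 'p, 'b) func \<Rightarrow> ('o \<Rightarrow> 'b) \<Rightarrow> bool" where
  "nat_iso C D F G t \<longleftrightarrow> nat_trans C D F G t \<and> (\<forall>A\<in>Obj C. iso D (t A))"

definition equivalence :: "('o, 'a) cat \<Rightarrow> ('p, 'b) cat \<Rightarrow> ('o, 'a, 'p, 'b) func \<Rightarrow> bool" where
  "equivalence C D K \<longleftrightarrow> is_functor C D K \<and>
     (\<exists>H \<alpha> \<beta>. is_functor D C H \<and>
        nat_iso C C id_func (comp_func H K) \<alpha> \<and> nat_iso D D (comp_func K H) id_func \<beta>)"

text \<open>\<open>F \<stileturn> G\<close> with unit \<open>\<eta>\<close> and counit \<open>\<epsilon>\<close>.\<close>

definition adjunction :: "('o, 'a) cat \<Rightarrow> ('p, 'b) cat \<Rightarrow> ('o, 'a, 'p, 'b) func \<Rightarrow>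
    ('p, 'b, 'o, 'a) func \<Rightarrow> ('o \<Rightarrow> 'a) \<Rightarrow> ('p \<Rightarrow> 'b) \<Rightarrow> bool" where
  "adjunction C D F G \<eta> \<epsilon> \<longleftrightarrow>
     is_functor C D F \<and> is_functor D C G \<and>
     nat_trans C C id_func (comp_func G F) \<eta> \<and>
     nat_trans D D (comp_func F G) id_func \<epsilon> \<and>
     (\<forall>A\<in>Obj C. \<epsilon> (omap F A) \<cdot>\<^bsub>D\<^esub> amap F (\<eta> A) = Ident D (omap F A)) \<and>
     (\<forall>B\<in>Obj D. amap G (\<epsilon> B) \<cdot>\<^bsub>C\<^esub> \<eta> (omap G B) = Ident C (omap G B))"

text \<open>The components of the functors and transformations are required to be extensional, so
  that equal morphisms of the functor category are equal in HOL.\<close>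

definition functor_category :: "('j, 'k) cat \<Rightarrow> ('o, 'a) cat \<Rightarrow>
    (('j, 'k, 'o, 'a) func,
     ('j, 'k, 'o, 'a) func \<times> ('j \<Rightarrow> 'a) \<times> ('j, 'k, 'o, 'a) func) cat" where
  "functor_category J C =
     (let ob = {F. is_functor J C F \<and> omap F \<in> extensional (Obj J) \<and> amap F \<in> extensional (Arr J)}
      in \<lparr>Obj = ob,
          Arr = {(F, t, G). F \<in> ob \<and> G \<in> ob \<and> nat_trans J C F G t \<and> t \<in> extensional (Obj J)},
          Dom = (\<lambda>(F, t, G). F),
          Cod = (\<lambda>(F, t, G). G),
          Ident = (\<lambda>F. (F, \<lambda>j\<in>Obj J. Ident C (omap F j), F)),
          Comp = (\<lambda>(G', s, H) (F, t, G). (F, \<lambda>j\<in>Obj J. s j \<cdot>\<^bsub>C\<^esub> t j, H))\<rparr>)"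

definition diagonal :: "('j, 'k) cat \<Rightarrow> ('o, 'a) cat \<Rightarrow>
    ('o, 'a, ('j, 'k, 'o, 'a) func,
     ('j, 'k, 'o, 'a) func \<times> ('j \<Rightarrow> 'a) \<times> ('j, 'k, 'o, 'a) func) func" where
  "diagonal J C =
     (let const = (\<lambda>A. \<lparr>omap = (\<lambda>j\<in>Obj J. A), amap = (\<lambda>f\<in>Arr J. Ident C A)\<rparr>)
      in \<lparr>omap = const,
          amap = (\<lambda>h. (const (Dom C h), \<lambda>j\<in>Obj J. h, const (Cod C h)))\<rparr>)"

section \<open>Pullbacks, monadicity and effective descent\<close>

text \<open>\<open>p : P \<rightarrow> A\<close>, \<open>q : P \<rightarrow> E\<close> is a pullback of \<open>f : A \<rightarrow> B\<close>, \<open>g : E \<rightarrow> B\<close>;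
  that is, \<open>q\<close> is a pullback of \<open>f\<close> along \<open>g\<close>.\<close>

definition is_pullback :: "('o, 'a) cat \<Rightarrow> 'a \<Rightarrow> 'a \<Rightarrow> 'a \<Rightarrow> 'a \<Rightarrow> bool" where
  "is_pullback C f g p q \<longleftrightarrow>
     f \<in> Arr C \<and> g \<in> Arr C \<and> p \<in> Arr C \<and> q \<in> Arr C \<and>
     Cod C f = Cod C g \<and> Dom C p = Dom C q \<and> Cod C p = Dom C f \<and> Cod C q = Dom C g \<and>
     f \<cdot>\<^bsub>C\<^esub> p = g \<cdot>\<^bsub>C\<^esub> q \<and>
     (\<forall>x\<in>Arr C. \<forall>y\<in>Arr C.
        Dom C x = Dom C y \<and> Cod C x = Dom C f \<and> Cod C y = Dom C g \<and> f \<cdot>\<^bsub>C\<^esub> x = g \<cdot>\<^bsub>C\<^esub> y \<longrightarrow>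
        (\<exists>!w. w \<in> hom C (Dom C x) (Dom C p) \<and> p \<cdot>\<^bsub>C\<^esub> w = x \<and> q \<cdot>\<^bsub>C\<^esub> w = y))"

definition slice :: "('o, 'a) cat \<Rightarrow> 'o \<Rightarrow> ('a, 'a \<times> 'a \<times> 'a) cat" where
  "slice C B =
     (let ob = {f \<in> Arr C. Cod C f = B}
      in \<lparr>Obj = ob,
          Arr = {(f, h, g). f \<in> ob \<and> g \<in> ob \<and> h \<in> hom C (Dom C f) (Dom C g) \<and> g \<cdot>\<^bsub>C\<^esub> h = f},
          Dom = (\<lambda>(f, h, g). f),
          Cod = (\<lambda>(f, h, g). g),
          Ident = (\<lambda>f. (f, Ident C (Dom C f), f)),
          Comp = (\<lambda>(g', k, l) (f, h, g). (f, k \<cdot>\<^bsub>C\<^esub> h, l))\<rparr>)"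

text \<open>For \<open>p : E \<rightarrow> B\<close>, the functor \<open>p\<^sup>* : C/B \<rightarrow> C/E\<close> determined by a choice of pullbacks along
  \<open>p\<close>; it is meaningful when \<open>C\<close> has pullbacks, and different choices give isomorphic functors.\<close>

definition chosen_pullback :: "('o, 'a) cat \<Rightarrow> 'a \<Rightarrow> 'a \<Rightarrow> 'a \<times> 'a" where
  "chosen_pullback C p f = (SOME (a, b). is_pullback C f p a b)"

definition pullback_functor ::
  "('o, 'a) cat \<Rightarrow> 'a \<Rightarrow> ('a, 'a \<times> 'a \<times> 'a, 'a, 'a \<times> 'a \<times> 'a) func" where
  "pullback_functor C p =
     (let top = (\<lambda>f. fst (chosen_pullback C p f));
          pb = (\<lambda>f. snd (chosen_pullback C p f))
      in \<lparr>omap = pb,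
          amap = (\<lambda>(f, h, g).
            (pb f,
             THE k. k \<in> hom C (Dom C (pb f)) (Dom C (pb g)) \<and>
                    top g \<cdot>\<^bsub>C\<^esub> k = h \<cdot>\<^bsub>C\<^esub> top f \<and> pb g \<cdot>\<^bsub>C\<^esub> k = pb f,
             pb g))\<rparr>)"

text \<open>The Eilenberg--Moore category of the monad \<open>(T, \<eta>, \<mu>)\<close> on \<open>C\<close>.\<close>

definition em_category :: "('o, 'a) cat \<Rightarrow> ('o, 'a, 'o, 'a) func \<Rightarrow> ('o \<Rightarrow> 'a) \<Rightarrow> ('o \<Rightarrow> 'a) \<Rightarrow>
    ('o \<times> 'a, ('o \<times> 'a) \<times> 'a \<times> ('o \<times> 'a)) cat" where
  "em_category C T \<eta> \<mu> =
     (let ob = {(A, a). A \<in> Obj C \<and> a \<in> hom C (omap T A) A \<and>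
                  a \<cdot>\<^bsub>C\<^esub> \<eta> A = Ident C A \<and> a \<cdot>\<^bsub>C\<^esub> amap T a = a \<cdot>\<^bsub>C\<^esub> \<mu> A}
      in \<lparr>Obj = ob,
          Arr = {(x, h, y). x \<in> ob \<and> y \<in> ob \<and> h \<in> hom C (fst x) (fst y) \<and>
                   h \<cdot>\<^bsub>C\<^esub> snd x = snd y \<cdot>\<^bsub>C\<^esub> amap T h},
          Dom = (\<lambda>(x, h, y). x),
          Cod = (\<lambda>(x, h, y). y),
          Ident = (\<lambda>x. (x, Ident C (fst x), x)),
          Comp = (\<lambda>(y', k, z) (x, h, y). (x, k \<cdot>\<^bsub>C\<^esub> h, z))\<rparr>)"

definition comparison_functor ::
  "('p, 'b) cat \<Rightarrow> ('p, 'b, 'o, 'a) func \<Rightarrow> ('p \<Rightarrow> 'b) \<Rightarrow>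
    ('p, 'b, 'o \<times> 'a, ('o \<times> 'a) \<times> 'a \<times> ('o \<times> 'a)) func" where
  "comparison_functor D G \<epsilon> =
     (let K = (\<lambda>X. (omap G X, amap G (\<epsilon> X)))
      in \<lparr>omap = K, amap = (\<lambda>f. (K (Dom D f), amap G f, K (Cod D f)))\<rparr>)"

definition monadic :: "('p, 'b) cat \<Rightarrow> ('o, 'a) cat \<Rightarrow> ('p, 'b, 'o, 'a) func \<Rightarrow> bool" where
  "monadic D C G \<longleftrightarrow>
     (\<exists>F \<eta> \<epsilon>. adjunction C D F G \<eta> \<epsilon> \<and>
        equivalence D (em_category C (comp_func G F) \<eta> (\<lambda>A. amap G (\<epsilon> (omap F A))))
          (comparison_functor D G \<epsilon>))"

definition effective_descent :: "('o, 'a) cat \<Rightarrow> 'a \<Rightarrow> bool" where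
  "effective_descent C p \<longleftrightarrow> p \<in> Arr C \<and>
     monadic (slice C (Cod C p)) (slice C (Dom C p)) (pullback_functor C p)"

section \<open>Factorization systems and the classes of a full reflection\<close>

definition orthogonal :: "('o, 'a) cat \<Rightarrow> 'a \<Rightarrow> 'a \<Rightarrow> bool" where
  "orthogonal C e m \<longleftrightarrow>
     (\<forall>u\<in>hom C (Dom C e) (Dom C m). \<forall>v\<in>hom C (Cod C e) (Cod C m).
        v \<cdot>\<^bsub>C\<^esub> e = m \<cdot>\<^bsub>C\<^esub> u \<longrightarrow>
        (\<exists>!w. w \<in> hom C (Cod C e) (Dom C m) \<and> w \<cdot>\<^bsub>C\<^esub> e = u \<and> m \<cdot>\<^bsub>C\<^esub> w = v))"

definition factorization_system :: "('o, 'a) cat \<Rightarrow> 'a set \<Rightarrow> 'a set \<Rightarrow> bool" where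
  "factorization_system C E M \<longleftrightarrow>
     E = {e \<in> Arr C. \<forall>m\<in>M. orthogonal C e m} \<and>
     M = {m \<in> Arr C. \<forall>e\<in>E. orthogonal C e m} \<and>
     (\<forall>f\<in>Arr C. \<exists>e\<in>E. \<exists>m\<in>M. Cod C e = Dom C m \<and> f = m \<cdot>\<^bsub>C\<^esub> e)"

text \<open>In the following, \<open>I : C \<rightarrow> D\<close> is a reflection of \<open>C\<close> onto a full subcategory \<open>D\<close>.\<close>

definition E_class ::
  "('o, 'a) cat \<Rightarrow> ('o, 'a) cat \<Rightarrow> ('o, 'a, 'o, 'a) func \<Rightarrow> 'a set" where
  "E_class C D I = {f \<in> Arr C. iso D (amap I f)}"

definition M_class ::
  "('o, 'a) cat \<Rightarrow> ('o, 'a) cat \<Rightarrow> ('o, 'a, 'o, 'a) func \<Rightarrow> 'a set" where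
  "M_class C D I = {m \<in> Arr C. \<forall>e\<in>E_class C D I. orthogonal C e m}"

definition stable_E_class ::
  "('o, 'a) cat \<Rightarrow> ('o, 'a) cat \<Rightarrow> ('o, 'a, 'o, 'a) func \<Rightarrow> 'a set" where
  "stable_E_class C D I =
     {f \<in> Arr C. \<forall>g p q. is_pullback C f g p q \<longrightarrow> q \<in> E_class C D I}"

definition local_M_class ::
  "('o, 'a) cat \<Rightarrow> ('o, 'a) cat \<Rightarrow> ('o, 'a, 'o, 'a) func \<Rightarrow> 'a set" where
  "local_M_class C D I =
     {f \<in> Arr C. \<exists>p. effective_descent C p \<and> Cod C p = Cod C f \<and>
        omap (pullback_functor C p) f \<in> M_class C D I}"

definition monotone_light_factorization_system ::
  "('o, 'a) cat \<Rightarrow> ('o, 'a) cat \<Rightarrow> ('o, 'a, 'o, 'a) func \<Rightarrow> bool" where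
  "monotone_light_factorization_system C D I \<longleftrightarrow>
     factorization_system C (stable_E_class C D I) (local_M_class C D I)"

section \<open>Pseudo-filtered categories\<close>

definition filtered :: "('o, 'a) cat \<Rightarrow> bool" where
  "filtered C \<longleftrightarrow> category C \<and> Obj C \<noteq> {} \<and>
     (\<forall>A\<in>Obj C. \<forall>B\<in>Obj C. \<exists>X. hom C A X \<noteq> {} \<and> hom C B X \<noteq> {}) \<and>
     (\<forall>A B. \<forall>f\<in>hom C A B. \<forall>g\<in>hom C A B. \<exists>X. \<exists>h\<in>hom C B X. h \<cdot>\<^bsub>C\<^esub> f = h \<cdot>\<^bsub>C\<^esub> g)"

text \<open>Two objects are connected if they are joined by a finite zigzag of morphisms.\<close>

definition connected_objs :: "('o, 'a) cat \<Rightarrow> ('o \<times> 'o) set" where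
  "connected_objs C =
     {(A, B). A \<in> Obj C \<and> B \<in> Obj C \<and>
        (A, B) \<in> {(X, Y). hom C X Y \<noteq> {} \<or> hom C Y X \<noteq> {}}\<^sup>*}"

definition pseudo_filtered :: "('o, 'a) cat \<Rightarrow> bool" where
  "pseudo_filtered C \<longleftrightarrow> category C \<and>
     (\<forall>A\<in>Obj C. filtered (full_subcategory C (connected_objs C `` {A})))"

section \<open>Set-valued functors\<close>

text \<open>A type \<open>'u\<close> plays the role of the universe: the (small) sets are the subsets of \<open>'u\<close> of
  cardinality less than that of \<open>'u\<close>. If the cardinality of \<open>'u\<close> is strongly inaccessible, these
  sets and their functions form, up to equivalence, the category of sets of a Grothendieck
  universe. Since HOL does not prove that such a type exists, only infinity and regularity
  of the cardinal are required below.\<close>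

definition set_universe :: "'u itself \<Rightarrow> bool" where
  "set_universe u \<longleftrightarrow> infinite (UNIV :: 'u set) \<and> regularCard |UNIV :: 'u set|"

definition small :: "'u itself \<Rightarrow> 'b set \<Rightarrow> bool" where
  "small u A \<longleftrightarrow> |A| <o |UNIV :: 'u set|"

definition small_category :: "'u itself \<Rightarrow> ('o, 'a) cat \<Rightarrow> bool" where
  "small_category u C \<longleftrightarrow> category C \<and> small u (Obj C) \<and> small u (Arr C)"

type_synonym 'u mapping = "'u set \<times> ('u \<Rightarrow> 'u) \<times> 'u set"
type_synonym ('j, 'k, 'u) diagram = "('j, 'k, 'u set, 'u mapping) func"
type_synonym ('j, 'k, 'u) transformation =
  "('j, 'k, 'u) diagram \<times> ('j \<Rightarrow> 'u mapping) \<times> ('j, 'k, 'u) diagram"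

definition set_cat :: "('u set, 'u mapping) cat" where
  "set_cat =
     \<lparr>Obj = {A. small TYPE('u) A},
      Arr = {(A, f, B). small TYPE('u) A \<and> small TYPE('u) B \<and> f \<in> A \<rightarrow>\<^sub>E B},
      Dom = (\<lambda>(A, f, B). A),
      Cod = (\<lambda>(A, f, B). B),
      Ident = (\<lambda>A. (A, \<lambda>x\<in>A. x, A)),
      Comp = (\<lambda>(B', g, C) (A, f, B). (A, \<lambda>x\<in>A. g (f x), C))\<rparr>"

abbreviation set_functors ::
  "('j, 'k) cat \<Rightarrow> (('j, 'k, 'u) diagram, ('j, 'k, 'u) transformation) cat" where
  "set_functors J \<equiv> functor_category J set_cat"

definition surj_mapping :: "'u mapping \<Rightarrow> bool" where
  "surj_mapping = (\<lambda>(A, f, B). f ` A = B)"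

definition inj_mapping :: "'u mapping \<Rightarrow> bool" where
  "inj_mapping = (\<lambda>(A, f, B). inj_on f A)"

definition componentwise ::
  "('u mapping \<Rightarrow> bool) \<Rightarrow> ('j, 'k) cat \<Rightarrow> ('j, 'k, 'u) transformation \<Rightarrow> bool" where
  "componentwise P J = (\<lambda>(F, t, G). \<forall>j\<in>Obj J. P (t j))"

text \<open>\<open>Mono(Colim)\<close>, where \<open>\<theta>\<close> is the unit of \<open>Colim \<stileturn> \<Delta>\<close>.\<close>

definition mono_colim :: "('j, 'k) cat \<Rightarrow> (('j, 'k, 'u) diagram \<Rightarrow> ('j, 'k, 'u) transformation) \<Rightarrow>
    (('j, 'k, 'u) diagram, ('j, 'k, 'u) transformation) cat" where
  "mono_colim J \<theta> = full_subcategory (set_functors J) {M. monic (set_functors J) (\<theta> M)}"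

text \<open>\<open>I\<close>, with unit \<open>\<eta>\<close>, is a reflection of \<open>Set\<^sup>J\<close> onto \<open>Mono(Colim)\<close> whose unit is the surjective
  part of the (surjective, injective) factorization \<open>\<theta>\<^sub>M = \<mu>\<^sub>M \<circ> \<eta>\<^sub>M\<close>.\<close>

definition derived_reflection :: "('j, 'k) cat \<Rightarrow>
    (('j, 'k, 'u) diagram, ('j, 'k, 'u) transformation, 'u set, 'u mapping) func \<Rightarrow>
    (('j, 'k, 'u) diagram \<Rightarrow> ('j, 'k, 'u) transformation) \<Rightarrow>
    (('j, 'k, 'u) diagram, ('j, 'k, 'u) transformation,
     ('j, 'k, 'u) diagram, ('j, 'k, 'u) transformation) func \<Rightarrow>
    (('j, 'k, 'u) diagram \<Rightarrow> ('j, 'k, 'u) transformation) \<Rightarrow> bool" where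
  "derived_reflection J Colim \<theta> I \<eta> \<longleftrightarrow>
     (\<exists>\<epsilon>. adjunction (set_functors J) (mono_colim J \<theta>) I id_func \<eta> \<epsilon>) \<and>
     (\<exists>\<mu>. \<forall>M\<in>Obj (set_functors J).
        \<mu> M \<in> hom (set_functors J) (omap I M) (omap (diagonal J set_cat) (omap Colim M)) \<and>
        \<theta> M = \<mu> M \<cdot>\<^bsub>set_functors J\<^esub> \<eta> M \<and>
        componentwise surj_mapping J (\<eta> M) \<and> componentwise inj_mapping J (\<mu> M))"

end

theory Submission
  imports Defs
begin

text \<open>
  In a pseudo-filtered diagram \<open>M\<close>, two elements \<open>x, y\<close> of \<open>M j\<close> have the same class in the
  colimit exactly when some transition \<open>M f\<close> identifies them (\<open>colim_unit_eq_iff\<close>); such elements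
  are called eventually equal below. The reflection \<open>I\<close> divides out eventual equality, so \<open>I f\<close> is
  invertible exactly when \<open>f\<close> is bijective up to eventual equality (\<open>E_class_iff\<close>), and the
  objects of \<open>Mono(Colim)\<close> are the diagrams in which eventual equality is equality, here called
  separated.

  Both classes of the theorem have an elementwise description. The class \<open>\<E>'\<close> consists of the
  monotone maps: the surjections whose fibres consist of eventually equal elements. The class
  \<open>\<M>\<^sup>*\<close> consists of the light maps: those that are injective on eventually equal elements of a
  fibre. For these explicit classes everything is direct. The factorization of \<open>f\<close> divides its
  domain by the relation \<open>f x = f y\<close> and \<open>x\<close> eventually equal to \<open>y\<close>
  (\<open>monotone_light_factorization\<close>), and the diagonal of a square from a monotone to a light map
  exists because the upper map sends the fibres of the monotone map to points
  (\<open>monotone_orthogonal_light\<close>).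

  The monomorphism hypothesis enters in the identification of the two classes. It makes the
  transitions of representable functors injective, so every diagram \<open>B\<close> is covered by a separated
  one, a coproduct of representables (\<open>separated_cover\<close>). Pulling \<open>f : A \<rightarrow> B\<close> back along such a
  cover shows the fibres of \<open>f\<close> over single elements: if the pullback is inverted by \<open>I\<close>, then \<open>f\<close>
  is monotone, and conversely monotone maps are stable under pullback and inverted by \<open>I\<close>. If \<open>f\<close>
  is light, its pullback along the cover is a morphism between separated diagrams, hence
  orthogonal to everything \<open>I\<close> inverts, and so \<open>f\<close> is in \<open>\<M>\<^sup>*\<close>. For the converse, a member
  of \<open>\<M>\<close> is light, because its monotone part is inverted by \<open>I\<close> and therefore split, and
  lightness descends along surjections.

  These arguments use that the effective descent morphisms between diagrams are the componentwise
  surjections (\<open>effective_descent_iff\<close>). A surjection \<open>p : E \<rightarrow> B\<close> is of effective descent because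
  a descent datum on \<open>X \<rightarrow> E\<close> is an equivalence relation on \<open>X\<close> in disguise, whose quotient is the
  descended object over \<open>B\<close>. Conversely, a monadic \<open>p\<^sup>*\<close> reflects isomorphisms, and it inverts
  the inclusion of the image of \<open>p\<close>.
\<close>

section \<open>Categories, functors and equivalences\<close>

lemma in_hom_iff: "f \<in> hom C A B \<longleftrightarrow> f \<in> Arr C \<and> Dom C f = A \<and> Cod C f = B"
  by (simp add: hom_def)

lemma category_hom_objs: "category C \<Longrightarrow> f \<in> hom C A B \<Longrightarrow> A \<in> Obj C \<and> B \<in> Obj C"
  by (auto simp: category_def hom_def)

lemma category_ident: "category C \<Longrightarrow> A \<in> Obj C \<Longrightarrow> Ident C A \<in> hom C A A"
  by (auto simp: category_def)

lemma category_comp: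
  "category C \<Longrightarrow> f \<in> hom C A B \<Longrightarrow> g \<in> hom C B D \<Longrightarrow> g \<cdot>\<^bsub>C\<^esub> f \<in> hom C A D"
  by (auto simp: category_def hom_def)

lemma category_comp_ident: "category C \<Longrightarrow> f \<in> hom C A B \<Longrightarrow> f \<cdot>\<^bsub>C\<^esub> Ident C A = f"
  by (auto simp: category_def hom_def)

lemma category_ident_comp: "category C \<Longrightarrow> f \<in> hom C A B \<Longrightarrow> Ident C B \<cdot>\<^bsub>C\<^esub> f = f"
  by (auto simp: category_def hom_def)

lemma category_assoc:
  "category C \<Longrightarrow> f \<in> hom C A B \<Longrightarrow> g \<in> hom C B D \<Longrightarrow> h \<in> hom C D E \<Longrightarrow>
     (h \<cdot>\<^bsub>C\<^esub> g) \<cdot>\<^bsub>C\<^esub> f = h \<cdot>\<^bsub>C\<^esub> (g \<cdot>\<^bsub>C\<^esub> f)"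
  by (auto simp: category_def hom_def)

lemma functor_categories: "is_functor C D F \<Longrightarrow> category C \<and> category D"
  by (simp add: is_functor_def)

lemma functor_obj: "is_functor C D F \<Longrightarrow> A \<in> Obj C \<Longrightarrow> omap F A \<in> Obj D"
  by (simp add: is_functor_def)

lemma functor_hom:
  "is_functor C D F \<Longrightarrow> f \<in> hom C A B \<Longrightarrow> amap F f \<in> hom D (omap F A) (omap F B)"
  by (auto simp: is_functor_def hom_def)

lemma functor_ident:
  "is_functor C D F \<Longrightarrow> A \<in> Obj C \<Longrightarrow> amap F (Ident C A) = Ident D (omap F A)"
  by (simp add: is_functor_def)

lemma functor_comp:
  "is_functor C D F \<Longrightarrow> f \<in> hom C A B \<Longrightarrow> g \<in> hom C B E \<Longrightarrow>
     amap F (g \<cdot>\<^bsub>C\<^esub> f) = amap F g \<cdot>\<^bsub>D\<^esub> amap F f"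
  by (auto simp: is_functor_def hom_def)

lemma functorI:
  assumes "category C" "category D"
    and "\<And>A. A \<in> Obj C \<Longrightarrow> omap F A \<in> Obj D"
    and "\<And>f A B. f \<in> hom C A B \<Longrightarrow> amap F f \<in> hom D (omap F A) (omap F B)"
    and "\<And>A. A \<in> Obj C \<Longrightarrow> amap F (Ident C A) = Ident D (omap F A)"
    and "\<And>f g A B E. f \<in> hom C A B \<Longrightarrow> g \<in> hom C B E \<Longrightarrow>
           amap F (g \<cdot>\<^bsub>C\<^esub> f) = amap F g \<cdot>\<^bsub>D\<^esub> amap F f"
  shows "is_functor C D F"
  using assms unfolding is_functor_def hom_def by auto

lemma comp_functor:
  assumes F: "is_functor C D F" and G: "is_functor D E G"
  shows "is_functor C E (comp_func G F)"
proof (rule functorI)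
  show "category C" "category E" using F G functor_categories by blast+
qed (auto simp: comp_func_def functor_ident[OF F] functor_ident[OF G] functor_obj[OF F] functor_comp[OF F]
      intro: functor_obj[OF F] functor_obj[OF G] functor_hom[OF F] functor_hom[OF G]
        functor_comp[OF G])

lemma id_functor: "category C \<Longrightarrow> is_functor C C id_func"
  by (rule functorI) (auto simp: id_func_def)

lemma id_func_simps [simp]: "omap id_func A = A" "amap id_func f = f"
  by (simp_all add: id_func_def)

lemma comp_func_simps [simp]:
  "omap (comp_func G F) A = omap G (omap F A)" "amap (comp_func G F) f = amap G (amap F f)"
  by (simp_all add: comp_func_def)

lemma nat_transI:
  assumes "is_functor C D F" "is_functor C D G"
    and "\<And>A. A \<in> Obj C \<Longrightarrow> t A \<in> hom D (omap F A) (omap G A)"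
    and "\<And>f A B. f \<in> hom C A B \<Longrightarrow> t B \<cdot>\<^bsub>D\<^esub> amap F f = amap G f \<cdot>\<^bsub>D\<^esub> t A"
  shows "nat_trans C D F G t"
  using assms unfolding nat_trans_def hom_def by auto

lemma nat_trans_hom:
  "nat_trans C D F G t \<Longrightarrow> A \<in> Obj C \<Longrightarrow> t A \<in> hom D (omap F A) (omap G A)"
  by (simp add: nat_trans_def)

lemma nat_trans_natural:
  "nat_trans C D F G t \<Longrightarrow> f \<in> hom C A B \<Longrightarrow> t B \<cdot>\<^bsub>D\<^esub> amap F f = amap G f \<cdot>\<^bsub>D\<^esub> t A"
  by (auto simp: nat_trans_def hom_def)

lemma isoI:
  "f \<in> hom C A B \<Longrightarrow> g \<in> hom C B A \<Longrightarrow> g \<cdot>\<^bsub>C\<^esub> f = Ident C A \<Longrightarrow> f \<cdot>\<^bsub>C\<^esub> g = Ident C B \<Longrightarrow> iso C f"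
  by (auto simp: iso_def hom_def)

lemma isoE:
  assumes "iso C f" "f \<in> hom C A B"
  obtains g where "g \<in> hom C B A" "g \<cdot>\<^bsub>C\<^esub> f = Ident C A" "f \<cdot>\<^bsub>C\<^esub> g = Ident C B"
  using assms by (auto simp: iso_def hom_def)

lemma iso_comp:
  assumes C: "category C" and f: "f \<in> hom C A B" "iso C f" and g: "g \<in> hom C B D" "iso C g"
  shows "iso C (g \<cdot>\<^bsub>C\<^esub> f)"
proof -
  obtain f' where f': "f' \<in> hom C B A" "f' \<cdot>\<^bsub>C\<^esub> f = Ident C A" "f \<cdot>\<^bsub>C\<^esub> f' = Ident C B"
    using f isoE by metis
  obtain g' where g': "g' \<in> hom C D B" "g' \<cdot>\<^bsub>C\<^esub> g = Ident C B" "g \<cdot>\<^bsub>C\<^esub> g' = Ident C D"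
    using g isoE by metis
  note cc = category_comp[OF C]
  show ?thesis
  proof (rule isoI)
    show gf: "g \<cdot>\<^bsub>C\<^esub> f \<in> hom C A D" and fg: "f' \<cdot>\<^bsub>C\<^esub> g' \<in> hom C D A"
      using f g f' g' cc by blast+
    have "(f' \<cdot>\<^bsub>C\<^esub> g') \<cdot>\<^bsub>C\<^esub> (g \<cdot>\<^bsub>C\<^esub> f) = f' \<cdot>\<^bsub>C\<^esub> ((g' \<cdot>\<^bsub>C\<^esub> g) \<cdot>\<^bsub>C\<^esub> f)"
      using category_assoc[OF C gf g'(1) f'(1)] category_assoc[OF C f(1) g(1) g'(1)] by simp
    then show "(f' \<cdot>\<^bsub>C\<^esub> g') \<cdot>\<^bsub>C\<^esub> (g \<cdot>\<^bsub>C\<^esub> f) = Ident C A"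
      using f f' g' category_ident_comp[OF C f(1)] by simp
    have "(g \<cdot>\<^bsub>C\<^esub> f) \<cdot>\<^bsub>C\<^esub> (f' \<cdot>\<^bsub>C\<^esub> g') = g \<cdot>\<^bsub>C\<^esub> ((f \<cdot>\<^bsub>C\<^esub> f') \<cdot>\<^bsub>C\<^esub> g')"
      using category_assoc[OF C fg f(1) g(1)] category_assoc[OF C g'(1) f'(1) f(1)] by simp
    then show "(g \<cdot>\<^bsub>C\<^esub> f) \<cdot>\<^bsub>C\<^esub> (f' \<cdot>\<^bsub>C\<^esub> g') = Ident C D"
      using f' g' category_ident_comp[OF C g'(1)] by simp
  qed
qed

lemma functor_iso:
  assumes F: "is_functor C D F" and f: "f \<in> hom C A B" "iso C f"
  shows "iso D (amap F f)"
proof -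
  obtain g where g: "g \<in> hom C B A" "g \<cdot>\<^bsub>C\<^esub> f = Ident C A" "f \<cdot>\<^bsub>C\<^esub> g = Ident C B"
    using f isoE by metis
  have AB: "A \<in> Obj C" "B \<in> Obj C"
    using category_hom_objs[OF _ f(1)] functor_categories[OF F] by auto
  show ?thesis
    by (rule isoI[OF functor_hom[OF F f(1)] functor_hom[OF F g(1)]])
      (simp_all add: g AB functor_ident[OF F] functor_comp[OF F f(1) g(1), symmetric]
        functor_comp[OF F g(1) f(1), symmetric])
qed

text \<open>If \<open>K f\<close> is invertible, so is \<open>H (K f)\<close>, and the natural isomorphism between \<open>H K\<close> and the
  identity carries this back to \<open>f\<close>.\<close>

lemma equivalence_reflects_iso:
  assumes K: "equivalence C D K" and f: "f \<in> hom C A B" and Kf: "iso D (amap K f)"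
  shows "iso C f"
proof -
  obtain H \<alpha> where H: "is_functor D C H" and \<alpha>: "nat_iso C C id_func (comp_func H K) \<alpha>"
    and KF: "is_functor C D K"
    using K unfolding equivalence_def by blast
  have C: "category C" using KF functor_categories by blast
  have AB: "A \<in> Obj C" "B \<in> Obj C" using category_hom_objs[OF C f] by auto
  have \<alpha>A: "\<alpha> A \<in> hom C A (omap H (omap K A))" "iso C (\<alpha> A)"
    and \<alpha>B: "\<alpha> B \<in> hom C B (omap H (omap K B))" "iso C (\<alpha> B)"
    using \<alpha> AB by (auto simp: nat_iso_def nat_trans_def)
  have nat: "\<alpha> B \<cdot>\<^bsub>C\<^esub> f = amap H (amap K f) \<cdot>\<^bsub>C\<^esub> \<alpha> A"
    using \<alpha> nat_trans_natural[of C C id_func "comp_func H K" \<alpha> f A B] f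
    by (simp add: nat_iso_def)
  have Kfh: "amap K f \<in> hom D (omap K A) (omap K B)" using functor_hom[OF KF f] .
  have HK: "iso C (amap H (amap K f))" using functor_iso[OF H Kfh Kf] .
  have HKh: "amap H (amap K f) \<in> hom C (omap H (omap K A)) (omap H (omap K B))"
    using functor_hom[OF H Kfh] .
  obtain b where b: "b \<in> hom C (omap H (omap K B)) B" "b \<cdot>\<^bsub>C\<^esub> \<alpha> B = Ident C B"
      "\<alpha> B \<cdot>\<^bsub>C\<^esub> b = Ident C (omap H (omap K B))"
    using isoE \<alpha>B by metis
  have "f = (b \<cdot>\<^bsub>C\<^esub> \<alpha> B) \<cdot>\<^bsub>C\<^esub> f" using b category_ident_comp[OF C f] by simp
  also have "\<dots> = b \<cdot>\<^bsub>C\<^esub> (amap H (amap K f) \<cdot>\<^bsub>C\<^esub> \<alpha> A)"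
    using category_assoc[OF C f \<alpha>B(1) b(1)] nat by simp
  finally have fe: "f = b \<cdot>\<^bsub>C\<^esub> (amap H (amap K f) \<cdot>\<^bsub>C\<^esub> \<alpha> A)" .
  have "iso C (amap H (amap K f) \<cdot>\<^bsub>C\<^esub> \<alpha> A)" using iso_comp[OF C \<alpha>A HKh HK] .
  moreover have "amap H (amap K f) \<cdot>\<^bsub>C\<^esub> \<alpha> A \<in> hom C A (omap H (omap K B))"
    using category_comp[OF C \<alpha>A(1) HKh] .
  moreover have "iso C b" using isoI b \<alpha>B(1) by metis
  ultimately show ?thesis using iso_comp[OF C _ _ b(1)] fe by metis
qed

text \<open>The quasi-inverse chooses for each \<open>Y\<close> an object \<open>h0 Y\<close> and an isomorphism
  \<open>i Y : K (h0 Y) \<rightarrow> Y\<close>; its action on morphisms and the unit are the unique preimages under \<open>K\<close> of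
  the evident conjugates, and all equations between them follow from faithfulness.\<close>

lemma equivalence_of_fully_faithful_essentially_surjective:
  assumes K: "is_functor C D K"
    and ff: "\<And>A B h. A \<in> Obj C \<Longrightarrow> B \<in> Obj C \<Longrightarrow> h \<in> hom D (omap K A) (omap K B) \<Longrightarrow>
        \<exists>!f. f \<in> hom C A B \<and> amap K f = h"
    and es: "\<And>Y. Y \<in> Obj D \<Longrightarrow> \<exists>A i. A \<in> Obj C \<and> i \<in> hom D (omap K A) Y \<and> iso D i"
  shows "equivalence C D K"
proof -
  have C: "category C" and D: "category D" using functor_categories[OF K] by auto
  note Dc = category_comp[OF D] and Cc = category_comp[OF C]
  have "\<exists>A i i'. A \<in> Obj C \<and> i \<in> hom D (omap K A) Y \<and> i' \<in> hom D Y (omap K A) \<and>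
      i' \<cdot>\<^bsub>D\<^esub> i = Ident D (omap K A) \<and> i \<cdot>\<^bsub>D\<^esub> i' = Ident D Y" if "Y \<in> Obj D" for Y
    using es[OF that] isoE by metis
  then obtain h0 i i' where hi: "\<And>Y. Y \<in> Obj D \<Longrightarrow> h0 Y \<in> Obj C \<and> i Y \<in> hom D (omap K (h0 Y)) Y \<and>
      i' Y \<in> hom D Y (omap K (h0 Y)) \<and>
      i' Y \<cdot>\<^bsub>D\<^esub> i Y = Ident D (omap K (h0 Y)) \<and> i Y \<cdot>\<^bsub>D\<^esub> i' Y = Ident D Y"
    by metis
  define lft where "lft A B h = (THE f. f \<in> hom C A B \<and> amap K f = h)" for A B h
  have lft: "lft A B h \<in> hom C A B \<and> amap K (lft A B h) = h"
    if "A \<in> Obj C" "B \<in> Obj C" "h \<in> hom D (omap K A) (omap K B)" for A B h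
    unfolding lft_def by (rule theI') (rule ff[OF that])
  have faith: "f = g" if "f \<in> hom C A B" "g \<in> hom C A B" "amap K f = amap K g" for f g A B
    using ff[of A B "amap K g"] that category_hom_objs[OF C that(1)] functor_hom[OF K that(2)] by blast
  define H where "H = \<lparr>omap = h0, amap = (\<lambda>g. lft (h0 (Dom D g)) (h0 (Cod D g))
      (i' (Cod D g) \<cdot>\<^bsub>D\<^esub> (g \<cdot>\<^bsub>D\<^esub> i (Dom D g))))\<rparr>"
  have H0: "omap H Y = h0 Y" for Y by (simp add: H_def)
  have Hg: "amap H g \<in> hom C (h0 X) (h0 Y) \<and> amap K (amap H g) = i' Y \<cdot>\<^bsub>D\<^esub> (g \<cdot>\<^bsub>D\<^esub> i X)"
    if g: "g \<in> hom D X Y" for g X Y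
  proof -
    have XY: "X \<in> Obj D" "Y \<in> Obj D" using category_hom_objs[OF D g] by auto
    have "i' Y \<cdot>\<^bsub>D\<^esub> (g \<cdot>\<^bsub>D\<^esub> i X) \<in> hom D (omap K (h0 X)) (omap K (h0 Y))"
      using hi[OF XY(1)] hi[OF XY(2)] g Dc by blast
    from lft[OF _ _ this] show ?thesis using hi XY g by (auto simp: H_def hom_def)
  qed
  have HF: "is_functor D C H"
  proof (rule functorI[OF D C])
    fix A assume A: "A \<in> Obj D"
    then show "omap H A \<in> Obj C" by (simp add: H0 hi)
    have idA: "Ident D A \<in> hom D A A" using category_ident[OF D A] .
    have "amap K (amap H (Ident D A)) = Ident D (omap K (h0 A))"
      using Hg[OF idA] hi[OF A] category_ident_comp[OF D] by metis
    then show "amap H (Ident D A) = Ident C (omap H A)"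
      using faith[of _ "h0 A" "h0 A"] Hg[OF idA] hi[OF A] category_ident[OF C] functor_ident[OF K]
      by (simp add: H0)
  next
    fix f A B assume "f \<in> hom D A B"
    then show "amap H f \<in> hom C (omap H A) (omap H B)" using Hg by (simp add: H0)
  next
    fix f g A B E assume f: "f \<in> hom D A B" and g: "g \<in> hom D B E"
    have obj: "A \<in> Obj D" "B \<in> Obj D" "E \<in> Obj D"
      using category_hom_objs[OF D f] category_hom_objs[OF D g] by auto
    have gf: "g \<cdot>\<^bsub>D\<^esub> f \<in> hom D A E" using Dc f g by blast
    note hA = hi[OF obj(1)] and hB = hi[OF obj(2)] and hE = hi[OF obj(3)]
    have fi: "f \<cdot>\<^bsub>D\<^esub> i A \<in> hom D (omap K (h0 A)) B" using f hA Dc by blast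
    have ifi: "i' B \<cdot>\<^bsub>D\<^esub> (f \<cdot>\<^bsub>D\<^esub> i A) \<in> hom D (omap K (h0 A)) (omap K (h0 B))"
      using fi hB Dc by blast
    have "amap K (amap H g \<cdot>\<^bsub>C\<^esub> amap H f) =
        (i' E \<cdot>\<^bsub>D\<^esub> (g \<cdot>\<^bsub>D\<^esub> i B)) \<cdot>\<^bsub>D\<^esub> (i' B \<cdot>\<^bsub>D\<^esub> (f \<cdot>\<^bsub>D\<^esub> i A))"
      using Hg[OF f] Hg[OF g] functor_comp[OF K] by metis
    also have "\<dots> = i' E \<cdot>\<^bsub>D\<^esub> ((g \<cdot>\<^bsub>D\<^esub> i B) \<cdot>\<^bsub>D\<^esub> (i' B \<cdot>\<^bsub>D\<^esub> (f \<cdot>\<^bsub>D\<^esub> i A)))"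
      using category_assoc[OF D ifi] hB hE g Dc by blast
    also have "(g \<cdot>\<^bsub>D\<^esub> i B) \<cdot>\<^bsub>D\<^esub> (i' B \<cdot>\<^bsub>D\<^esub> (f \<cdot>\<^bsub>D\<^esub> i A)) =
        g \<cdot>\<^bsub>D\<^esub> (i B \<cdot>\<^bsub>D\<^esub> (i' B \<cdot>\<^bsub>D\<^esub> (f \<cdot>\<^bsub>D\<^esub> i A)))"
      using category_assoc[OF D ifi] hB g by blast
    also have "i B \<cdot>\<^bsub>D\<^esub> (i' B \<cdot>\<^bsub>D\<^esub> (f \<cdot>\<^bsub>D\<^esub> i A)) = f \<cdot>\<^bsub>D\<^esub> i A"
      using category_assoc[OF D fi] hB category_ident_comp[OF D fi] by metis
    also have "g \<cdot>\<^bsub>D\<^esub> (f \<cdot>\<^bsub>D\<^esub> i A) = (g \<cdot>\<^bsub>D\<^esub> f) \<cdot>\<^bsub>D\<^esub> i A"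
      using category_assoc[OF D _ f g] hA by metis
    finally have "amap K (amap H g \<cdot>\<^bsub>C\<^esub> amap H f) = amap K (amap H (g \<cdot>\<^bsub>D\<^esub> f))"
      using Hg[OF gf] by simp
    then show "amap H (g \<cdot>\<^bsub>D\<^esub> f) = amap H g \<cdot>\<^bsub>C\<^esub> amap H f"
      using faith Hg[OF gf] Cc Hg[OF f] Hg[OF g] by metis
  qed
  have KH: "is_functor C C (comp_func H K)" "is_functor D D (comp_func K H)"
    using comp_functor K HF by blast+
  define \<alpha> where "\<alpha> A = lft A (h0 (omap K A)) (i' (omap K A))" for A
  have \<alpha>: "\<alpha> A \<in> hom C A (h0 (omap K A)) \<and> amap K (\<alpha> A) = i' (omap K A)" if "A \<in> Obj C" for A
    unfolding \<alpha>_def using lft hi functor_obj[OF K that] that by blast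
  have \<alpha>iso: "iso C (\<alpha> A)" if A: "A \<in> Obj C" for A
  proof -
    have KA: "omap K A \<in> Obj D" using functor_obj[OF K A] .
    define b where "b = lft (h0 (omap K A)) A (i (omap K A))"
    have b: "b \<in> hom C (h0 (omap K A)) A" "amap K b = i (omap K A)"
      unfolding b_def using lft hi[OF KA] A by blast+
    note a = \<alpha>[OF A]
    have 1: "amap K (b \<cdot>\<^bsub>C\<^esub> \<alpha> A) = amap K (Ident C A)"
      using functor_comp[OF K conjunct1[OF a] b(1)] a b(2) hi[OF KA] functor_ident[OF K A] by simp
    have 2: "amap K (\<alpha> A \<cdot>\<^bsub>C\<^esub> b) = amap K (Ident C (h0 (omap K A)))"
      using functor_comp[OF K b(1) conjunct1[OF a]] a b(2) hi[OF KA] functor_ident[OF K] by simp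
    have "b \<cdot>\<^bsub>C\<^esub> \<alpha> A = Ident C A"
      by (rule faith[OF category_comp[OF C conjunct1[OF a] b(1)] category_ident[OF C A] 1])
    moreover have "\<alpha> A \<cdot>\<^bsub>C\<^esub> b = Ident C (h0 (omap K A))"
      using hi[OF KA]
      by (intro faith[OF category_comp[OF C b(1) conjunct1[OF a]] category_ident[OF C] 2]) simp
    ultimately show ?thesis using isoI[OF conjunct1[OF a] b(1)] by blast
  qed
  have \<alpha>nat: "nat_trans C C id_func (comp_func H K) \<alpha>"
  proof (rule nat_transI[OF id_functor[OF C] KH(1)])
    fix A assume "A \<in> Obj C"
    then show "\<alpha> A \<in> hom C (omap id_func A) (omap (comp_func H K) A)" using \<alpha> by (simp add: H0)
  next
    fix f A B assume f: "f \<in> hom C A B"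
    have AB: "A \<in> Obj C" "B \<in> Obj C" using category_hom_objs[OF C f] by auto
    have Kf: "amap K f \<in> hom D (omap K A) (omap K B)" using functor_hom[OF K f] .
    have KAB: "omap K A \<in> Obj D" "omap K B \<in> Obj D" using category_hom_objs[OF D Kf] by auto
    note aA = \<alpha>[OF AB(1)] and aB = \<alpha>[OF AB(2)]
    have "amap K (amap H (amap K f) \<cdot>\<^bsub>C\<^esub> \<alpha> A) =
        (i' (omap K B) \<cdot>\<^bsub>D\<^esub> (amap K f \<cdot>\<^bsub>D\<^esub> i (omap K A))) \<cdot>\<^bsub>D\<^esub> i' (omap K A)"
      using functor_comp[OF K conjunct1[OF aA] conjunct1[OF Hg[OF Kf]]] Hg[OF Kf] aA by simp
    also have "\<dots> = i' (omap K B) \<cdot>\<^bsub>D\<^esub> ((amap K f \<cdot>\<^bsub>D\<^esub> i (omap K A)) \<cdot>\<^bsub>D\<^esub> i' (omap K A))"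
      using category_assoc[OF D] hi[OF KAB(1)] hi[OF KAB(2)] Kf Dc by blast
    also have "(amap K f \<cdot>\<^bsub>D\<^esub> i (omap K A)) \<cdot>\<^bsub>D\<^esub> i' (omap K A) = amap K f"
      using category_assoc[OF D _ _ Kf] hi[OF KAB(1)] category_comp_ident[OF D Kf] by metis
    finally have "amap K (\<alpha> B \<cdot>\<^bsub>C\<^esub> f) = amap K (amap H (amap K f) \<cdot>\<^bsub>C\<^esub> \<alpha> A)"
      using functor_comp[OF K f conjunct1[OF aB]] aB by simp
    then show "\<alpha> B \<cdot>\<^bsub>C\<^esub> amap id_func f = amap (comp_func H K) f \<cdot>\<^bsub>C\<^esub> \<alpha> A"
      using faith Cc aA aB f Hg[OF Kf] by (metis comp_func_simps(2) id_func_simps(2))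
  qed
  have \<beta>nat: "nat_trans D D (comp_func K H) id_func i"
  proof (rule nat_transI[OF KH(2) id_functor[OF D]])
    fix A assume "A \<in> Obj D"
    then show "i A \<in> hom D (omap (comp_func K H) A) (omap id_func A)" using hi by (simp add: H0)
  next
    fix f A B assume f: "f \<in> hom D A B"
    have AB: "A \<in> Obj D" "B \<in> Obj D" using category_hom_objs[OF D f] by auto
    have "f \<cdot>\<^bsub>D\<^esub> i A \<in> hom D (omap K (h0 A)) B" using Dc hi[OF AB(1)] f by blast
    then have "i B \<cdot>\<^bsub>D\<^esub> (i' B \<cdot>\<^bsub>D\<^esub> (f \<cdot>\<^bsub>D\<^esub> i A)) = f \<cdot>\<^bsub>D\<^esub> i A"
      using category_assoc[OF D] category_ident_comp[OF D] hi[OF AB(2)] by metis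
    then show "i B \<cdot>\<^bsub>D\<^esub> amap (comp_func K H) f = amap id_func f \<cdot>\<^bsub>D\<^esub> i A"
      using Hg[OF f] by simp
  qed
  have "iso D (i Y)" if "Y \<in> Obj D" for Y using hi[OF that] isoI by metis
  then show ?thesis
    unfolding equivalence_def nat_iso_def using K HF \<alpha>nat \<alpha>iso \<beta>nat by blast
qed

section \<open>Algebras of a monad and the comparison functor\<close>

lemma in_hom_em_iff:
  "F \<in> hom (em_category C T \<eta> \<mu>) x y \<longleftrightarrow>
     x \<in> Obj (em_category C T \<eta> \<mu>) \<and> y \<in> Obj (em_category C T \<eta> \<mu>) \<and>
     (\<exists>h. F = (x, h, y) \<and> h \<in> hom C (fst x) (fst y) \<and> h \<cdot>\<^bsub>C\<^esub> snd x = snd y \<cdot>\<^bsub>C\<^esub> amap T h)"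
  unfolding em_category_def Let_def hom_def by auto

lemma em_obj_iff:
  "(A, a) \<in> Obj (em_category C T \<eta> \<mu>) \<longleftrightarrow> A \<in> Obj C \<and> a \<in> hom C (omap T A) A \<and>
     a \<cdot>\<^bsub>C\<^esub> \<eta> A = Ident C A \<and> a \<cdot>\<^bsub>C\<^esub> amap T a = a \<cdot>\<^bsub>C\<^esub> \<mu> A"
  unfolding em_category_def Let_def by auto

lemma em_simps [simp]:
  "Ident (em_category C T \<eta> \<mu>) x = (x, Ident C (fst x), x)"
  "Comp (em_category C T \<eta> \<mu>) (y', k, z) (x, h, y) = (x, k \<cdot>\<^bsub>C\<^esub> h, z)"
  unfolding em_category_def Let_def by auto

lemma categoryI:
  assumes "\<And>f. f \<in> Arr C \<Longrightarrow> Dom C f \<in> Obj C \<and> Cod C f \<in> Obj C"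
    and "\<And>A. A \<in> Obj C \<Longrightarrow> Ident C A \<in> hom C A A"
    and "\<And>f g A B D. f \<in> hom C A B \<Longrightarrow> g \<in> hom C B D \<Longrightarrow> g \<cdot>\<^bsub>C\<^esub> f \<in> hom C A D"
    and "\<And>f A B. f \<in> hom C A B \<Longrightarrow> f \<cdot>\<^bsub>C\<^esub> Ident C A = f \<and> Ident C B \<cdot>\<^bsub>C\<^esub> f = f"
    and "\<And>f g h A B D E. f \<in> hom C A B \<Longrightarrow> g \<in> hom C B D \<Longrightarrow> h \<in> hom C D E \<Longrightarrow>
       h \<cdot>\<^bsub>C\<^esub> (g \<cdot>\<^bsub>C\<^esub> f) = (h \<cdot>\<^bsub>C\<^esub> g) \<cdot>\<^bsub>C\<^esub> f"
  shows "category C"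
  unfolding category_def
proof (intro conjI ballI impI)
  fix f g assume f: "f \<in> Arr C" and g: "g \<in> Arr C" and d: "Dom C g = Cod C f"
  show "g \<cdot>\<^bsub>C\<^esub> f \<in> hom C (Dom C f) (Cod C g)"
    using assms(3)[of f "Dom C f" "Cod C f" g "Cod C g"] f g d by (simp add: in_hom_iff)
next
  fix f g h assume f: "f \<in> Arr C" and g: "g \<in> Arr C"
    and "h \<in> Arr C" "Dom C g = Cod C f \<and> Dom C h = Cod C g"
  then show "h \<cdot>\<^bsub>C\<^esub> (g \<cdot>\<^bsub>C\<^esub> f) = (h \<cdot>\<^bsub>C\<^esub> g) \<cdot>\<^bsub>C\<^esub> f"
    using assms(5)[of f "Dom C f" "Cod C f" g "Cod C g" h "Cod C h"] f g
    by (simp add: in_hom_iff)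
next
  fix f assume f: "f \<in> Arr C"
  show "f \<cdot>\<^bsub>C\<^esub> Ident C (Dom C f) = f" "Ident C (Cod C f) \<cdot>\<^bsub>C\<^esub> f = f"
    using assms(4)[of f "Dom C f" "Cod C f"] f by (simp_all add: in_hom_iff)
qed (use assms(1,2) in auto)

lemma category_em:
  assumes T: "is_functor C C T"
  shows "category (em_category C T \<eta> \<mu>)" (is "category ?E")
proof -
  have C: "category C" using functor_categories[OF T] by blast
  have obj: "fst x \<in> Obj C \<and> snd x \<in> hom C (omap T (fst x)) (fst x)" if "x \<in> Obj ?E" for x
    using that by (cases x) (simp add: em_obj_iff)
  show ?thesis
  proof (rule categoryI)
    fix f assume "f \<in> Arr ?E"
    then have "f \<in> hom ?E (Dom ?E f) (Cod ?E f)" by (simp add: in_hom_iff)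
    then show "Dom ?E f \<in> Obj ?E \<and> Cod ?E f \<in> Obj ?E" unfolding in_hom_em_iff by blast
  next
    fix A assume A: "A \<in> Obj ?E"
    then show "Ident ?E A \<in> hom ?E A A"
      unfolding in_hom_em_iff
      using obj[OF A] category_ident[OF C] functor_ident[OF T]
        category_comp_ident[OF C] category_ident_comp[OF C] by auto
  next
    fix F G x y z assume "F \<in> hom ?E x y" "G \<in> hom ?E y z"
    then obtain f g where F: "F = (x, f, y)" and G: "G = (y, g, z)"
      and xyz: "x \<in> Obj ?E" "y \<in> Obj ?E" "z \<in> Obj ?E"
      and f: "f \<in> hom C (fst x) (fst y)" "f \<cdot>\<^bsub>C\<^esub> snd x = snd y \<cdot>\<^bsub>C\<^esub> amap T f"
      and g: "g \<in> hom C (fst y) (fst z)" "g \<cdot>\<^bsub>C\<^esub> snd y = snd z \<cdot>\<^bsub>C\<^esub> amap T g"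
      unfolding in_hom_em_iff by blast
    have x: "snd x \<in> hom C (omap T (fst x)) (fst x)" and y: "snd y \<in> hom C (omap T (fst y)) (fst y)"
      and z: "snd z \<in> hom C (omap T (fst z)) (fst z)" using obj xyz by auto
    have Tf: "amap T f \<in> hom C (omap T (fst x)) (omap T (fst y))"
      and Tg: "amap T g \<in> hom C (omap T (fst y)) (omap T (fst z))"
      using functor_hom[OF T] f g by auto
    have "(g \<cdot>\<^bsub>C\<^esub> f) \<cdot>\<^bsub>C\<^esub> snd x = g \<cdot>\<^bsub>C\<^esub> (snd y \<cdot>\<^bsub>C\<^esub> amap T f)"
      using category_assoc[OF C x f(1) g(1)] f by simp
    also have "\<dots> = (snd z \<cdot>\<^bsub>C\<^esub> amap T g) \<cdot>\<^bsub>C\<^esub> amap T f"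
      using category_assoc[OF C Tf y g(1)] g by simp
    also have "\<dots> = snd z \<cdot>\<^bsub>C\<^esub> amap T (g \<cdot>\<^bsub>C\<^esub> f)"
      using category_assoc[OF C Tf Tg z] functor_comp[OF T f(1) g(1)] by simp
    finally show "G \<cdot>\<^bsub>?E\<^esub> F \<in> hom ?E x z"
      unfolding in_hom_em_iff using F G xyz category_comp[OF C f(1) g(1)] by auto
  next
    fix f A B assume "f \<in> hom ?E A B"
    then show "f \<cdot>\<^bsub>?E\<^esub> Ident ?E A = f \<and> Ident ?E B \<cdot>\<^bsub>?E\<^esub> f = f"
      unfolding in_hom_em_iff using category_comp_ident[OF C] category_ident_comp[OF C] by auto
  next
    fix f g h A B D E assume "f \<in> hom ?E A B" "g \<in> hom ?E B D" "h \<in> hom ?E D E"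
    then show "h \<cdot>\<^bsub>?E\<^esub> (g \<cdot>\<^bsub>?E\<^esub> f) = (h \<cdot>\<^bsub>?E\<^esub> g) \<cdot>\<^bsub>?E\<^esub> f"
      unfolding in_hom_em_iff using category_assoc[OF C] by auto
  qed
qed

text \<open>The inverse of the underlying morphism is automatically compatible with the algebra
  structures.\<close>

lemma iso_em:
  assumes T: "is_functor C C T"
    and F: "(x, h, y) \<in> hom (em_category C T \<eta> \<mu>) x y" and h: "iso C h"
  shows "iso (em_category C T \<eta> \<mu>) (x, h, y)"
proof -
  let ?E = "em_category C T \<eta> \<mu>"
  have C: "category C" using functor_categories[OF T] by blast
  have xy: "x \<in> Obj ?E" "y \<in> Obj ?E" and hh: "h \<in> hom C (fst x) (fst y)"
    and hc: "h \<cdot>\<^bsub>C\<^esub> snd x = snd y \<cdot>\<^bsub>C\<^esub> amap T h"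
    using F unfolding in_hom_em_iff by auto
  have x: "snd x \<in> hom C (omap T (fst x)) (fst x)" and y: "snd y \<in> hom C (omap T (fst y)) (fst y)"
    using xy em_obj_iff by (metis prod.collapse)+
  obtain g where g: "g \<in> hom C (fst y) (fst x)" "g \<cdot>\<^bsub>C\<^esub> h = Ident C (fst x)"
      "h \<cdot>\<^bsub>C\<^esub> g = Ident C (fst y)"
    using isoE[OF h hh] by metis
  have Th: "amap T h \<in> hom C (omap T (fst x)) (omap T (fst y))"
    and Tg: "amap T g \<in> hom C (omap T (fst y)) (omap T (fst x))"
    using functor_hom[OF T] hh g by auto
  have y1: "snd y \<cdot>\<^bsub>C\<^esub> amap T h \<in> hom C (omap T (fst x)) (fst y)"
    using category_comp[OF C Th y] .
  have ThTg: "amap T h \<cdot>\<^bsub>C\<^esub> amap T g = Ident C (omap T (fst y))"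
    using functor_comp[OF T g(1) hh] g(3) functor_ident[OF T] category_hom_objs[OF C hh] by simp
  have "g \<cdot>\<^bsub>C\<^esub> snd y = g \<cdot>\<^bsub>C\<^esub> (snd y \<cdot>\<^bsub>C\<^esub> (amap T h \<cdot>\<^bsub>C\<^esub> amap T g))"
    using ThTg category_comp_ident[OF C y] by simp
  also have "\<dots> = g \<cdot>\<^bsub>C\<^esub> ((h \<cdot>\<^bsub>C\<^esub> snd x) \<cdot>\<^bsub>C\<^esub> amap T g)"
    using category_assoc[OF C Tg Th y] hc by simp
  also have "\<dots> = g \<cdot>\<^bsub>C\<^esub> (h \<cdot>\<^bsub>C\<^esub> (snd x \<cdot>\<^bsub>C\<^esub> amap T g))"
    using category_assoc[OF C Tg x hh] by simp
  also have "\<dots> = (g \<cdot>\<^bsub>C\<^esub> h) \<cdot>\<^bsub>C\<^esub> (snd x \<cdot>\<^bsub>C\<^esub> amap T g)"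
    using category_assoc[OF C category_comp[OF C Tg x] hh g(1)] by simp
  finally have gc: "g \<cdot>\<^bsub>C\<^esub> snd y = snd x \<cdot>\<^bsub>C\<^esub> amap T g"
    using g(2) category_ident_comp[OF C category_comp[OF C Tg x]] by simp
  have "(y, g, x) \<in> hom ?E y x" unfolding in_hom_em_iff using xy g gc by auto
  from isoI[OF F this] show ?thesis using g by simp
qed

text \<open>The unit law of the algebra \<open>G \<epsilon>\<close> is a triangle identity; its associativity law is
  naturality of \<open>\<epsilon>\<close> at \<open>\<epsilon>\<close> itself.\<close>

lemma comparison_functor_is_functor:
  assumes adj: "adjunction C D F G \<eta> \<epsilon>"
  shows "is_functor D (em_category C (comp_func G F) \<eta> (\<lambda>A. amap G (\<epsilon> (omap F A))))
    (comparison_functor D G \<epsilon>)" (is "is_functor D ?E ?K")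
proof -
  have F: "is_functor C D F" and G: "is_functor D C G"
    and \<epsilon>: "nat_trans D D (comp_func F G) id_func \<epsilon>"
    and tri: "\<And>B. B \<in> Obj D \<Longrightarrow> amap G (\<epsilon> B) \<cdot>\<^bsub>C\<^esub> \<eta> (omap G B) = Ident C (omap G B)"
    using adj unfolding adjunction_def by auto
  have C: "category C" and D: "category D" using functor_categories[OF F] by auto
  have T: "is_functor C C (comp_func G F)" using comp_functor[OF F G] .
  have eps: "\<epsilon> X \<in> hom D (omap F (omap G X)) X" if "X \<in> Obj D" for X
    using nat_trans_hom[OF \<epsilon> that] by simp
  have epsnat: "\<epsilon> Y \<cdot>\<^bsub>D\<^esub> amap F (amap G f) = f \<cdot>\<^bsub>D\<^esub> \<epsilon> X" if "f \<in> hom D X Y" for f X Y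
    using nat_trans_natural[OF \<epsilon> that] by simp
  have Geps: "amap G (\<epsilon> Y) \<cdot>\<^bsub>C\<^esub> amap G (amap F (amap G f)) = amap G f \<cdot>\<^bsub>C\<^esub> amap G (\<epsilon> X)"
    if f: "f \<in> hom D X Y" for f X Y
  proof -
    have XY: "X \<in> Obj D" "Y \<in> Obj D" using category_hom_objs[OF D f] by auto
    show ?thesis
      using functor_comp[OF G functor_hom[OF F functor_hom[OF G f]] eps[OF XY(2)]]
        functor_comp[OF G eps[OF XY(1)] f] epsnat[OF f] by simp
  qed
  have K0: "omap ?K X = (omap G X, amap G (\<epsilon> X))" for X
    by (simp add: comparison_functor_def Let_def)
  have K1: "amap ?K f = ((omap G X, amap G (\<epsilon> X)), amap G f, (omap G Y, amap G (\<epsilon> Y)))"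
    if "f \<in> hom D X Y" for f X Y
    using that by (simp add: comparison_functor_def Let_def in_hom_iff)
  have KO: "omap ?K X \<in> Obj ?E" if X: "X \<in> Obj D" for X
    unfolding K0 em_obj_iff
    using functor_obj[OF G X] functor_hom[OF G eps[OF X]] tri[OF X] Geps[OF eps[OF X]] by simp
  show ?thesis
  proof (rule functorI[OF D category_em[OF T]])
    fix f X Y assume f: "f \<in> hom D X Y"
    then have XY: "X \<in> Obj D" "Y \<in> Obj D" using category_hom_objs[OF D] by auto
    show "amap ?K f \<in> hom ?E (omap ?K X) (omap ?K Y)"
      unfolding K1[OF f] in_hom_em_iff using KO XY functor_hom[OF G f] Geps[OF f] by (simp add: K0)
  next
    fix X assume X: "X \<in> Obj D"
    show "amap ?K (Ident D X) = Ident ?E (omap ?K X)"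
      unfolding K1[OF category_ident[OF D X]] using functor_ident[OF G X] by (simp add: K0)
  next
    fix f g X Y Z assume f: "f \<in> hom D X Y" and g: "g \<in> hom D Y Z"
    show "amap ?K (g \<cdot>\<^bsub>D\<^esub> f) = amap ?K g \<cdot>\<^bsub>?E\<^esub> amap ?K f"
      unfolding K1[OF f] K1[OF g] K1[OF category_comp[OF D f g]]
      using functor_comp[OF G f g] by simp
  qed (rule KO)
qed

section \<open>Slices and change of base\<close>

lemma slice_simps [simp]:
  "f \<in> Obj (slice C B) \<longleftrightarrow> f \<in> Arr C \<and> Cod C f = B"
  "Ident (slice C B) f = (f, Ident C (Dom C f), f)"
  "Comp (slice C B) (g', k, l) (f, h, g) = (f, k \<cdot>\<^bsub>C\<^esub> h, l)"
  unfolding slice_def Let_def by auto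

lemma in_hom_slice_iff:
  "F \<in> hom (slice C B) f g \<longleftrightarrow> f \<in> Arr C \<and> Cod C f = B \<and> g \<in> Arr C \<and> Cod C g = B \<and>
     (\<exists>h. F = (f, h, g) \<and> h \<in> hom C (Dom C f) (Dom C g) \<and> g \<cdot>\<^bsub>C\<^esub> h = f)"
  unfolding slice_def Let_def hom_def by auto

lemma category_slice:
  assumes C: "category C"
  shows "category (slice C B)" (is "category ?S")
proof (rule categoryI)
  fix f assume "f \<in> Arr ?S"
  then have "f \<in> hom ?S (Dom ?S f) (Cod ?S f)" by (simp add: in_hom_iff)
  then show "Dom ?S f \<in> Obj ?S \<and> Cod ?S f \<in> Obj ?S" unfolding in_hom_slice_iff by simp
next
  fix A assume A: "A \<in> Obj ?S"
  then have "A \<in> hom C (Dom C A) B" by (simp add: in_hom_iff)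
  then show "Ident ?S A \<in> hom ?S A A"
    using category_hom_objs[OF C] category_ident[OF C] category_comp_ident[OF C] A
    by (auto simp: in_hom_slice_iff)
next
  fix F G f g h assume "F \<in> hom ?S f g" "G \<in> hom ?S g h"
  then obtain k l where F: "F = (f, k, g)" and G: "G = (g, l, h)"
    and fg: "f \<in> Arr C" "Cod C f = B" "h \<in> Arr C" "Cod C h = B"
    and k: "k \<in> hom C (Dom C f) (Dom C g)" "g \<cdot>\<^bsub>C\<^esub> k = f"
    and l: "l \<in> hom C (Dom C g) (Dom C h)" "h \<cdot>\<^bsub>C\<^esub> l = g"
    unfolding in_hom_slice_iff by auto
  have "h \<in> hom C (Dom C h) B" using fg by (simp add: in_hom_iff)
  from category_assoc[OF C k(1) l(1) this] show "G \<cdot>\<^bsub>?S\<^esub> F \<in> hom ?S f h"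
    unfolding in_hom_slice_iff using F G fg k l category_comp[OF C k(1) l(1)] by simp
next
  fix f A D assume "f \<in> hom ?S A D"
  then show "f \<cdot>\<^bsub>?S\<^esub> Ident ?S A = f \<and> Ident ?S D \<cdot>\<^bsub>?S\<^esub> f = f"
    unfolding in_hom_slice_iff using category_comp_ident[OF C] category_ident_comp[OF C] by auto
next
  fix f g h A D E F assume "f \<in> hom ?S A D" "g \<in> hom ?S D E" "h \<in> hom ?S E F"
  then show "h \<cdot>\<^bsub>?S\<^esub> (g \<cdot>\<^bsub>?S\<^esub> f) = (h \<cdot>\<^bsub>?S\<^esub> g) \<cdot>\<^bsub>?S\<^esub> f"
    unfolding in_hom_slice_iff using category_assoc[OF C] by auto
qed

lemma iso_slice:
  assumes C: "category C" and F: "(f, h, g) \<in> hom (slice C B) f g" and h: "iso C h"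
  shows "iso (slice C B) (f, h, g)"
proof -
  have hh: "h \<in> hom C (Dom C f) (Dom C g)" "g \<cdot>\<^bsub>C\<^esub> h = f"
    and fg: "f \<in> Arr C" "Cod C f = B" "g \<in> Arr C" "Cod C g = B"
    using F unfolding in_hom_slice_iff by auto
  obtain k where k: "k \<in> hom C (Dom C g) (Dom C f)" "k \<cdot>\<^bsub>C\<^esub> h = Ident C (Dom C f)"
      "h \<cdot>\<^bsub>C\<^esub> k = Ident C (Dom C g)"
    using isoE[OF h hh(1)] by metis
  have g: "g \<in> hom C (Dom C g) B" using fg by (simp add: in_hom_iff)
  have "f \<cdot>\<^bsub>C\<^esub> k = g"
    using category_assoc[OF C k(1) hh(1) g] hh k category_comp_ident[OF C g] by simp
  then have "(g, k, f) \<in> hom (slice C B) g f" unfolding in_hom_slice_iff using fg k by simp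
  from isoI[OF F this] show ?thesis using k by simp
qed

lemma iso_of_iso_slice:
  assumes "iso (slice C B) (f, h, g)"
  shows "iso C h"
proof -
  obtain k where k: "k \<in> hom (slice C B) g f" "k \<cdot>\<^bsub>slice C B\<^esub> (f, h, g) = Ident (slice C B) f"
      "(f, h, g) \<cdot>\<^bsub>slice C B\<^esub> k = Ident (slice C B) g"
    and F: "(f, h, g) \<in> hom (slice C B) f g"
    using assms unfolding iso_def slice_def Let_def hom_def by auto
  obtain k' where k': "k = (g, k', f)" "k' \<in> hom C (Dom C g) (Dom C f)"
    using k(1) unfolding in_hom_slice_iff by auto
  show ?thesis
    using isoI[of h C "Dom C f" "Dom C g" k'] F k k' unfolding in_hom_slice_iff by auto
qed

text \<open>Composition with \<open>p\<close>, the left adjoint \<open>\<Sigma>\<^sub>p\<close> of \<open>p\<^sup>*\<close>.\<close>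

definition postcomp_functor ::
  "('o, 'a) cat \<Rightarrow> 'a \<Rightarrow> ('a, 'a \<times> 'a \<times> 'a, 'a, 'a \<times> 'a \<times> 'a) func" where
  "postcomp_functor C p =
     \<lparr>omap = (\<lambda>g. p \<cdot>\<^bsub>C\<^esub> g), amap = (\<lambda>(f, h, g). (p \<cdot>\<^bsub>C\<^esub> f, h, p \<cdot>\<^bsub>C\<^esub> g))\<rparr>"

abbreviation pb_top :: "('o, 'a) cat \<Rightarrow> 'a \<Rightarrow> 'a \<Rightarrow> 'a" where
  "pb_top C p f \<equiv> fst (chosen_pullback C p f)"

abbreviation pb_proj :: "('o, 'a) cat \<Rightarrow> 'a \<Rightarrow> 'a \<Rightarrow> 'a" where
  "pb_proj C p f \<equiv> snd (chosen_pullback C p f)"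

text \<open>The morphism of domains underlying \<open>p\<^sup>*(h)\<close>, for \<open>h\<close> from \<open>f\<close> to \<open>g\<close> over the codomain of
  \<open>p\<close>.\<close>

definition pb_map :: "('o, 'a) cat \<Rightarrow> 'a \<Rightarrow> 'a \<Rightarrow> 'a \<Rightarrow> 'a \<Rightarrow> 'a" where
  "pb_map C p f h g =
     (THE k. k \<in> hom C (Dom C (pb_proj C p f)) (Dom C (pb_proj C p g)) \<and>
        pb_top C p g \<cdot>\<^bsub>C\<^esub> k = h \<cdot>\<^bsub>C\<^esub> pb_top C p f \<and> pb_proj C p g \<cdot>\<^bsub>C\<^esub> k = pb_proj C p f)"

text \<open>The unit \<open>x \<mapsto> (x, g x)\<close> of \<open>\<Sigma>\<^sub>p \<stileturn> p\<^sup>*\<close>.\<close>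

definition pb_unit :: "('o, 'a) cat \<Rightarrow> 'a \<Rightarrow> 'a \<Rightarrow> 'a" where
  "pb_unit C p g =
     (THE k. k \<in> hom C (Dom C g) (Dom C (pb_proj C p (p \<cdot>\<^bsub>C\<^esub> g))) \<and>
        pb_top C p (p \<cdot>\<^bsub>C\<^esub> g) \<cdot>\<^bsub>C\<^esub> k = Ident C (Dom C g) \<and> pb_proj C p (p \<cdot>\<^bsub>C\<^esub> g) \<cdot>\<^bsub>C\<^esub> k = g)"

lemma pullback_functor_simps:
  "omap (pullback_functor C p) f = pb_proj C p f"
  "amap (pullback_functor C p) (f, h, g) = (pb_proj C p f, pb_map C p f h g, pb_proj C p g)"
  by (simp_all add: pullback_functor_def Let_def pb_map_def)

lemma postcomp_functor_simps:
  "omap (postcomp_functor C p) g = p \<cdot>\<^bsub>C\<^esub> g"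
  "amap (postcomp_functor C p) (f, h, g) = (p \<cdot>\<^bsub>C\<^esub> f, h, p \<cdot>\<^bsub>C\<^esub> g)"
  by (simp_all add: postcomp_functor_def)

lemma pullback_lift:
  assumes "is_pullback C f g p q" "x \<in> hom C X (Dom C f)" "y \<in> hom C X (Dom C g)"
    "f \<cdot>\<^bsub>C\<^esub> x = g \<cdot>\<^bsub>C\<^esub> y"
  shows "\<exists>!w. w \<in> hom C X (Dom C p) \<and> p \<cdot>\<^bsub>C\<^esub> w = x \<and> q \<cdot>\<^bsub>C\<^esub> w = y"
proof -
  have "x \<in> Arr C" "y \<in> Arr C" "Dom C x = X" "Dom C x = Dom C y" "Cod C x = Dom C f" "Cod C y = Dom C g"
    using assms(2,3) by (auto simp: in_hom_iff)
  then show ?thesis using assms(1,4) unfolding is_pullback_def by blast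
qed

lemma pullback_eqI:
  assumes C: "category C" and pb: "is_pullback C f g p q"
    and w: "w \<in> hom C X (Dom C p)" "w' \<in> hom C X (Dom C p)"
    and eq: "p \<cdot>\<^bsub>C\<^esub> w = p \<cdot>\<^bsub>C\<^esub> w'" "q \<cdot>\<^bsub>C\<^esub> w = q \<cdot>\<^bsub>C\<^esub> w'"
  shows "w = w'"
proof -
  have p: "p \<in> hom C (Dom C p) (Dom C f)" and q: "q \<in> hom C (Dom C p) (Dom C g)"
    and f: "f \<in> hom C (Dom C f) (Cod C f)" and g: "g \<in> hom C (Dom C g) (Cod C f)"
    and sq: "f \<cdot>\<^bsub>C\<^esub> p = g \<cdot>\<^bsub>C\<^esub> q"
    using pb unfolding is_pullback_def by (auto simp: in_hom_iff)
  have "f \<cdot>\<^bsub>C\<^esub> (p \<cdot>\<^bsub>C\<^esub> w) = g \<cdot>\<^bsub>C\<^esub> (q \<cdot>\<^bsub>C\<^esub> w)"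
    using category_assoc[OF C w(1) p f] category_assoc[OF C w(1) q g] sq by simp
  from pullback_lift[OF pb category_comp[OF C w(1) p] category_comp[OF C w(1) q] this]
  show ?thesis using w eq by metis
qed

locale base_change =
  fixes C :: "('o, 'a) cat" (structure) and p :: 'a and E B :: 'o
  assumes C: "category C" and p: "p \<in> hom C E B"
    and pullbacks: "\<And>f. f \<in> Arr C \<Longrightarrow> Cod C f = B \<Longrightarrow> \<exists>a b. is_pullback C f p a b"
begin

abbreviation "ptop \<equiv> pb_top C p"
abbreviation "pr \<equiv> pb_proj C p"
abbreviation "src \<equiv> Dom C"
abbreviation "P f \<equiv> src (pr f)"

abbreviation over :: "'a \<Rightarrow> 'o \<Rightarrow> bool" where
  "over f A \<equiv> f \<in> hom C (src f) A"

lemma chosen: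
  assumes "over f B"
  shows "is_pullback C f p (ptop f) (pr f)"
  using someI_ex[of "\<lambda>ab. is_pullback C f p (fst ab) (snd ab)"] pullbacks[of f] assms
  by (force simp: chosen_pullback_def in_hom_iff case_prod_unfold)

lemma top_hom: "over f B \<Longrightarrow> ptop f \<in> hom C (P f) (src f)"
  and pr_hom: "over f B \<Longrightarrow> pr f \<in> hom C (P f) E"
  and square: "over f B \<Longrightarrow> f \<cdot> ptop f = p \<cdot> pr f"
  using chosen[of f] p unfolding is_pullback_def in_hom_iff by auto

lemma lift:
  assumes "over f B" "x \<in> hom C X (src f)" "y \<in> hom C X E" "f \<cdot> x = p \<cdot> y"
  shows "\<exists>!w. w \<in> hom C X (P f) \<and> ptop f \<cdot> w = x \<and> pr f \<cdot> w = y"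
proof -
  have "src p = E" "src (ptop f) = P f"
    using p top_hom[OF assms(1)] by (auto simp: in_hom_iff)
  then show ?thesis
    using pullback_lift[OF chosen[OF assms(1)], of x X y] assms by metis
qed

lemma eqI:
  assumes "over f B" "w \<in> hom C X (P f)" "w' \<in> hom C X (P f)"
    "ptop f \<cdot> w = ptop f \<cdot> w'" "pr f \<cdot> w = pr f \<cdot> w'"
  shows "w = w'"
  using pullback_eqI[OF C chosen[OF assms(1)], of w X w'] assms top_hom[OF assms(1)]
  by (simp add: in_hom_iff)

lemma pb_map:
  assumes f: "over f B" and g: "over g B" and h: "h \<in> hom C (src f) (src g)" "g \<cdot> h = f"
  shows "pb_map C p f h g \<in> hom C (P f) (P g)"
    and "ptop g \<cdot> pb_map C p f h g = h \<cdot> ptop f"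
    and "pr g \<cdot> pb_map C p f h g = pr f"
proof -
  have eq: "g \<cdot> (h \<cdot> ptop f) = p \<cdot> pr f"
    using category_assoc[OF C top_hom[OF f] h(1) g] h(2) square[OF f] by simp
  from theI'[OF lift[OF g category_comp[OF C top_hom[OF f] h(1)] pr_hom[OF f] eq]]
  show "pb_map C p f h g \<in> hom C (P f) (P g)"
    "ptop g \<cdot> pb_map C p f h g = h \<cdot> ptop f" "pr g \<cdot> pb_map C p f h g = pr f"
    unfolding pb_map_def by auto
qed

lemma pb_map_eqI:
  assumes f: "over f B" and g: "over g B" and h: "h \<in> hom C (src f) (src g)" "g \<cdot> h = f"
    and k: "k \<in> hom C (P f) (P g)" "ptop g \<cdot> k = h \<cdot> ptop f" "pr g \<cdot> k = pr f"
  shows "pb_map C p f h g = k"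
  using eqI[OF g pb_map(1)[OF f g h] k(1)] pb_map(2,3)[OF f g h] k by simp

lemma p_over: "over g E \<Longrightarrow> over (p \<cdot> g) B" "over g E \<Longrightarrow> src (p \<cdot> g) = src g"
  using category_comp[OF C _ p, of g] by (auto simp: in_hom_iff)

lemma ident_hom: "f \<in> hom C X Y \<Longrightarrow> Ident C X \<in> hom C X X" "f \<in> hom C X Y \<Longrightarrow> Ident C Y \<in> hom C Y Y"
  using category_hom_objs[OF C] category_ident[OF C] by blast+

lemma pb_unit:
  assumes g: "over g E"
  shows "pb_unit C p g \<in> hom C (src g) (P (p \<cdot> g))"
    and "ptop (p \<cdot> g) \<cdot> pb_unit C p g = Ident C (src g)"
    and "pr (p \<cdot> g) \<cdot> pb_unit C p g = g"
proof -
  note pg = p_over[OF g]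
  have id: "Ident C (src g) \<in> hom C (src g) (src (p \<cdot> g))" using ident_hom(1)[OF g] pg(2) by simp
  have "(p \<cdot> g) \<cdot> Ident C (src g) = p \<cdot> g"
    using category_comp_ident[OF C pg(1)] pg(2) by simp
  from theI'[OF lift[OF pg(1) id g this]]
  show "pb_unit C p g \<in> hom C (src g) (P (p \<cdot> g))"
    "ptop (p \<cdot> g) \<cdot> pb_unit C p g = Ident C (src g)"
    "pr (p \<cdot> g) \<cdot> pb_unit C p g = g"
    unfolding pb_unit_def by auto
qed

lemma pr_over: "over f B \<Longrightarrow> over (pr f) E"
  using pr_hom .

abbreviation "pull \<equiv> pullback_functor C p"
abbreviation "post \<equiv> postcomp_functor C p"
abbreviation "unit g \<equiv> (g, pb_unit C p g, pr (p \<cdot> g))"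
abbreviation "counit f \<equiv> (p \<cdot> pr f, ptop f, f)"

lemma slice_hom:
  "F \<in> hom (slice C A) f g \<longleftrightarrow> over f A \<and> over g A \<and>
     (\<exists>h. F = (f, h, g) \<and> h \<in> hom C (src f) (src g) \<and> g \<cdot> h = f)"
  unfolding in_hom_slice_iff by (auto simp: in_hom_iff)

lemma slice_obj: "f \<in> Obj (slice C A) \<longleftrightarrow> over f A"
  by (auto simp: in_hom_iff)

lemma post_functor: "is_functor (slice C E) (slice C B) post"
proof (rule functorI[OF category_slice[OF C] category_slice[OF C]])
  fix f assume "f \<in> Obj (slice C E)"
  then show "omap post f \<in> Obj (slice C B)"
    using p_over unfolding slice_obj by (simp add: postcomp_functor_simps)
next
  fix F f g assume "F \<in> hom (slice C E) f g"
  then obtain h where F: "F = (f, h, g)" and f: "over f E" and g: "over g E"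
    and h: "h \<in> hom C (src f) (src g)" "g \<cdot> h = f" unfolding slice_hom by blast
  then show "amap post F \<in> hom (slice C B) (omap post f) (omap post g)"
    unfolding slice_hom using p_over[OF f] p_over[OF g] category_assoc[OF C h(1) g p]
    by (simp add: postcomp_functor_simps)
next
  fix f assume "f \<in> Obj (slice C E)"
  then show "amap post (Ident (slice C E) f) = Ident (slice C B) (omap post f)"
    using p_over unfolding slice_obj by (simp add: postcomp_functor_simps)
next
  fix F G f g h assume "F \<in> hom (slice C E) f g" "G \<in> hom (slice C E) g h"
  then show "amap post (G \<cdot>\<^bsub>slice C E\<^esub> F) = amap post G \<cdot>\<^bsub>slice C B\<^esub> amap post F"
    unfolding slice_hom by (auto simp: postcomp_functor_simps)
qed

lemma pull_functor: "is_functor (slice C B) (slice C E) pull"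
proof (rule functorI[OF category_slice[OF C] category_slice[OF C]])
  fix f assume "f \<in> Obj (slice C B)"
  then show "omap pull f \<in> Obj (slice C E)"
    using pr_over unfolding slice_obj by (simp add: pullback_functor_simps)
next
  fix F f g assume "F \<in> hom (slice C B) f g"
  then obtain h where F: "F = (f, h, g)" and f: "over f B" and g: "over g B"
    and h: "h \<in> hom C (src f) (src g)" "g \<cdot> h = f" unfolding slice_hom by blast
  then show "amap pull F \<in> hom (slice C E) (omap pull f) (omap pull g)"
    unfolding slice_hom using pr_over[OF f] pr_over[OF g] pb_map[OF f g h]
    by (simp add: pullback_functor_simps)
next
  fix f assume "f \<in> Obj (slice C B)"
  then have f: "over f B" unfolding slice_obj .
  have "pb_map C p f (Ident C (src f)) f = Ident C (P f)"
    using ident_hom(1)[OF f] ident_hom(1)[OF pr_hom[OF f]] category_comp_ident[OF C f]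
      category_comp_ident[OF C top_hom[OF f]] category_ident_comp[OF C top_hom[OF f]]
      category_comp_ident[OF C pr_hom[OF f]]
    by (intro pb_map_eqI[OF f f]) simp_all
  then show "amap pull (Ident (slice C B) f) = Ident (slice C E) (omap pull f)"
    by (simp add: pullback_functor_simps)
next
  fix F G f g h assume "F \<in> hom (slice C B) f g" "G \<in> hom (slice C B) g h"
  then obtain k l where F: "F = (f, k, g)" and G: "G = (g, l, h)"
    and f: "over f B" and g: "over g B" and h: "over h B"
    and k: "k \<in> hom C (src f) (src g)" "g \<cdot> k = f"
    and l: "l \<in> hom C (src g) (src h)" "h \<cdot> l = g" unfolding slice_hom by blast
  note K = pb_map[OF f g k] and L = pb_map[OF g h l]
  have 1: "ptop h \<cdot> (pb_map C p g l h \<cdot> pb_map C p f k g) = (l \<cdot> k) \<cdot> ptop f"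
    using category_assoc[OF C K(1) L(1) top_hom[OF h]] category_assoc[OF C K(1) top_hom[OF g] l(1)]
      category_assoc[OF C top_hom[OF f] k(1) l(1)] K L by simp
  have 2: "pr h \<cdot> (pb_map C p g l h \<cdot> pb_map C p f k g) = pr f"
    using category_assoc[OF C K(1) L(1) pr_hom[OF h]] K L by simp
  have "pb_map C p f (l \<cdot> k) h = pb_map C p g l h \<cdot> pb_map C p f k g"
    using category_assoc[OF C k(1) l(1) h] k l
    by (intro pb_map_eqI[OF f h category_comp[OF C k(1) l(1)] _ category_comp[OF C K(1) L(1)] 1 2])
      simp
  then show "amap pull (G \<cdot>\<^bsub>slice C B\<^esub> F) = amap pull G \<cdot>\<^bsub>slice C E\<^esub> amap pull F"
    by (simp add: pullback_functor_simps F G)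
qed

lemma pull_adjunction: "adjunction (slice C E) (slice C B) post pull unit counit"
proof -
  have tp: "ptop f \<in> hom C (src (p \<cdot> pr f)) (src f)" if "over f B" for f
    using top_hom[OF that] p_over(2)[OF pr_over[OF that]] by simp
  have un: "nat_trans (slice C E) (slice C E) id_func (comp_func pull post) unit"
  proof (rule nat_transI[OF id_functor[OF category_slice[OF C]] comp_functor[OF post_functor pull_functor]])
    fix g assume "g \<in> Obj (slice C E)"
    then have g: "over g E" unfolding slice_obj .
    show "unit g \<in> hom (slice C E) (omap id_func g) (omap (comp_func pull post) g)"
      unfolding slice_hom using g pr_over[OF p_over(1)[OF g]] pb_unit[OF g]
      by (simp add: pullback_functor_simps postcomp_functor_simps)
  next
    fix F f g assume "F \<in> hom (slice C E) f g"
    then obtain h where F: "F = (f, h, g)" and f: "over f E" and g: "over g E"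
      and h: "h \<in> hom C (src f) (src g)" "g \<cdot> h = f" unfolding slice_hom by blast
    note pf = p_over[OF f] and pg = p_over[OF g] and uf = pb_unit[OF f] and ug = pb_unit[OF g]
    have h': "h \<in> hom C (src (p \<cdot> f)) (src (p \<cdot> g))" using h pf pg by simp
    have h'': "(p \<cdot> g) \<cdot> h = p \<cdot> f" using category_assoc[OF C h(1) g p] h by simp
    note m = pb_map[OF pf(1) pg(1) h' h'']
    have tg: "ptop (p \<cdot> g) \<in> hom C (P (p \<cdot> g)) (src g)" using top_hom[OF pg(1)] pg(2) by simp
    have tf: "ptop (p \<cdot> f) \<in> hom C (P (p \<cdot> f)) (src f)" using top_hom[OF pf(1)] pf(2) by simp
    have "pb_unit C p g \<cdot> h = pb_map C p (p \<cdot> f) h (p \<cdot> g) \<cdot> pb_unit C p f"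
    proof (rule eqI[OF pg(1) category_comp[OF C h(1) ug(1)] category_comp[OF C uf(1) m(1)]])
      show "ptop (p \<cdot> g) \<cdot> (pb_unit C p g \<cdot> h) = ptop (p \<cdot> g) \<cdot>
          (pb_map C p (p \<cdot> f) h (p \<cdot> g) \<cdot> pb_unit C p f)"
        using category_assoc[OF C h(1) ug(1) tg] category_assoc[OF C uf(1) m(1) tg] m uf ug
          category_assoc[OF C uf(1) tf h(1)] category_ident_comp[OF C h(1)]
          category_comp_ident[OF C h(1)] by simp
      show "pr (p \<cdot> g) \<cdot> (pb_unit C p g \<cdot> h) = pr (p \<cdot> g) \<cdot>
          (pb_map C p (p \<cdot> f) h (p \<cdot> g) \<cdot> pb_unit C p f)"
        using category_assoc[OF C h(1) ug(1) pr_hom[OF pg(1)]] h m uf ug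
          category_assoc[OF C uf(1) m(1) pr_hom[OF pg(1)]] by simp
    qed
    then show "unit g \<cdot>\<^bsub>slice C E\<^esub> amap id_func F =
        amap (comp_func pull post) F \<cdot>\<^bsub>slice C E\<^esub> unit f"
      by (simp add: F pullback_functor_simps postcomp_functor_simps)
  qed
  have co: "nat_trans (slice C B) (slice C B) (comp_func post pull) id_func counit"
  proof (rule nat_transI[OF comp_functor[OF pull_functor post_functor] id_functor[OF category_slice[OF C]]])
    fix f assume "f \<in> Obj (slice C B)"
    then have f: "over f B" unfolding slice_obj .
    show "counit f \<in> hom (slice C B) (omap (comp_func post pull) f) (omap id_func f)"
      unfolding slice_hom using f p_over[OF pr_over[OF f]] top_hom[OF f] square[OF f]
      by (simp add: pullback_functor_simps postcomp_functor_simps)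
  next
    fix F f g assume "F \<in> hom (slice C B) f g"
    then obtain h where F: "F = (f, h, g)" and f: "over f B" and g: "over g B"
      and h: "h \<in> hom C (src f) (src g)" "g \<cdot> h = f" unfolding slice_hom by blast
    show "counit g \<cdot>\<^bsub>slice C B\<^esub> amap (comp_func post pull) F =
        amap id_func F \<cdot>\<^bsub>slice C B\<^esub> counit f"
      by (simp add: F pullback_functor_simps postcomp_functor_simps pb_map[OF f g h])
  qed
  have tri1: "counit (omap post g) \<cdot>\<^bsub>slice C B\<^esub> amap post (unit g) = Ident (slice C B) (omap post g)"
    if "g \<in> Obj (slice C E)" for g
  proof -
    have g: "over g E" using that unfolding slice_obj .
    show ?thesis using pb_unit(2)[OF g] p_over(2)[OF g]
      by (simp add: postcomp_functor_simps)
  qed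
  have tri2: "amap pull (counit f) \<cdot>\<^bsub>slice C E\<^esub> unit (omap pull f) = Ident (slice C E) (omap pull f)"
    if "f \<in> Obj (slice C B)" for f
  proof -
    have f: "over f B" using that unfolding slice_obj .
    note q = pr_over[OF f] and pq = p_over[OF pr_over[OF f]]
    note u = pb_unit[OF q] and m = pb_map[OF pq(1) f tp[OF f] square[OF f]]
    have tq: "ptop (p \<cdot> pr f) \<in> hom C (P (p \<cdot> pr f)) (P f)" using top_hom[OF pq(1)] pq(2) by simp
    have "pb_map C p (p \<cdot> pr f) (ptop f) f \<cdot> pb_unit C p (pr f) = Ident C (P f)"
    proof (rule eqI[OF f category_comp[OF C u(1) m(1)] ident_hom(1)[OF q]])
      show "ptop f \<cdot> (pb_map C p (p \<cdot> pr f) (ptop f) f \<cdot> pb_unit C p (pr f)) =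
          ptop f \<cdot> Ident C (P f)"
        using category_assoc[OF C u(1) m(1) top_hom[OF f]] m u
          category_assoc[OF C u(1) tq top_hom[OF f]] by simp
      show "pr f \<cdot> (pb_map C p (p \<cdot> pr f) (ptop f) f \<cdot> pb_unit C p (pr f)) =
          pr f \<cdot> Ident C (P f)"
        using category_assoc[OF C u(1) m(1) pr_hom[OF f]] m u category_comp_ident[OF C q] by simp
    qed
    then show ?thesis by (simp add: pullback_functor_simps)
  qed
  show ?thesis unfolding adjunction_def using post_functor pull_functor un co tri1 tri2 by blast
qed

text \<open>For the monad of this adjunction an algebra on \<open>g : X \<rightarrow> E\<close> is a morphism
  \<open>X \<times>\<^sub>B E \<rightarrow> X\<close> over \<open>E\<close>, that is, a descent datum.  The two hypotheses say, in these terms, that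
  morphisms compatible with the canonical descent data descend uniquely, and that every
  descent datum is effective.\<close>

lemma effective_descentI:
  assumes ff: "\<And>f g k. over f B \<Longrightarrow> over g B \<Longrightarrow> k \<in> hom C (P f) (P g) \<Longrightarrow> pr g \<cdot> k = pr f \<Longrightarrow>
        k \<cdot> pb_map C p (p \<cdot> pr f) (ptop f) f =
        pb_map C p (p \<cdot> pr g) (ptop g) g \<cdot> pb_map C p (p \<cdot> pr f) k (p \<cdot> pr g) \<Longrightarrow>
        \<exists>!h. h \<in> hom C (src f) (src g) \<and> g \<cdot> h = f \<and> pb_map C p f h g = k"
    and es: "\<And>g a. over g E \<Longrightarrow> a \<in> hom C (P (p \<cdot> g)) (src g) \<Longrightarrow> g \<cdot> a = pr (p \<cdot> g) \<Longrightarrow>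
        a \<cdot> pb_unit C p g = Ident C (src g) \<Longrightarrow>
        a \<cdot> pb_map C p (p \<cdot> pr (p \<cdot> g)) a (p \<cdot> g) =
        a \<cdot> pb_map C p (p \<cdot> pr (p \<cdot> g)) (ptop (p \<cdot> g)) (p \<cdot> g) \<Longrightarrow>
        \<exists>f \<phi>. over f B \<and> \<phi> \<in> hom C (P f) (src g) \<and> iso C \<phi> \<and> g \<cdot> \<phi> = pr f \<and>
          \<phi> \<cdot> pb_map C p (p \<cdot> pr f) (ptop f) f =
          a \<cdot> pb_map C p (p \<cdot> pr f) \<phi> (p \<cdot> g)"
  shows "effective_descent C p"
proof -
  let ?T = "comp_func pull post"
  let ?EM = "em_category (slice C E) ?T unit (\<lambda>A. amap pull (counit (omap post A)))"
  let ?K = "comparison_functor (slice C B) pull counit"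
  have K: "is_functor (slice C B) ?EM ?K"
    by (rule comparison_functor_is_functor[OF pull_adjunction])
  have T: "is_functor (slice C E) (slice C E) ?T" by (rule comp_functor[OF post_functor pull_functor])
  have K0: "omap ?K f = (pr f, (pr (p \<cdot> pr f), pb_map C p (p \<cdot> pr f) (ptop f) f, pr f))" for f
    by (simp add: comparison_functor_def Let_def pullback_functor_simps)
  have K1: "amap ?K (f, h, g) = (omap ?K f, (pr f, pb_map C p f h g, pr g), omap ?K g)" for f h g
    unfolding K0 by (simp add: comparison_functor_def Let_def pullback_functor_simps slice_def)
  have "equivalence (slice C B) ?EM ?K"
  proof (rule equivalence_of_fully_faithful_essentially_surjective[OF K])
    fix f g H assume "f \<in> Obj (slice C B)" "g \<in> Obj (slice C B)"
      and H: "H \<in> hom ?EM (omap ?K f) (omap ?K g)"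
    then have f: "over f B" and g: "over g B" unfolding slice_obj by auto
    obtain s where s: "H = (omap ?K f, s, omap ?K g)" "s \<in> hom (slice C E) (pr f) (pr g)"
        "s \<cdot>\<^bsub>slice C E\<^esub> snd (omap ?K f) = snd (omap ?K g) \<cdot>\<^bsub>slice C E\<^esub> amap ?T s"
      using H unfolding in_hom_em_iff by (auto simp: K0)
    obtain k where k: "s = (pr f, k, pr g)" "k \<in> hom C (P f) (P g)" "pr g \<cdot> k = pr f"
      using s(2) unfolding slice_hom by auto
    have "k \<cdot> pb_map C p (p \<cdot> pr f) (ptop f) f =
        pb_map C p (p \<cdot> pr g) (ptop g) g \<cdot> pb_map C p (p \<cdot> pr f) k (p \<cdot> pr g)"
      using s(3) by (simp add: k(1) K0 pullback_functor_simps postcomp_functor_simps)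
    from ff[OF f g k(2,3) this] obtain h where h: "h \<in> hom C (src f) (src g)" "g \<cdot> h = f"
        "pb_map C p f h g = k"
      and uniq: "\<And>h'. h' \<in> hom C (src f) (src g) \<and> g \<cdot> h' = f \<and> pb_map C p f h' g = k \<Longrightarrow> h' = h"
      by metis
    show "\<exists>!F. F \<in> hom (slice C B) f g \<and> amap ?K F = H"
    proof (rule ex1I[of _ "(f, h, g)"])
      show "(f, h, g) \<in> hom (slice C B) f g \<and> amap ?K (f, h, g) = H"
        unfolding slice_hom K1 using f g h s(1) k(1) by simp
      fix F assume F: "F \<in> hom (slice C B) f g \<and> amap ?K F = H"
      then obtain h' where h': "F = (f, h', g)" "h' \<in> hom C (src f) (src g)" "g \<cdot> h' = f"
        unfolding slice_hom by auto
      then have "pb_map C p f h' g = k" using F K1[of f h' g] s(1) k(1) by simp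
      then show "F = (f, h, g)" using uniq h' by simp
    qed
  next
    fix Y assume Y: "Y \<in> Obj ?EM"
    obtain g s where Yg: "Y = (g, s)" by (cases Y)
    have "g \<in> Obj (slice C E)" and s: "s \<in> hom (slice C E) (omap ?T g) g"
      and s1: "s \<cdot>\<^bsub>slice C E\<^esub> unit g = Ident (slice C E) g"
      and s2: "s \<cdot>\<^bsub>slice C E\<^esub> amap ?T s = s \<cdot>\<^bsub>slice C E\<^esub> amap pull (counit (omap post g))"
      using Y unfolding Yg em_obj_iff by auto
    then have g: "over g E" unfolding slice_obj by simp
    obtain a where a: "s = (pr (p \<cdot> g), a, g)" "a \<in> hom C (P (p \<cdot> g)) (src g)"
        "g \<cdot> a = pr (p \<cdot> g)"
      using s unfolding slice_hom by (auto simp: pullback_functor_simps postcomp_functor_simps)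
    have a1: "a \<cdot> pb_unit C p g = Ident C (src g)" using s1 by (simp add: a(1))
    have a2: "a \<cdot> pb_map C p (p \<cdot> pr (p \<cdot> g)) a (p \<cdot> g) =
        a \<cdot> pb_map C p (p \<cdot> pr (p \<cdot> g)) (ptop (p \<cdot> g)) (p \<cdot> g)"
      using s2 by (simp add: a(1) pullback_functor_simps postcomp_functor_simps)
    from es[OF g a(2,3) a1 a2] obtain f \<phi> where f: "over f B" and
      \<phi>: "\<phi> \<in> hom C (P f) (src g)" "iso C \<phi>" "g \<cdot> \<phi> = pr f"
        "\<phi> \<cdot> pb_map C p (p \<cdot> pr f) (ptop f) f = a \<cdot> pb_map C p (p \<cdot> pr f) \<phi> (p \<cdot> g)"
      by blast
    have fo: "f \<in> Obj (slice C B)" unfolding slice_obj by (rule f)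
    have sl: "(pr f, \<phi>, g) \<in> hom (slice C E) (pr f) g"
      unfolding slice_hom using g pr_over[OF f] \<phi> by simp
    have "(omap ?K f, (pr f, \<phi>, g), Y) \<in> hom ?EM (omap ?K f) Y"
      unfolding in_hom_em_iff using Y functor_obj[OF K fo] sl \<phi>(4)
      by (simp add: Yg K0 a(1) pullback_functor_simps postcomp_functor_simps)
    moreover from this have "iso ?EM (omap ?K f, (pr f, \<phi>, g), Y)"
      by (rule iso_em[OF T]) (rule iso_slice[OF C sl \<phi>(2)])
    ultimately show "\<exists>A i. A \<in> Obj (slice C B) \<and> i \<in> hom ?EM (omap ?K A) Y \<and> iso ?EM i"
      using fo by blast
  qed
  then have "monadic (slice C B) (slice C E) pull"
    unfolding monadic_def using pull_adjunction by blast
  then show ?thesis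
    using p by (auto simp: effective_descent_def in_hom_iff)
qed

text \<open>A monadic functor reflects isomorphisms, because the comparison functor does and an
  algebra morphism is invertible as soon as its underlying morphism is.\<close>

lemma effective_descent_reflects_iso:
  assumes ed: "effective_descent C p" and f: "over f B" and g: "over g B"
    and h: "h \<in> hom C (src f) (src g)" "g \<cdot> h = f" and i: "iso C (pb_map C p f h g)"
  shows "iso C h"
proof -
  have "monadic (slice C B) (slice C E) pull"
    using ed p by (auto simp: effective_descent_def in_hom_iff)
  then obtain F \<eta> \<epsilon> where adj: "adjunction (slice C E) (slice C B) F pull \<eta> \<epsilon>"
    and eq: "equivalence (slice C B) (em_category (slice C E) (comp_func pull F) \<eta>
        (\<lambda>A. amap pull (\<epsilon> (omap F A)))) (comparison_functor (slice C B) pull \<epsilon>)"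
    (is "equivalence _ ?EM ?K")
    unfolding monadic_def by blast
  have FF: "is_functor (slice C E) (slice C B) F" using adj by (simp add: adjunction_def)
  have T: "is_functor (slice C E) (slice C E) (comp_func pull F)"
    by (rule comp_functor[OF FF pull_functor])
  have KF: "is_functor (slice C B) ?EM ?K" using eq by (simp add: equivalence_def)
  have fhg: "(f, h, g) \<in> hom (slice C B) f g" unfolding slice_hom using f g h by simp
  have K1: "amap ?K (f, h, g) = (omap ?K f, (pr f, pb_map C p f h g, pr g), omap ?K g)"
    by (simp add: comparison_functor_def Let_def pullback_functor_simps slice_def)
  have "(pr f, pb_map C p f h g, pr g) \<in> hom (slice C E) (pr f) (pr g)"
    unfolding slice_hom using pr_over f g pb_map[OF f g h] by simp
  from iso_slice[OF C this i] have "iso (slice C E) (pr f, pb_map C p f h g, pr g)" .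
  then have "iso ?EM (amap ?K (f, h, g))"
    using functor_hom[OF KF fhg] unfolding K1 by (intro iso_em[OF T]) auto
  from equivalence_reflects_iso[OF eq fhg this] show ?thesis by (rule iso_of_iso_slice)
qed

end

section \<open>Diagrams of small sets, elementwise\<close>

text \<open>Morphisms of sets are triples of domain, function and codomain, and transformations are
  triples whose middle part consists of such morphisms. The following two constants extract the
  underlying functions, so that diagrams can be handled by their elements.\<close>

definition act :: "('j, 'k, 'u) diagram \<Rightarrow> 'k \<Rightarrow> 'u \<Rightarrow> 'u" where
  "act F f = fst (snd (amap F f))"

definition app :: "('j, 'k, 'u) transformation \<Rightarrow> 'j \<Rightarrow> 'u \<Rightarrow> 'u" where
  "app t j = fst (snd (fst (snd t) j))"

lemma in_hom_set_cat_iff: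
  "m \<in> hom set_cat A B \<longleftrightarrow> (\<exists>\<phi>. m = (A, \<phi>, B) \<and>
     small TYPE('u) A \<and> small TYPE('u) B \<and> \<phi> \<in> A \<rightarrow>\<^sub>E (B :: 'u set))"
  unfolding set_cat_def hom_def by auto

lemma set_cat_simps [simp]:
  "A \<in> Obj set_cat \<longleftrightarrow> small TYPE('u) (A :: 'u set)"
  "Ident set_cat A = (A, \<lambda>x\<in>A. x, A)"
  "Comp set_cat (B', g, D) (A, f, B) = (A, \<lambda>x\<in>A. g (f x), D)"
  unfolding set_cat_def by auto

lemma category_set_cat: "category set_cat"
proof (rule categoryI)
  fix f :: "'u mapping" assume "f \<in> Arr set_cat"
  then have "f \<in> hom set_cat (Dom set_cat f) (Cod set_cat f)" by (simp add: in_hom_iff)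
  then show "Dom set_cat f \<in> Obj set_cat \<and> Cod set_cat f \<in> Obj set_cat"
    unfolding in_hom_set_cat_iff by auto
next
  fix A :: "'u set" assume "A \<in> Obj set_cat"
  then show "Ident set_cat A \<in> hom set_cat A A" unfolding in_hom_set_cat_iff by auto
next
  fix f g and A B D :: "'u set" assume "f \<in> hom set_cat A B" "g \<in> hom set_cat B D"
  then show "g \<cdot>\<^bsub>set_cat\<^esub> f \<in> hom set_cat A D"
    unfolding in_hom_set_cat_iff by (auto simp: PiE_iff)
next
  fix f and A B :: "'u set" assume "f \<in> hom set_cat A B"
  then show "f \<cdot>\<^bsub>set_cat\<^esub> Ident set_cat A = f \<and> Ident set_cat B \<cdot>\<^bsub>set_cat\<^esub> f = f"
    unfolding in_hom_set_cat_iff by (auto intro!: ext simp: PiE_iff extensional_def) metis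
next
  fix f g h and A B D E :: "'u set"
  assume "f \<in> hom set_cat A B" "g \<in> hom set_cat B D" "h \<in> hom set_cat D E"
  then show "h \<cdot>\<^bsub>set_cat\<^esub> (g \<cdot>\<^bsub>set_cat\<^esub> f) = (h \<cdot>\<^bsub>set_cat\<^esub> g) \<cdot>\<^bsub>set_cat\<^esub> f"
    unfolding in_hom_set_cat_iff by (auto intro!: ext simp: PiE_iff)
qed

text \<open>The parameter \<open>u\<close> only names the type that serves as universe.\<close>

locale small_index =
  fixes J :: "('j, 'k) cat" and u :: "'u itself"
  assumes universe: "set_universe u" and small_J: "small_category u J"
begin

abbreviation S :: "(('j, 'k, 'u) diagram, ('j, 'k, 'u) transformation) cat" where
  "S \<equiv> set_functors J"

abbreviation comp_S (infixl "\<odot>" 70) where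
  "s \<odot> t \<equiv> s \<cdot>\<^bsub>S\<^esub> t"

abbreviation el :: "('j, 'k, 'u) diagram \<Rightarrow> 'j \<Rightarrow> 'u set" where
  "el F j \<equiv> omap F j"

lemma category_J: "category J"
  using small_J by (simp add: small_category_def)

lemma J_objs: "f \<in> hom J i k \<Longrightarrow> i \<in> Obj J" "f \<in> hom J i k \<Longrightarrow> k \<in> Obj J"
  using category_hom_objs[OF category_J] by blast+

lemma in_Obj_S_iff:
  "F \<in> Obj S \<longleftrightarrow> is_functor J set_cat F \<and> omap F \<in> extensional (Obj J) \<and> amap F \<in> extensional (Arr J)"
  by (simp add: functor_category_def Let_def)

lemma in_hom_S_iff:
  "t \<in> hom S F G \<longleftrightarrow> (\<exists>\<phi>. t = (F, \<phi>, G) \<and> F \<in> Obj S \<and> G \<in> Obj S \<and>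
     nat_trans J set_cat F G \<phi> \<and> \<phi> \<in> extensional (Obj J))"
  unfolding hom_def by (auto simp: functor_category_def Let_def)

lemma S_simps:
  "Ident S F = (F, \<lambda>j\<in>Obj J. Ident set_cat (omap F j), F)"
  "Comp S (G', s, H) (F, t, G) = (F, \<lambda>j\<in>Obj J. s j \<cdot>\<^bsub>set_cat\<^esub> t j, H)"
  by (simp_all add: functor_category_def Let_def)

lemma amap_eq:
  assumes "F \<in> Obj S" "f \<in> hom J i k"
  shows "amap F f = (el F i, act F f, el F k)" "act F f \<in> el F i \<rightarrow>\<^sub>E el F k"
proof -
  have "amap F f \<in> hom set_cat (el F i) (el F k)"
    using assms functor_hom[of J set_cat F] by (simp add: in_Obj_S_iff)
  then show "amap F f = (el F i, act F f, el F k)" "act F f \<in> el F i \<rightarrow>\<^sub>E el F k"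
    unfolding in_hom_set_cat_iff by (auto simp: act_def)
qed

lemma small_el: "F \<in> Obj S \<Longrightarrow> j \<in> Obj J \<Longrightarrow> small TYPE('u) (el F j)"
  using functor_obj[of J set_cat F j] by (simp add: in_Obj_S_iff)

lemma act_in: "F \<in> Obj S \<Longrightarrow> f \<in> hom J i k \<Longrightarrow> x \<in> el F i \<Longrightarrow> act F f x \<in> el F k"
  using PiE_mem[OF amap_eq(2)] .

lemma act_ident:
  assumes "F \<in> Obj S" "i \<in> Obj J" "x \<in> el F i"
  shows "act F (Ident J i) x = x"
  using assms functor_ident[of J set_cat F i] by (simp add: act_def in_Obj_S_iff)

lemma act_comp:
  assumes "F \<in> Obj S" "f \<in> hom J i k" "g \<in> hom J k l" "x \<in> el F i"
  shows "act F (g \<cdot>\<^bsub>J\<^esub> f) x = act F g (act F f x)"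
proof -
  have "amap F (g \<cdot>\<^bsub>J\<^esub> f) = (el F k, act F g, el F l) \<cdot>\<^bsub>set_cat\<^esub> (el F i, act F f, el F k)"
    using functor_comp[of J set_cat F f i k g l] assms amap_eq(1)[OF assms(1,2)]
      amap_eq(1)[OF assms(1,3)] by (simp add: in_Obj_S_iff)
  then show ?thesis using assms by (simp add: act_def)
qed

lemma component_eq:
  assumes "t \<in> hom S F G" "j \<in> Obj J"
  shows "fst (snd t) j = (el F j, app t j, el G j)" "app t j \<in> el F j \<rightarrow>\<^sub>E el G j"
proof -
  have "fst (snd t) j \<in> hom set_cat (el F j) (el G j)"
    using assms nat_trans_hom[of J set_cat F G] by (auto simp: in_hom_S_iff)
  then show "fst (snd t) j = (el F j, app t j, el G j)" "app t j \<in> el F j \<rightarrow>\<^sub>E el G j"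
    unfolding in_hom_set_cat_iff by (auto simp: app_def)
qed

lemma S_objs: "t \<in> hom S F G \<Longrightarrow> F \<in> Obj S" "t \<in> hom S F G \<Longrightarrow> G \<in> Obj S"
  by (auto simp: in_hom_S_iff)

lemma app_in: "t \<in> hom S F G \<Longrightarrow> j \<in> Obj J \<Longrightarrow> x \<in> el F j \<Longrightarrow> app t j x \<in> el G j"
  using PiE_mem[OF component_eq(2)] .

lemma app_natural:
  assumes t: "t \<in> hom S F G" and f: "f \<in> hom J i k" and x: "x \<in> el F i"
  shows "app t k (act F f x) = act G f (app t i x)"
proof -
  have "fst (snd t) k \<cdot>\<^bsub>set_cat\<^esub> amap F f = amap G f \<cdot>\<^bsub>set_cat\<^esub> fst (snd t) i"
    using t nat_trans_natural[of J set_cat F G "fst (snd t)" f i k] f by (auto simp: in_hom_S_iff)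
  then have "(\<lambda>x\<in>el F i. app t k (act F f x)) = (\<lambda>x\<in>el F i. act G f (app t i x))"
    unfolding amap_eq(1)[OF S_objs(1)[OF t] f] amap_eq(1)[OF S_objs(2)[OF t] f]
      component_eq(1)[OF t J_objs(1)[OF f]] component_eq(1)[OF t J_objs(2)[OF f]] by simp
  from fun_cong[OF this, of x] show ?thesis using x by simp
qed

lemma transformation_eqI:
  assumes t: "t \<in> hom S F G" and s: "s \<in> hom S F G"
    and eq: "\<And>j x. j \<in> Obj J \<Longrightarrow> x \<in> el F j \<Longrightarrow> app t j x = app s j x"
  shows "t = s"
proof -
  have "fst (snd t) j = fst (snd s) j" for j
  proof (cases "j \<in> Obj J")
    case True
    then have "app t j = app s j"
      using component_eq(2)[OF t True] component_eq(2)[OF s True] eq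
      by (intro PiE_ext) auto
    then show ?thesis using component_eq(1)[OF t True] component_eq(1)[OF s True] by simp
  next
    case False
    then show ?thesis using t s by (auto simp: in_hom_S_iff extensional_def)
  qed
  then have "fst (snd t) = fst (snd s)" by blast
  then show ?thesis using t s by (auto simp: in_hom_S_iff)
qed

text \<open>Diagrams and transformations from elementwise data. Everything is restricted to its carrier,
  since the functor category consists of extensional functions.\<close>

definition diagram_of :: "('j \<Rightarrow> 'u set) \<Rightarrow> ('k \<Rightarrow> 'u \<Rightarrow> 'u) \<Rightarrow> ('j, 'k, 'u) diagram" where
  "diagram_of X a = \<lparr>omap = (\<lambda>j\<in>Obj J. X j),
     amap = (\<lambda>f\<in>Arr J. (X (Dom J f), \<lambda>x\<in>X (Dom J f). a f x, X (Cod J f)))\<rparr>"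

lemma diagram_of:
  assumes sm: "\<And>j. j \<in> Obj J \<Longrightarrow> small TYPE('u) (X j)"
    and a: "\<And>f i k x. f \<in> hom J i k \<Longrightarrow> x \<in> X i \<Longrightarrow> a f x \<in> X k"
    and a_id: "\<And>i x. i \<in> Obj J \<Longrightarrow> x \<in> X i \<Longrightarrow> a (Ident J i) x = x"
    and a_comp: "\<And>f g i k l x. f \<in> hom J i k \<Longrightarrow> g \<in> hom J k l \<Longrightarrow> x \<in> X i \<Longrightarrow>
       a (g \<cdot>\<^bsub>J\<^esub> f) x = a g (a f x)"
  shows "diagram_of X a \<in> Obj S"
    and "\<And>j. j \<in> Obj J \<Longrightarrow> el (diagram_of X a) j = X j"
    and "\<And>f i k x. f \<in> hom J i k \<Longrightarrow> x \<in> X i \<Longrightarrow> act (diagram_of X a) f x = a f x"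
proof -
  have am: "amap (diagram_of X a) f = (X i, \<lambda>x\<in>X i. a f x, X k)" if "f \<in> hom J i k" for f i k
    using that by (auto simp: diagram_of_def in_hom_iff)
  show el: "el (diagram_of X a) j = X j" if "j \<in> Obj J" for j
    using that by (simp add: diagram_of_def)
  show "act (diagram_of X a) f x = a f x" if "f \<in> hom J i k" "x \<in> X i" for f i k x
    using that by (simp add: act_def am)
  have "is_functor J set_cat (diagram_of X a)"
  proof (rule functorI[OF category_J category_set_cat])
    fix A assume "A \<in> Obj J"
    then show "el (diagram_of X a) A \<in> Obj set_cat" by (simp add: el sm)
  next
    fix f A B assume f: "f \<in> hom J A B"
    then show "amap (diagram_of X a) f \<in> hom set_cat (el (diagram_of X a) A) (el (diagram_of X a) B)"
      unfolding in_hom_set_cat_iff using J_objs[OF f] a[OF f] sm by (auto simp: el am)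
  next
    fix A assume A: "A \<in> Obj J"
    then show "amap (diagram_of X a) (Ident J A) = Ident set_cat (el (diagram_of X a) A)"
      using am[OF category_ident[OF category_J A]] a_id by (auto simp: el intro!: ext)
  next
    fix f g A B E assume f: "f \<in> hom J A B" and g: "g \<in> hom J B E"
    then show "amap (diagram_of X a) (g \<cdot>\<^bsub>J\<^esub> f) =
        amap (diagram_of X a) g \<cdot>\<^bsub>set_cat\<^esub> amap (diagram_of X a) f"
      using am[OF category_comp[OF category_J f g]] am[OF f] am[OF g] a[OF f] a_comp[OF f g]
      by (auto intro!: ext)
  qed
  then show "diagram_of X a \<in> Obj S"
    unfolding in_Obj_S_iff by (simp add: diagram_of_def)
qed

definition transformation_of ::
  "('j, 'k, 'u) diagram \<Rightarrow> ('j \<Rightarrow> 'u \<Rightarrow> 'u) \<Rightarrow> ('j, 'k, 'u) diagram \<Rightarrow> ('j, 'k, 'u) transformation" where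
  "transformation_of F \<phi> G = (F, \<lambda>j\<in>Obj J. (el F j, \<lambda>x\<in>el F j. \<phi> j x, el G j), G)"

lemma transformation_of:
  assumes F: "F \<in> Obj S" and G: "G \<in> Obj S"
    and \<phi>: "\<And>j x. j \<in> Obj J \<Longrightarrow> x \<in> el F j \<Longrightarrow> \<phi> j x \<in> el G j"
    and nat: "\<And>f i k x. f \<in> hom J i k \<Longrightarrow> x \<in> el F i \<Longrightarrow> \<phi> k (act F f x) = act G f (\<phi> i x)"
  shows "transformation_of F \<phi> G \<in> hom S F G"
    and "\<And>j x. j \<in> Obj J \<Longrightarrow> x \<in> el F j \<Longrightarrow> app (transformation_of F \<phi> G) j x = \<phi> j x"
proof -
  show "app (transformation_of F \<phi> G) j x = \<phi> j x" if "j \<in> Obj J" "x \<in> el F j" for j x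
    using that by (simp add: app_def transformation_of_def)
  let ?t = "\<lambda>j\<in>Obj J. (el F j, \<lambda>x\<in>el F j. \<phi> j x, el G j)"
  have "nat_trans J set_cat F G ?t"
  proof (rule nat_transI)
    show "is_functor J set_cat F" "is_functor J set_cat G"
      using F G by (simp_all add: in_Obj_S_iff)
  next
    fix A assume "A \<in> Obj J"
    then show "?t A \<in> hom set_cat (el F A) (el G A)"
      unfolding in_hom_set_cat_iff using \<phi> small_el F G by auto
  next
    fix f A B assume f: "f \<in> hom J A B"
    show "?t B \<cdot>\<^bsub>set_cat\<^esub> amap F f = amap G f \<cdot>\<^bsub>set_cat\<^esub> ?t A"
      using J_objs[OF f] amap_eq[OF F f] amap_eq[OF G f] nat[OF f] act_in[OF F f] 
      by (auto intro!: ext)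
  qed
  then show "transformation_of F \<phi> G \<in> hom S F G"
    unfolding in_hom_S_iff transformation_of_def using F G by simp
qed

lemma comp_in: "t \<in> hom S F G \<Longrightarrow> s \<in> hom S G H \<Longrightarrow> s \<odot> t \<in> hom S F H"
  and app_comp: "t \<in> hom S F G \<Longrightarrow> s \<in> hom S G H \<Longrightarrow> j \<in> Obj J \<Longrightarrow> x \<in> el F j \<Longrightarrow>
    app (s \<odot> t) j x = app s j (app t j x)"
proof -
  assume t: "t \<in> hom S F G" and s: "s \<in> hom S G H"
  obtain \<tau> \<sigma> where ts: "t = (F, \<tau>, G)" "s = (G, \<sigma>, H)" using t s by (auto simp: in_hom_S_iff)
  have \<tau>: "\<tau> j = (el F j, app t j, el G j)" and \<sigma>: "\<sigma> j = (el G j, app s j, el H j)"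
    if "j \<in> Obj J" for j
    using component_eq(1)[OF t that] component_eq(1)[OF s that] ts by simp_all
  have eq: "s \<odot> t = transformation_of F (\<lambda>j x. app s j (app t j x)) H"
    using \<tau> \<sigma> by (auto simp: ts S_simps transformation_of_def intro!: ext)
  have nat: "app s k (app t k (act F f x)) = act H f (app s i (app t i x))"
    if "f \<in> hom J i k" "x \<in> el F i" for f i k x
    using app_natural[OF t that] app_natural[OF s that(1)] app_in[OF t _ that(2)] J_objs[OF that(1)]
    by simp
  note T = transformation_of[of F H "\<lambda>j x. app s j (app t j x)"]
  show "s \<odot> t \<in> hom S F H"
    unfolding eq by (rule T(1)) (use S_objs[OF t] S_objs[OF s] app_in[OF t] app_in[OF s] nat in auto)
  show "app (s \<odot> t) j x = app s j (app t j x)" if "j \<in> Obj J" "x \<in> el F j"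
    unfolding eq by (rule T(2)) (use S_objs[OF t] S_objs[OF s] app_in[OF t] app_in[OF s] nat that in auto)
qed

lemma ident_in: "F \<in> Obj S \<Longrightarrow> Ident S F \<in> hom S F F"
  and app_ident: "F \<in> Obj S \<Longrightarrow> j \<in> Obj J \<Longrightarrow> x \<in> el F j \<Longrightarrow> app (Ident S F) j x = x"
proof -
  assume F: "F \<in> Obj S"
  have eq: "Ident S F = transformation_of F (\<lambda>j x. x) F"
    by (simp add: S_simps transformation_of_def)
  show "Ident S F \<in> hom S F F" unfolding eq by (rule transformation_of(1)[OF F F]) auto
  show "app (Ident S F) j x = x" if "j \<in> Obj J" "x \<in> el F j"
    unfolding eq by (rule transformation_of(2)[OF F F]) (use that in auto)
qed

lemma category_S: "category S"
proof (rule categoryI)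
  fix f assume "f \<in> Arr S"
  then have "f \<in> hom S (Dom S f) (Cod S f)" by (simp add: in_hom_iff)
  then show "Dom S f \<in> Obj S \<and> Cod S f \<in> Obj S" using S_objs by blast
next
  fix f A B assume f: "f \<in> hom S A B"
  note o = S_objs[OF f]
  show "f \<odot> Ident S A = f \<and> Ident S B \<odot> f = f"
    using comp_in[OF ident_in[OF o(1)] f] comp_in[OF f ident_in[OF o(2)]] f
    by (auto intro!: transformation_eqI[OF _ f] simp: app_comp[OF ident_in[OF o(1)] f]
        app_comp[OF f ident_in[OF o(2)]] app_ident o app_in[OF f])
next
  fix f g h A B D E assume f: "f \<in> hom S A B" and g: "g \<in> hom S B D" and h: "h \<in> hom S D E"
  show "h \<odot> (g \<odot> f) = (h \<odot> g) \<odot> f"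
    by (rule transformation_eqI[OF comp_in[OF comp_in[OF f g] h] comp_in[OF f comp_in[OF g h]]])
      (simp add: app_comp[OF comp_in[OF f g] h] app_comp[OF f comp_in[OF g h]] app_comp[OF f g]
        app_comp[OF g h] app_in[OF f])
qed (rule ident_in, assumption, rule comp_in)

lemma iso_S_iff:
  assumes t: "t \<in> hom S F G"
  shows "iso S t \<longleftrightarrow> (\<forall>j\<in>Obj J. bij_betw (app t j) (el F j) (el G j))"
proof
  assume "iso S t"
  then obtain s where s: "s \<in> hom S G F" "s \<odot> t = Ident S F" "t \<odot> s = Ident S G"
    using isoE t by metis
  show "\<forall>j\<in>Obj J. bij_betw (app t j) (el F j) (el G j)"
  proof
    fix j assume j: "j \<in> Obj J"
    show "bij_betw (app t j) (el F j) (el G j)"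
      by (rule bij_betw_byWitness[where f' = "app s j"])
        (use app_comp[OF t s(1) j] app_comp[OF s(1) t j] s app_ident[OF S_objs(1)[OF t] j]
          app_ident[OF S_objs(2)[OF t] j] app_in[OF t j] app_in[OF s(1) j] in auto)
  qed
next
  assume b: "\<forall>j\<in>Obj J. bij_betw (app t j) (el F j) (el G j)"
  define r where "r j = inv_into (el F j) (app t j)" for j
  have r: "r j y \<in> el F j \<and> app t j (r j y) = y" if "j \<in> Obj J" "y \<in> el G j" for j y
    using b that unfolding r_def
    by (metis bij_betw_imp_surj_on f_inv_into_f inv_into_into)
  have rt: "r j (app t j x) = x" if "j \<in> Obj J" "x \<in> el F j" for j x
    using b that unfolding r_def by (metis bij_betw_inv_into_left)
  have inj: "x = y" if "j \<in> Obj J" "x \<in> el F j" "y \<in> el F j" "app t j x = app t j y" for j x y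
    using rt that by metis
  note o = S_objs[OF t]
  have nat: "r k (act G f y) = act F f (r i y)" if f: "f \<in> hom J i k" and y: "y \<in> el G i" for f i k y
  proof (rule inj[of k])
    note ik = J_objs[OF f]
    show "k \<in> Obj J" "r k (act G f y) \<in> el F k" "act F f (r i y) \<in> el F k"
      using ik r act_in[OF o(1) f] act_in[OF o(2) f y] y by auto
    show "app t k (r k (act G f y)) = app t k (act F f (r i y))"
      using r[OF ik(1) y] r[OF ik(2) act_in[OF o(2) f y]] app_natural[OF t f, of "r i y"] by simp
  qed
  let ?s = "transformation_of G r F"
  have s: "?s \<in> hom S G F" and as: "\<And>j y. j \<in> Obj J \<Longrightarrow> y \<in> el G j \<Longrightarrow> app ?s j y = r j y"
    using transformation_of[OF o(2,1)] r nat by blast+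
  show "iso S t"
  proof (rule isoI[OF t s])
    show "?s \<odot> t = Ident S F"
      by (rule transformation_eqI[OF comp_in[OF t s] ident_in[OF o(1)]])
        (simp add: app_comp[OF t s] app_ident[OF o(1)] as app_in[OF t] rt)
    show "t \<odot> ?s = Ident S G"
      by (rule transformation_eqI[OF comp_in[OF s t] ident_in[OF o(2)]])
        (simp add: app_comp[OF s t] app_ident[OF o(2)] as r)
  qed
qed

lemma small_Sigma:
  assumes "small TYPE('u) A" "\<And>a. a \<in> A \<Longrightarrow> small TYPE('u) (F a)"
  shows "small TYPE('u) (SIGMA a:A. F a)"
proof -
  have "stable |UNIV :: 'u set|"
    using universe by (intro regularCard_stable[OF card_of_Card_order]) (auto simp: set_universe_def Field_card_of)
  from stable_elim[OF this] show ?thesis using assms unfolding small_def by blast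
qed

lemma small_subset: "small TYPE('u) A \<Longrightarrow> B \<subseteq> A \<Longrightarrow> small TYPE('u) B"
  unfolding small_def using card_of_mono1 ordLeq_ordLess_trans by blast

lemma small_image: "small TYPE('u) A \<Longrightarrow> small TYPE('u) (h ` A)"
  unfolding small_def using card_of_image ordLeq_ordLess_trans by blast

text \<open>Diagrams may be built from sets over any type, as long as they are small: an injection
  into the universe transports the structure.\<close>

lemma realization:
  fixes X :: "'j \<Rightarrow> 'x set" and a :: "'k \<Rightarrow> 'x \<Rightarrow> 'x"
  assumes sm: "\<And>j. j \<in> Obj J \<Longrightarrow> small TYPE('u) (X j)"
    and a: "\<And>f i k x. f \<in> hom J i k \<Longrightarrow> x \<in> X i \<Longrightarrow> a f x \<in> X k"
    and a_id: "\<And>i x. i \<in> Obj J \<Longrightarrow> x \<in> X i \<Longrightarrow> a (Ident J i) x = x"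
    and a_comp: "\<And>f g i k l x. f \<in> hom J i k \<Longrightarrow> g \<in> hom J k l \<Longrightarrow> x \<in> X i \<Longrightarrow>
       a (g \<cdot>\<^bsub>J\<^esub> f) x = a g (a f x)"
  obtains F \<phi> \<psi> where "F \<in> Obj S"
    "\<And>j x. j \<in> Obj J \<Longrightarrow> x \<in> X j \<Longrightarrow> \<phi> j x \<in> el F j"
    "\<And>j y. j \<in> Obj J \<Longrightarrow> y \<in> el F j \<Longrightarrow> \<psi> j y \<in> X j"
    "\<And>j x. j \<in> Obj J \<Longrightarrow> x \<in> X j \<Longrightarrow> \<psi> j (\<phi> j x) = x"
    "\<And>j y. j \<in> Obj J \<Longrightarrow> y \<in> el F j \<Longrightarrow> \<phi> j (\<psi> j y) = y"
    "\<And>f i k x. f \<in> hom J i k \<Longrightarrow> x \<in> X i \<Longrightarrow> act F f (\<phi> i x) = \<phi> k (a f x)"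
    "\<And>f i k y. f \<in> hom J i k \<Longrightarrow> y \<in> el F i \<Longrightarrow> \<psi> k (act F f y) = a f (\<psi> i y)"
proof -
  have "\<exists>\<phi>. inj_on \<phi> (X j) \<and> \<phi> ` X j \<subseteq> (UNIV :: 'u set)" if "j \<in> Obj J" for j
    using sm[OF that] ordLess_imp_ordLeq unfolding small_def card_of_ordLeq by blast
  then obtain \<phi> :: "'j \<Rightarrow> 'x \<Rightarrow> 'u" where \<phi>: "\<And>j. j \<in> Obj J \<Longrightarrow> inj_on (\<phi> j) (X j)" by metis
  let ?X = "\<lambda>j. \<phi> j ` X j"
  let ?a = "\<lambda>f y. \<phi> (Cod J f) (a f (inv_into (X (Dom J f)) (\<phi> (Dom J f)) y))"
  have a': "?a f (\<phi> i x) = \<phi> k (a f x)" if "f \<in> hom J i k" "x \<in> X i" for f i k x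
    using that \<phi>[OF J_objs(1)[OF that(1)]] by (auto simp: in_hom_iff)
  have idh: "Ident J i \<in> hom J i i" if "i \<in> Obj J" for i
    using category_ident[OF category_J that] .
  note D = diagram_of[of ?X ?a]
  have sm': "small TYPE('u) (?X j)" if "j \<in> Obj J" for j
    using small_image sm that by blast
  have cl: "?a f y \<in> ?X k" if "f \<in> hom J i k" "y \<in> ?X i" for f i k y
    using that a' a by fastforce
  have id': "?a (Ident J i) y = y" if i: "i \<in> Obj J" and y: "y \<in> ?X i" for i y
    using y a'[OF idh[OF i]] a_id[OF i] by auto
  have co: "?a (g \<cdot>\<^bsub>J\<^esub> f) y = ?a g (?a f y)"
    if f: "f \<in> hom J i k" and g: "g \<in> hom J k l" and y: "y \<in> ?X i" for f g i k l y
  proof -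
    obtain x where x: "x \<in> X i" "y = \<phi> i x" using y by blast
    show ?thesis
      unfolding x(2) a'[OF category_comp[OF category_J f g] x(1)] a'[OF f x(1)]
        a'[OF g a[OF f x(1)]] a_comp[OF f g x(1)] ..
  qed
  let ?F = "diagram_of ?X ?a" and ?\<psi> = "\<lambda>j. inv_into (X j) (\<phi> j)"
  have el: "el ?F j = \<phi> j ` X j" if "j \<in> Obj J" for j
    using D(2)[OF sm' cl id' co that] .
  have ac: "act ?F f (\<phi> i x) = \<phi> k (a f x)" if "f \<in> hom J i k" "x \<in> X i" for f i k x
    using D(3)[OF sm' cl id' co that(1) imageI[OF that(2)]] a'[OF that] by simp
  show thesis
  proof (rule that[of ?F \<phi> ?\<psi>])
    show "?F \<in> Obj S" by (rule D(1)[OF sm' cl id' co])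
    fix j assume j: "j \<in> Obj J"
    show "\<phi> j x \<in> el ?F j" "?\<psi> j (\<phi> j x) = x" if "x \<in> X j" for x
      using that \<phi>[OF j] by (auto simp: el[OF j])
    show "?\<psi> j y \<in> X j" "\<phi> j (?\<psi> j y) = y" if "y \<in> el ?F j" for y
      using that \<phi>[OF j] by (auto simp: el[OF j])
  next
    fix f i k y assume f: "f \<in> hom J i k" and y: "y \<in> el ?F i"
    obtain x where x: "x \<in> X i" "y = \<phi> i x" using y unfolding el[OF J_objs(1)[OF f]] by blast
    show "?\<psi> k (act ?F f y) = a f (?\<psi> i y)"
      using ac[OF f x(1)] a[OF f x(1)] \<phi>[OF J_objs(1)[OF f]] \<phi>[OF J_objs(2)[OF f]] x by simp
  qed (rule ac)
qed

section \<open>Pullbacks of diagrams\<close>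

text \<open>The elementwise form of a pullback square: the elements of the corner are the pairs of
  elements with a common image.\<close>

definition fibred_elements where
  "fibred_elements f g p q = (\<forall>j\<in>Obj J.
     (\<forall>x\<in>el (Dom S p) j. app f j (app p j x) = app g j (app q j x)) \<and>
     (\<forall>a\<in>el (Dom S f) j. \<forall>e\<in>el (Dom S g) j. app f j a = app g j e \<longrightarrow>
       (\<exists>!x. x \<in> el (Dom S p) j \<and> app p j x = a \<and> app q j x = e)))"

lemma fibred_elements_pullback:
  assumes f: "f \<in> hom S A B" and g: "g \<in> hom S E B" and p: "p \<in> hom S P A" and q: "q \<in> hom S P E"
    and fib: "fibred_elements f g p q"
  shows "is_pullback S f g p q"
proof -
  have d: "Dom S f = A" "Dom S g = E" "Dom S p = P" "Dom S q = P"
      "Cod S f = B" "Cod S g = B" "Cod S p = A" "Cod S q = E"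
    and arr: "f \<in> Arr S" "g \<in> Arr S" "p \<in> Arr S" "q \<in> Arr S"
    using f g p q by (auto simp: in_hom_iff)
  have sq: "app f j (app p j x) = app g j (app q j x)" if "j \<in> Obj J" "x \<in> el P j" for j x
    using fib that unfolding fibred_elements_def d by blast
  have un: "\<exists>!x. x \<in> el P j \<and> app p j x = a \<and> app q j x = e"
    if "j \<in> Obj J" "a \<in> el A j" "e \<in> el E j" "app f j a = app g j e" for j a e
    using fib that unfolding fibred_elements_def d by blast
  have inj: "x = y" if "j \<in> Obj J" "x \<in> el P j" "y \<in> el P j" "app p j x = app p j y"
    "app q j x = app q j y" for j x y
    using un[OF that(1) app_in[OF p that(1,2)] app_in[OF q that(1,2)] sq[OF that(1,2)]] that by metis
  have comm: "f \<odot> p = g \<odot> q"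
    by (rule transformation_eqI[OF comp_in[OF p f] comp_in[OF q g]])
      (simp add: app_comp[OF p f] app_comp[OF q g] sq)
  have "\<exists>!w. w \<in> hom S X P \<and> p \<odot> w = x \<and> q \<odot> w = y"
    if x: "x \<in> hom S X A" and y: "y \<in> hom S X E" and eq: "f \<odot> x = g \<odot> y" for X x y
  proof -
    have e: "app f j (app x j z) = app g j (app y j z)" if "j \<in> Obj J" "z \<in> el X j" for j z
      using app_comp[OF x f that] app_comp[OF y g that] eq by simp
    define r where "r j z = (THE w. w \<in> el P j \<and> app p j w = app x j z \<and> app q j w = app y j z)" for j z
    have r: "r j z \<in> el P j \<and> app p j (r j z) = app x j z \<and> app q j (r j z) = app y j z"
      if "j \<in> Obj J" "z \<in> el X j" for j z
      unfolding r_def by (rule theI') (rule un[OF that(1) app_in[OF x that] app_in[OF y that] e[OF that]])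
    note oX = S_objs(1)[OF x] and oP = S_objs(1)[OF p]
    have nat: "r k (act X h z) = act P h (r i z)" if h: "h \<in> hom J i k" and z: "z \<in> el X i" for h i k z
    proof (rule inj[of k])
      note ik = J_objs[OF h] and hz = act_in[OF oX h z] and rz = r[OF J_objs(1)[OF h] z]
      show "k \<in> Obj J" "r k (act X h z) \<in> el P k" "act P h (r i z) \<in> el P k"
        using ik r[OF ik(2) hz] act_in[OF oP h] rz by auto
      show "app p k (r k (act X h z)) = app p k (act P h (r i z))"
        using r[OF ik(2) hz] app_natural[OF p h] rz app_natural[OF x h z] by simp
      show "app q k (r k (act X h z)) = app q k (act P h (r i z))"
        using r[OF ik(2) hz] app_natural[OF q h] rz app_natural[OF y h z] by simp
    qed
    let ?w = "transformation_of X r P"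
    have w: "?w \<in> hom S X P" and aw: "\<And>j z. j \<in> Obj J \<Longrightarrow> z \<in> el X j \<Longrightarrow> app ?w j z = r j z"
      using transformation_of[OF oX oP] r nat by blast+
    show ?thesis
    proof (rule ex1I[of _ ?w])
      show "?w \<in> hom S X P \<and> p \<odot> ?w = x \<and> q \<odot> ?w = y"
        using w by (auto intro!: transformation_eqI[OF comp_in[OF w p] x]
            transformation_eqI[OF comp_in[OF w q] y] simp: app_comp[OF w p] app_comp[OF w q] aw r)
      fix w' assume "w' \<in> hom S X P \<and> p \<odot> w' = x \<and> q \<odot> w' = y"
      then have w': "w' \<in> hom S X P" "p \<odot> w' = x" "q \<odot> w' = y" by auto
      show "w' = ?w"
      proof (rule transformation_eqI[OF w'(1) w])
        fix j z assume jz: "j \<in> Obj J" "z \<in> el X j"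
        show "app w' j z = app ?w j z"
          unfolding aw[OF jz]
          using app_comp[OF w'(1) p jz] app_comp[OF w'(1) q jz] w'(2,3) r[OF jz]
          by (intro inj[OF jz(1) app_in[OF w'(1) jz]]) simp_all
      qed
    qed
  qed
  note key = this
  have "\<exists>!w. w \<in> hom S (Dom S x) P \<and> p \<odot> w = x \<and> q \<odot> w = y"
    if "x \<in> Arr S" "y \<in> Arr S" "Dom S x = Dom S y \<and> Cod S x = A \<and> Cod S y = E \<and> f \<odot> x = g \<odot> y"
    for x y
    using that by (intro key) (simp_all add: in_hom_iff)
  then show ?thesis
    unfolding is_pullback_def d using arr comm by blast
qed

lemma pullback_exists:
  assumes f: "f \<in> hom S A B" and g: "g \<in> hom S E B"
  obtains P p q where "p \<in> hom S P A" "q \<in> hom S P E" "fibred_elements f g p q"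
proof -
  note oA = S_objs(1)[OF f] and oE = S_objs(1)[OF g]
  let ?X = "\<lambda>j. {(a, e). a \<in> el A j \<and> e \<in> el E j \<and> app f j a = app g j e}"
  let ?a = "\<lambda>h (a, e). (act A h a, act E h e)"
  have sm: "small TYPE('u) (?X j)" if j: "j \<in> Obj J" for j
    by (rule small_subset[OF small_Sigma[OF small_el[OF oA j] small_el[OF oE j]]]) auto
  have cl: "?a h x \<in> ?X k" if "h \<in> hom J i k" "x \<in> ?X i" for h i k x
    using that act_in[OF oA that(1)] act_in[OF oE that(1)] app_natural[OF f that(1)]
      app_natural[OF g that(1)] by auto
  have id': "?a (Ident J i) x = x" if "i \<in> Obj J" "x \<in> ?X i" for i x
    using that act_ident[OF oA] act_ident[OF oE] by auto
  have co: "?a (h' \<cdot>\<^bsub>J\<^esub> h) x = ?a h' (?a h x)"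
    if "h \<in> hom J i k" "h' \<in> hom J k l" "x \<in> ?X i" for h h' i k l x
    using that act_comp[OF oA that(1,2)] act_comp[OF oE that(1,2)] by auto
  obtain P \<phi> \<psi> where P: "P \<in> Obj S"
    and \<phi>: "\<And>j x. j \<in> Obj J \<Longrightarrow> x \<in> ?X j \<Longrightarrow> \<phi> j x \<in> el P j"
    and \<psi>: "\<And>j x. j \<in> Obj J \<Longrightarrow> x \<in> el P j \<Longrightarrow> \<psi> j x \<in> ?X j"
    and \<psi>\<phi>: "\<And>j x. j \<in> Obj J \<Longrightarrow> x \<in> ?X j \<Longrightarrow> \<psi> j (\<phi> j x) = x"
    and \<phi>\<psi>: "\<And>j x. j \<in> Obj J \<Longrightarrow> x \<in> el P j \<Longrightarrow> \<phi> j (\<psi> j x) = x"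
    and \<psi>nat: "\<And>h i k x. h \<in> hom J i k \<Longrightarrow> x \<in> el P i \<Longrightarrow> \<psi> k (act P h x) = ?a h (\<psi> i x)"
    by (rule realization[of ?X ?a, OF sm cl id' co]) (assumption | blast)+
  have \<psi>': "fst (\<psi> j x) \<in> el A j" "snd (\<psi> j x) \<in> el E j"
    "app f j (fst (\<psi> j x)) = app g j (snd (\<psi> j x))" if "j \<in> Obj J" "x \<in> el P j" for j x
    using \<psi>[OF that] by auto
  let ?p = "transformation_of P (\<lambda>j x. fst (\<psi> j x)) A"
  let ?q = "transformation_of P (\<lambda>j x. snd (\<psi> j x)) E"
  have p: "?p \<in> hom S P A" and ap: "\<And>j x. j \<in> Obj J \<Longrightarrow> x \<in> el P j \<Longrightarrow> app ?p j x = fst (\<psi> j x)"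
    by (rule transformation_of[OF P oA]; simp add: \<psi>' \<psi>nat case_prod_unfold)+
  have q: "?q \<in> hom S P E" and aq: "\<And>j x. j \<in> Obj J \<Longrightarrow> x \<in> el P j \<Longrightarrow> app ?q j x = snd (\<psi> j x)"
    by (rule transformation_of[OF P oE]; simp add: \<psi>' \<psi>nat case_prod_unfold)+
  have d: "Dom S f = A" "Dom S g = E" "Dom S ?p = P"
    using f g p by (auto simp: in_hom_iff)
  show thesis
  proof (rule that[OF p q])
    show "fibred_elements f g ?p ?q"
      unfolding fibred_elements_def d
    proof (intro ballI conjI impI)
      fix j x assume "j \<in> Obj J" "x \<in> el P j"
      then show "app f j (app ?p j x) = app g j (app ?q j x)"
        by (simp add: ap aq \<psi>')
    next
      fix j a e assume j: "j \<in> Obj J" and ae: "a \<in> el A j" "e \<in> el E j" "app f j a = app g j e"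
      then have X: "(a, e) \<in> ?X j" by simp
      show "\<exists>!x. x \<in> el P j \<and> app ?p j x = a \<and> app ?q j x = e"
      proof (rule ex1I[of _ "\<phi> j (a, e)"])
        have "\<phi> j (a, e) \<in> el P j" by (rule \<phi>[OF j X])
        then show "\<phi> j (a, e) \<in> el P j \<and> app ?p j (\<phi> j (a, e)) = a \<and> app ?q j (\<phi> j (a, e)) = e"
          using \<psi>\<phi>[OF j X] j by (simp add: ap aq)
        fix x assume x: "x \<in> el P j \<and> app ?p j x = a \<and> app ?q j x = e"
        then have "\<psi> j x = (a, e)" using j by (auto simp: ap aq intro: prod_eqI)
        then show "x = \<phi> j (a, e)" using \<phi>\<psi>[OF j] x by metis
      qed
    qed
  qed
qed

text \<open>Every pullback is isomorphic to the one built from pairs, and the property transfers along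
  the isomorphism.\<close>

lemma pullback_fibred_elements:
  assumes pb: "is_pullback S f g p q"
  shows "fibred_elements f g p q"
proof -
  let ?A = "Dom S f" and ?B = "Cod S f" and ?E = "Dom S g" and ?P = "Dom S p"
  have f: "f \<in> hom S ?A ?B" and g: "g \<in> hom S ?E ?B" and p: "p \<in> hom S ?P ?A"
    and q: "q \<in> hom S ?P ?E" and sq: "f \<odot> p = g \<odot> q"
    using pb unfolding is_pullback_def by (auto simp: in_hom_iff)
  obtain P' p' q' where p': "p' \<in> hom S P' ?A" and q': "q' \<in> hom S P' ?E"
    and fib: "fibred_elements f g p' q'" using pullback_exists[OF f g] .
  have pb': "is_pullback S f g p' q'" by (rule fibred_elements_pullback[OF f g p' q' fib])
  have d': "Dom S p' = P'" using p' by (simp add: in_hom_iff)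
  have sq': "f \<odot> p' = g \<odot> q'" using pb' by (simp add: is_pullback_def)
  obtain w where w: "w \<in> hom S P' ?P" "p \<odot> w = p'" "q \<odot> w = q'"
    using pullback_lift[OF pb p' q' sq'] by blast
  obtain v where v: "v \<in> hom S ?P P'" "p' \<odot> v = p" "q' \<odot> v = q"
    using pullback_lift[OF pb' p q sq] unfolding d' by blast
  note oP = S_objs(1)[OF p]
  have "w \<odot> v = Ident S ?P"
    using category_assoc[OF category_S v(1) w(1) p] category_assoc[OF category_S v(1) w(1) q]
      w v category_comp_ident[OF category_S p] category_comp_ident[OF category_S q]
    by (intro pullback_eqI[OF category_S pb comp_in[OF v(1) w(1)] ident_in[OF oP]]) simp_all
  then have wv: "app w j (app v j x) = x" if "j \<in> Obj J" "x \<in> el ?P j" for j x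
    using app_comp[OF v(1) w(1) that] app_ident[OF oP that] by simp
  show ?thesis
    unfolding fibred_elements_def
  proof (intro ballI conjI impI)
    fix j x assume jx: "j \<in> Obj J" "x \<in> el ?P j"
    show "app f j (app p j x) = app g j (app q j x)"
      using app_comp[OF p f jx] app_comp[OF q g jx] sq by simp
  next
    fix j a e assume j: "j \<in> Obj J" and ae: "a \<in> el ?A j" "e \<in> el ?E j" "app f j a = app g j e"
    then have "\<exists>!x. x \<in> el P' j \<and> app p' j x = a \<and> app q' j x = e"
      using fib unfolding fibred_elements_def d' by blast
    then obtain x where x: "x \<in> el P' j" "app p' j x = a" "app q' j x = e"
      and ux: "\<And>y. y \<in> el P' j \<Longrightarrow> app p' j y = a \<Longrightarrow> app q' j y = e \<Longrightarrow> y = x" by blast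
    show "\<exists>!x. x \<in> el ?P j \<and> app p j x = a \<and> app q j x = e"
    proof (rule ex1I[of _ "app w j x"])
      show "app w j x \<in> el ?P j \<and> app p j (app w j x) = a \<and> app q j (app w j x) = e"
        using app_in[OF w(1) j x(1)] app_comp[OF w(1) p j x(1)] app_comp[OF w(1) q j x(1)] w x by simp
      fix y assume y: "y \<in> el ?P j \<and> app p j y = a \<and> app q j y = e"
      have "app v j y = x"
        using app_in[OF v(1) j] app_comp[OF v(1) p' j] app_comp[OF v(1) q' j] v y by (intro ux) auto
      then show "y = app w j x" using wv[OF j] y by metis
    qed
  qed
qed

end

section \<open>Quotients and images of diagrams\<close>

context small_index
begin

definition surjective :: "('j, 'k, 'u) transformation \<Rightarrow> bool" where
  "surjective t \<longleftrightarrow> (\<forall>j\<in>Obj J. app t j ` el (Dom S t) j = el (Cod S t) j)"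

lemma surjectiveI:
  assumes "t \<in> hom S F G" "\<And>j y. j \<in> Obj J \<Longrightarrow> y \<in> el G j \<Longrightarrow> \<exists>x\<in>el F j. app t j x = y"
  shows "surjective t"
  unfolding surjective_def
proof
  fix j assume j: "j \<in> Obj J"
  have "Dom S t = F" "Cod S t = G" using assms(1) by (auto simp: in_hom_iff)
  then show "app t j ` el (Dom S t) j = el (Cod S t) j"
    using assms(2)[OF j] app_in[OF assms(1) j] by auto
qed

lemma surjectiveD:
  assumes "surjective t" "t \<in> hom S F G" "j \<in> Obj J" "y \<in> el G j"
  obtains x where "x \<in> el F j" "app t j x = y"
proof -
  have "Dom S t = F" "Cod S t = G" using assms(2) by (auto simp: in_hom_iff)
  then have "y \<in> app t j ` el F j" using assms by (simp add: surjective_def)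
  then show thesis using that by blast
qed

text \<open>Choosing preimages defines the descended map; constancy on fibres makes the choice
  irrelevant, and this also gives naturality.\<close>

lemma descend_along_surjective:
  assumes q: "q \<in> hom S A Q" and s: "surjective q" and t: "t \<in> hom S A Z"
    and c: "\<And>j x y. j \<in> Obj J \<Longrightarrow> x \<in> el A j \<Longrightarrow> y \<in> el A j \<Longrightarrow> app q j x = app q j y \<Longrightarrow>
      app t j x = app t j y"
  obtains w where "w \<in> hom S Q Z" "w \<odot> q = t"
    "\<And>j x. j \<in> Obj J \<Longrightarrow> x \<in> el A j \<Longrightarrow> app w j (app q j x) = app t j x"
proof -
  define r where "r j y = app t j (SOME x. x \<in> el A j \<and> app q j x = y)" for j y
  have r: "r j (app q j x) = app t j x" if "j \<in> Obj J" "x \<in> el A j" for j x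
  proof -
    let ?x = "SOME x'. x' \<in> el A j \<and> app q j x' = app q j x"
    have "?x \<in> el A j \<and> app q j ?x = app q j x" by (rule someI[of _ x]) (use that in simp)
    then show ?thesis using c[OF that(1), of ?x x] that(2) by (simp add: r_def)
  qed
  note oA = S_objs(1)[OF q] and oQ = S_objs(2)[OF q] and oZ = S_objs(2)[OF t]
  have rin: "r j y \<in> el Z j" if j: "j \<in> Obj J" and y: "y \<in> el Q j" for j y
  proof -
    obtain x where "x \<in> el A j" "app q j x = y" using surjectiveD[OF s q j y] .
    then show ?thesis using r[OF j, of x] app_in[OF t j, of x] by simp
  qed
  have rnat: "r k (act Q f y) = act Z f (r i y)" if f: "f \<in> hom J i k" and y: "y \<in> el Q i" for f i k y
  proof -
    note ik = J_objs[OF f]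
    obtain x where x: "x \<in> el A i" "app q i x = y" using surjectiveD[OF s q ik(1) y] .
    have "act Q f y = app q k (act A f x)" using app_natural[OF q f x(1)] x by simp
    then have "r k (act Q f y) = app t k (act A f x)" using r[OF ik(2) act_in[OF oA f x(1)]] by simp
    then show ?thesis using app_natural[OF t f x(1)] r[OF ik(1) x(1)] x(2) by simp
  qed
  have w: "transformation_of Q r Z \<in> hom S Q Z"
    and aw: "\<And>j y. j \<in> Obj J \<Longrightarrow> y \<in> el Q j \<Longrightarrow> app (transformation_of Q r Z) j y = r j y"
    by (rule transformation_of[OF oQ oZ rin rnat]; assumption)+
  have ap: "app (transformation_of Q r Z) j (app q j x) = app t j x"
    if "j \<in> Obj J" "x \<in> el A j" for j x
    using aw[OF that(1) app_in[OF q that]] r[OF that] by simp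
  show thesis
    by (rule that[OF w _ ap])
      (auto intro!: transformation_eqI[OF comp_in[OF q w] t] simp: app_comp[OF q w] ap)
qed

lemma surjective_epi:
  assumes q: "q \<in> hom S A Q" and s: "surjective q" and w: "w \<in> hom S Q Z" "w' \<in> hom S Q Z"
    and eq: "w \<odot> q = w' \<odot> q"
  shows "w = w'"
proof (rule transformation_eqI[OF w])
  fix j y assume j: "j \<in> Obj J" and y: "y \<in> el Q j"
  obtain x where "x \<in> el A j" "app q j x = y" using surjectiveD[OF s q j y] .
  then show "app w j y = app w' j y"
    using app_comp[OF q w(1) j, of x] app_comp[OF q w(2) j, of x] eq by simp
qed

lemma quotient_exists:
  assumes A: "A \<in> Obj S"
    and refl: "\<And>j x. j \<in> Obj J \<Longrightarrow> x \<in> el A j \<Longrightarrow> R j x x"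
    and sym: "\<And>j x y. j \<in> Obj J \<Longrightarrow> x \<in> el A j \<Longrightarrow> y \<in> el A j \<Longrightarrow> R j x y \<Longrightarrow> R j y x"
    and trans: "\<And>j x y z. j \<in> Obj J \<Longrightarrow> x \<in> el A j \<Longrightarrow> y \<in> el A j \<Longrightarrow> z \<in> el A j \<Longrightarrow>
      R j x y \<Longrightarrow> R j y z \<Longrightarrow> R j x z"
    and act: "\<And>f i k x y. f \<in> hom J i k \<Longrightarrow> x \<in> el A i \<Longrightarrow> y \<in> el A i \<Longrightarrow> R i x y \<Longrightarrow>
      R k (act A f x) (act A f y)"
  obtains Q q where "q \<in> hom S A Q" "surjective q"
    "\<And>j x y. j \<in> Obj J \<Longrightarrow> x \<in> el A j \<Longrightarrow> y \<in> el A j \<Longrightarrow> app q j x = app q j y \<longleftrightarrow> R j x y"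
proof -
  define cls where "cls j x = {y \<in> el A j. R j x y}" for j x
  have cls: "cls j x = cls j y \<longleftrightarrow> R j x y" if "j \<in> Obj J" "x \<in> el A j" "y \<in> el A j" for j x y
  proof
    assume "cls j x = cls j y"
    moreover have "y \<in> cls j y" using refl that by (simp add: cls_def)
    ultimately have "y \<in> cls j x" by simp
    then show "R j x y" by (simp add: cls_def)
  next
    assume xy: "R j x y"
    show "cls j x = cls j y"
      unfolding cls_def using that xy sym[OF that xy] trans[OF that(1)] by blast
  qed
  let ?X = "\<lambda>j. cls j ` el A j"
  let ?a = "\<lambda>f c. cls (Cod J f) (act A f (SOME x. x \<in> el A (Dom J f) \<and> cls (Dom J f) x = c))"
  have a: "?a f (cls i x) = cls k (act A f x)" if f: "f \<in> hom J i k" and x: "x \<in> el A i" for f i k x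
  proof -
    note ik = J_objs[OF f]
    let ?x = "SOME x'. x' \<in> el A i \<and> cls i x' = cls i x"
    have X: "?x \<in> el A i \<and> cls i ?x = cls i x" by (rule someI[of _ x]) (use x in simp)
    then have "R i ?x x" using cls[OF ik(1)] x by blast
    then have "R k (act A f ?x) (act A f x)" using act[OF f] X x by blast
    then have "cls k (act A f ?x) = cls k (act A f x)"
      using cls[OF ik(2)] act_in[OF A f] X x by blast
    then show ?thesis using f by (simp add: in_hom_iff)
  qed
  have sm: "small TYPE('u) (?X j)" if "j \<in> Obj J" for j
    by (rule small_image[OF small_el[OF A that]])
  have cl: "?a f c \<in> ?X k" if f: "f \<in> hom J i k" and c: "c \<in> ?X i" for f i k c
  proof -
    obtain x where x: "x \<in> el A i" "c = cls i x" using c by blast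
    show ?thesis unfolding x(2) a[OF f x(1)] using act_in[OF A f x(1)] by blast
  qed
  have id': "?a (Ident J i) c = c" if i: "i \<in> Obj J" and c: "c \<in> ?X i" for i c
  proof -
    obtain x where x: "x \<in> el A i" "c = cls i x" using c by blast
    show ?thesis
      unfolding x(2) a[OF category_ident[OF category_J i] x(1)] act_ident[OF A i x(1)] ..
  qed
  have co: "?a (g \<cdot>\<^bsub>J\<^esub> f) c = ?a g (?a f c)"
    if f: "f \<in> hom J i k" and g: "g \<in> hom J k l" and c: "c \<in> ?X i" for f g i k l c
  proof -
    obtain x where x: "x \<in> el A i" "c = cls i x" using c by blast
    show ?thesis
      unfolding x(2) a[OF category_comp[OF category_J f g] x(1)] a[OF f x(1)]
        a[OF g act_in[OF A f x(1)]] act_comp[OF A f g x(1)] ..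
  qed
  obtain Q \<phi> \<psi> where Q: "Q \<in> Obj S"
    and \<phi>: "\<And>j c. j \<in> Obj J \<Longrightarrow> c \<in> ?X j \<Longrightarrow> \<phi> j c \<in> el Q j"
    and \<psi>: "\<And>j y. j \<in> Obj J \<Longrightarrow> y \<in> el Q j \<Longrightarrow> \<psi> j y \<in> ?X j"
    and \<psi>\<phi>: "\<And>j c. j \<in> Obj J \<Longrightarrow> c \<in> ?X j \<Longrightarrow> \<psi> j (\<phi> j c) = c"
    and \<phi>\<psi>: "\<And>j y. j \<in> Obj J \<Longrightarrow> y \<in> el Q j \<Longrightarrow> \<phi> j (\<psi> j y) = y"
    and ac: "\<And>f i k c. f \<in> hom J i k \<Longrightarrow> c \<in> ?X i \<Longrightarrow> act Q f (\<phi> i c) = \<phi> k (?a f c)"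
    by (rule realization[of ?X ?a, OF sm cl id' co]) (assumption | blast)+
  let ?q = "transformation_of A (\<lambda>j x. \<phi> j (cls j x)) Q"
  have q: "?q \<in> hom S A Q"
    and aq: "\<And>j x. j \<in> Obj J \<Longrightarrow> x \<in> el A j \<Longrightarrow> app ?q j x = \<phi> j (cls j x)"
    by (rule transformation_of[OF A Q]; simp add: \<phi> ac a)+
  show thesis
  proof (rule that[OF q])
    show "surjective ?q"
    proof (rule surjectiveI[OF q])
      fix j y assume j: "j \<in> Obj J" and y: "y \<in> el Q j"
      obtain x where "x \<in> el A j" "\<psi> j y = cls j x" using \<psi>[OF j y] by blast
      then show "\<exists>x\<in>el A j. app ?q j x = y" using aq[OF j] \<phi>\<psi>[OF j y] by auto
    qed
    fix j x y assume j: "j \<in> Obj J" and xy: "x \<in> el A j" "y \<in> el A j"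
    have "\<phi> j (cls j x) = \<phi> j (cls j y) \<longleftrightarrow> cls j x = cls j y"
      using \<psi>\<phi>[OF j] xy by (metis imageI)
    then show "app ?q j x = app ?q j y \<longleftrightarrow> R j x y"
      using aq[OF j] xy cls[OF j xy] by simp
  qed
qed

lemma image_exists:
  assumes p: "p \<in> hom S E B"
  obtains M m where "m \<in> hom S M B" "\<And>j. j \<in> Obj J \<Longrightarrow> el M j = app p j ` el E j"
    "\<And>j x. j \<in> Obj J \<Longrightarrow> x \<in> el M j \<Longrightarrow> app m j x = x"
proof -
  note oE = S_objs(1)[OF p] and oB = S_objs(2)[OF p]
  let ?X = "\<lambda>j. app p j ` el E j"
  have sub: "x \<in> el B j" if "j \<in> Obj J" "x \<in> ?X j" for j x
    using that app_in[OF p] by blast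
  have sm: "small TYPE('u) (?X j)" if "j \<in> Obj J" for j
    by (rule small_image[OF small_el[OF oE that]])
  have cl: "act B f x \<in> ?X k" if f: "f \<in> hom J i k" and x: "x \<in> ?X i" for f i k x
  proof -
    obtain e where e: "e \<in> el E i" "x = app p i e" using x by blast
    show ?thesis unfolding e(2) app_natural[OF p f e(1), symmetric] using act_in[OF oE f e(1)] by blast
  qed
  have id': "act B (Ident J i) x = x" if "i \<in> Obj J" "x \<in> ?X i" for i x
    using act_ident[OF oB that(1) sub[OF that]] .
  have co: "act B (g \<cdot>\<^bsub>J\<^esub> f) x = act B g (act B f x)"
    if "f \<in> hom J i k" "g \<in> hom J k l" "x \<in> ?X i" for f g i k l x
    using act_comp[OF oB that(1,2) sub[OF J_objs(1)[OF that(1)] that(3)]] .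
  let ?M = "diagram_of ?X (act B)"
  have M: "?M \<in> Obj S" and el: "\<And>j. j \<in> Obj J \<Longrightarrow> el ?M j = ?X j"
    and ac: "\<And>f i k x. f \<in> hom J i k \<Longrightarrow> x \<in> ?X i \<Longrightarrow> act ?M f x = act B f x"
    by (rule diagram_of[of ?X "act B", OF sm cl id' co]; assumption)+
  have elE: "x \<in> ?X j" if "j \<in> Obj J" "x \<in> el ?M j" for j x using el that by blast
  show thesis
  proof (rule that[of "transformation_of ?M (\<lambda>j x. x) B" ?M])
    show "transformation_of ?M (\<lambda>j x. x) B \<in> hom S ?M B"
      by (rule transformation_of(1)[OF M oB sub[OF _ elE] ac[OF _ elE[OF J_objs(1)]]])
    show "app (transformation_of ?M (\<lambda>j x. x) B) j x = x" if "j \<in> Obj J" "x \<in> el ?M j" for j x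
      by (rule transformation_of(2)[OF M oB sub[OF _ elE] ac[OF _ elE[OF J_objs(1)]] that])
  qed (rule el)
qed

end

section \<open>Effective descent morphisms of diagrams\<close>

locale diagram_base_change = small_index J u
  for J :: "('j, 'k) cat" and u :: "'u itself" +
  fixes p :: "('j, 'k, 'u) transformation" and E B :: "('j, 'k, 'u) diagram"
  assumes p_hom: "p \<in> hom S E B"

sublocale diagram_base_change \<subseteq> base_change S p E B
proof
  show "category S" by (rule category_S)
  show "p \<in> hom S E B" by (rule p_hom)
  fix f assume "f \<in> Arr S" "Cod S f = B"
  then have f: "f \<in> hom S (Dom S f) B" by (simp add: in_hom_iff)
  then show "\<exists>a b. is_pullback S f p a b"
    using pullback_exists[OF f p_hom] fibred_elements_pullback[OF f p_hom] by metis
qed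

context diagram_base_change
begin

text \<open>The element of the chosen pullback with coordinates \<open>(a, e)\<close>.\<close>

definition pair where
  "pair f j a e = (THE x. x \<in> el (P f) j \<and> app (ptop f) j x = a \<and> app (pr f) j x = e)"

lemma pair_ex1:
  assumes f: "over f B" and "j \<in> Obj J" "a \<in> el (src f) j" "e \<in> el E j" "app f j a = app p j e"
  shows "\<exists>!x. x \<in> el (P f) j \<and> app (ptop f) j x = a \<and> app (pr f) j x = e"
proof -
  have d: "Dom S p = E" "Dom S (ptop f) = P f"
    using p_hom top_hom[OF f] by (auto simp: in_hom_iff)
  show ?thesis
    using pullback_fibred_elements[OF chosen[OF f]] assms(2-) unfolding fibred_elements_def d by blast
qed

lemma pair:
  assumes "over f B" "j \<in> Obj J" "a \<in> el (src f) j" "e \<in> el E j" "app f j a = app p j e"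
  shows "pair f j a e \<in> el (P f) j" "app (ptop f) j (pair f j a e) = a"
    "app (pr f) j (pair f j a e) = e"
  using theI'[OF pair_ex1[OF assms]] unfolding pair_def by auto

lemma proj_in:
  assumes "over f B" "j \<in> Obj J" "x \<in> el (P f) j"
  shows "app (ptop f) j x \<in> el (src f) j" "app (pr f) j x \<in> el E j"
    "app f j (app (ptop f) j x) = app p j (app (pr f) j x)"
proof -
  show "app (ptop f) j x \<in> el (src f) j" "app (pr f) j x \<in> el E j"
    using app_in[OF top_hom] app_in[OF pr_hom] assms by auto
  show "app f j (app (ptop f) j x) = app p j (app (pr f) j x)"
    using app_comp[OF top_hom assms(1)] app_comp[OF pr_hom p_hom] assms square by metis
qed

lemma pair_proj:
  assumes "over f B" "j \<in> Obj J" "x \<in> el (P f) j" "app (ptop f) j x = a" "app (pr f) j x = e"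
  shows "pair f j a e = x"
  unfolding pair_def
  using the1_equality[OF pair_ex1[OF assms(1,2)], of a e x] proj_in[OF assms(1-3)] assms(3-) by auto

lemma act_pair:
  assumes f: "over f B" and h: "h \<in> hom J i k"
    and a: "a \<in> el (src f) i" "e \<in> el E i" "app f i a = app p i e"
  shows "act (P f) h (pair f i a e) = pair f k (act (src f) h a) (act E h e)"
proof -
  note ik = J_objs[OF h] and P = pair[OF f J_objs(1)[OF h] a]
  have "act (P f) h (pair f i a e) \<in> el (P f) k"
    using act_in[OF S_objs(1)[OF top_hom[OF f]] h P(1)] .
  then show ?thesis
    using app_natural[OF top_hom[OF f] h P(1)] app_natural[OF pr_hom[OF f] h P(1)] P
    by (intro pair_proj[OF f ik(2), symmetric]) simp_all
qed

lemma pb_map_pair: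
  assumes f: "over f B" and g: "over g B" and h: "h \<in> hom S (src f) (src g)" "g \<odot> h = f"
    and a: "j \<in> Obj J" "a \<in> el (src f) j" "e \<in> el E j" "app f j a = app p j e"
  shows "app (pb_map S p f h g) j (pair f j a e) = pair g j (app h j a) e"
proof -
  note P = pair[OF f a] and m = pb_map[OF f g h]
  show ?thesis
    using app_in[OF m(1) a(1) P(1)] app_comp[OF m(1) top_hom[OF g] a(1) P(1)]
      app_comp[OF m(1) pr_hom[OF g] a(1) P(1)] app_comp[OF top_hom[OF f] h(1) a(1) P(1)] m P
    by (intro pair_proj[OF g a(1), symmetric]) simp_all
qed

lemma pr_pb_map:
  assumes f: "over f B" and g: "over g B" and k: "k \<in> hom S (P f) (P g)" "pr g \<odot> k = pr f"
    and x: "j \<in> Obj J" "x \<in> el (P f) j"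
  shows "app (pr g) j (app k j x) = app (pr f) j x"
  using app_comp[OF k(1) pr_hom[OF g] x] k(2) by simp

text \<open>The structure map of the canonical descent datum on \<open>p\<^sup>*f\<close> replaces the second
  coordinate: \<open>((a, e), e') \<mapsto> (a, e')\<close>.\<close>

lemma canonical_datum_pair:
  assumes f: "over f B" and j: "j \<in> Obj J" and x: "x \<in> el (P f) j"
    and e: "e \<in> el E j" "app p j (app (pr f) j x) = app p j e"
  shows "app (p \<odot> pr f) j x = app p j e"
    and "app (pb_map S p (p \<odot> pr f) (ptop f) f) j (pair (p \<odot> pr f) j x e) =
      pair f j (app (ptop f) j x) e"
proof -
  note q = p_over[OF pr_over[OF f]]
  show eq: "app (p \<odot> pr f) j x = app p j e"
    using app_comp[OF pr_hom[OF f] p_hom j x] e by simp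
  show "app (pb_map S p (p \<odot> pr f) (ptop f) f) j (pair (p \<odot> pr f) j x e) =
      pair f j (app (ptop f) j x) e"
    using pb_map_pair[OF q(1) f, of "ptop f" j x e] top_hom[OF f] square[OF f] q(2) j x e eq by simp
qed

text \<open>A morphism \<open>k\<close> between the pullbacks sends \<open>(a, e)\<close> to some \<open>(h a, e)\<close> where \<open>h a\<close> could
  depend on \<open>e\<close>; compatibility with the descent data says that it does not. Since \<open>p\<close> is
  surjective, every \<open>a\<close> occurs in such a pair.\<close>

lemma descent_fully_faithful:
  assumes s: "surjective p" and f: "over f B" and g: "over g B"
    and k: "k \<in> hom S (P f) (P g)" "pr g \<odot> k = pr f"
    and c: "k \<odot> pb_map S p (p \<odot> pr f) (ptop f) f =
        pb_map S p (p \<odot> pr g) (ptop g) g \<odot> pb_map S p (p \<odot> pr f) k (p \<odot> pr g)"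
  shows "\<exists>!h. h \<in> hom S (src f) (src g) \<and> g \<odot> h = f \<and> pb_map S p f h g = k"
proof -
  note qf = p_over[OF pr_over[OF f]] and qg = p_over[OF pr_over[OF g]]
  let ?A = "src f" and ?A' = "src g"
  note oA = S_objs(1)[OF f] and oA' = S_objs(1)[OF g] and oE = S_objs(1)[OF p_hom]
  have kk: "k \<in> hom S (src (p \<odot> pr f)) (src (p \<odot> pr g))"
    "(p \<odot> pr g) \<odot> k = p \<odot> pr f"
    using k qf qg category_assoc[OF category_S k(1) pr_hom[OF g] p_hom] by simp_all
  have tf: "ptop f \<in> hom S (src (p \<odot> pr f)) (src f)" "f \<odot> ptop f = p \<odot> pr f"
    and tg: "ptop g \<in> hom S (src (p \<odot> pr g)) (src g)" "g \<odot> ptop g = p \<odot> pr g"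
    using top_hom f g qf qg square by simp_all
  have fib: "\<exists>e. e \<in> el E j \<and> app f j a = app p j e" if "j \<in> Obj J" "a \<in> el ?A j" for j a
    using surjectiveD[OF s p_hom that(1) app_in[OF f that]] by metis
  \<comment> \<open>Compatibility, evaluated at the element \<open>((a, e), e')\<close>.\<close>
  have indep: "app (ptop g) j (app k j (pair f j a e')) = app (ptop g) j (app k j (pair f j a e))"
    if j: "j \<in> Obj J" and a: "a \<in> el ?A j" and e: "e \<in> el E j" "app f j a = app p j e"
      and e': "e' \<in> el E j" "app f j a = app p j e'" for j a e e'
  proof -
    let ?x = "pair f j a e"
    note x = pair[OF f j a e] and x' = pair[OF f j a e']
    have px: "app p j (app (pr f) j ?x) = app p j e'" using x e e' by simp
    note cf = canonical_datum_pair[OF f j x(1) e'(1) px]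
    let ?z = "pair (p \<odot> pr f) j ?x e'"
    have z: "?z \<in> el (P (p \<odot> pr f)) j"
      using pair(1)[OF qf(1) j, of ?x e'] qf(2) x(1) e' cf(1) by simp
    have kx: "app k j ?x \<in> el (P g) j" using app_in[OF k(1) j x(1)] .
    have pkx: "app p j (app (pr g) j (app k j ?x)) = app p j e'"
      using pr_pb_map[OF f g k j x(1)] px by simp
    note cg = canonical_datum_pair[OF g j kx e'(1) pkx]
    have "app k j (pair f j a e') = pair g j (app (ptop g) j (app k j ?x)) e'"
      using app_comp[OF pb_map(1)[OF qf(1) f tf] k(1) j z]
        app_comp[OF pb_map(1)[OF qf(1) qg(1) kk] pb_map(1)[OF qg(1) g tg] j z] c cf(2) cg(2)
        pb_map_pair[OF qf(1) qg(1) kk j, of ?x e'] x cf(1) e'(1) qf(2) by simp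
    moreover have "app g j (app (ptop g) j (app k j ?x)) = app p j e'"
      using proj_in(3)[OF g j kx] pkx by simp
    ultimately show ?thesis
      using pair(2)[OF g j proj_in(1)[OF g j kx] e'(1)] by simp
  qed
  define h0 where "h0 j a = app (ptop g) j (app k j (pair f j a (SOME e. e \<in> el E j \<and> app f j a = app p j e)))"
    for j a
  have h0: "h0 j a = app (ptop g) j (app k j (pair f j a e))"
    if "j \<in> Obj J" "a \<in> el ?A j" "e \<in> el E j" "app f j a = app p j e" for j a e
    using someI_ex[OF fib[OF that(1,2)]] unfolding h0_def by (intro indep[OF that(1,2)]) (use that in auto)
  have h0in: "h0 j a \<in> el ?A' j" if "j \<in> Obj J" "a \<in> el ?A j" for j a
    using fib[OF that] h0[OF that] pair(1)[OF f that] app_in[OF k(1) that(1)] proj_in(1)[OF g that(1)]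
    by metis
  have h0nat: "h0 l (act ?A t a) = act ?A' t (h0 i a)" if t: "t \<in> hom J i l" and a: "a \<in> el ?A i" for t i l a
  proof -
    note il = J_objs[OF t]
    obtain e where e: "e \<in> el E i" "app f i a = app p i e" using fib[OF il(1) a] by blast
    have e': "act E t e \<in> el E l" "app f l (act ?A t a) = app p l (act E t e)"
      using act_in[OF oE t e(1)] app_natural[OF f t a] app_natural[OF p_hom t e(1)] e by simp_all
    note x = pair(1)[OF f il(1) a e]
    show ?thesis
      using h0[OF il(1) a e] h0[OF il(2) act_in[OF oA t a] e'] act_pair[OF f t a e]
        app_natural[OF k(1) t x] app_natural[OF top_hom[OF g] t app_in[OF k(1) il(1) x]] by simp
  qed
  let ?h = "transformation_of ?A h0 ?A'"
  have h: "?h \<in> hom S ?A ?A'" and ah: "\<And>j a. j \<in> Obj J \<Longrightarrow> a \<in> el ?A j \<Longrightarrow> app ?h j a = h0 j a"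
    by (rule transformation_of[OF oA oA' h0in h0nat]; assumption)+
  have gh: "g \<odot> ?h = f"
  proof (rule transformation_eqI[OF comp_in[OF h g] f])
    fix j a assume j: "j \<in> Obj J" and a: "a \<in> el ?A j"
    obtain e where e: "e \<in> el E j" "app f j a = app p j e" using fib[OF j a] by blast
    note x = pair[OF f j a e]
    show "app (g \<odot> ?h) j a = app f j a"
      using app_comp[OF h g j a] ah[OF j a] h0[OF j a e] proj_in(3)[OF g j app_in[OF k(1) j x(1)]]
        pr_pb_map[OF f g k j x(1)] x e by simp
  qed
  have hk: "pb_map S p f ?h g = k"
  proof (rule transformation_eqI[OF pb_map(1)[OF f g h gh] k(1)])
    fix j x assume j: "j \<in> Obj J" and x: "x \<in> el (P f) j"
    note px = proj_in[OF f j x]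
    have xe: "pair f j (app (ptop f) j x) (app (pr f) j x) = x" by (rule pair_proj[OF f j x refl refl])
    have "app (pb_map S p f ?h g) j x = pair g j (h0 j (app (ptop f) j x)) (app (pr f) j x)"
      using pb_map_pair[OF f g h gh j px] xe ah[OF j px(1)] by simp
    also have "\<dots> = app k j x"
      using h0[OF j px] xe pr_pb_map[OF f g k j x]
      by (intro pair_proj[OF g j app_in[OF k(1) j x]]) simp_all
    finally show "app (pb_map S p f ?h g) j x = app k j x" .
  qed
  show ?thesis
  proof (rule ex1I[of _ ?h])
    show "?h \<in> hom S ?A ?A' \<and> g \<odot> ?h = f \<and> pb_map S p f ?h g = k" using h gh hk by blast
    fix h' assume "h' \<in> hom S ?A ?A' \<and> g \<odot> h' = f \<and> pb_map S p f h' g = k"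
    then have h': "h' \<in> hom S ?A ?A'" "g \<odot> h' = f" "pb_map S p f h' g = k" by auto
    show "h' = ?h"
    proof (rule transformation_eqI[OF h'(1) h])
      fix j a assume j: "j \<in> Obj J" and a: "a \<in> el ?A j"
      obtain e where e: "e \<in> el E j" "app f j a = app p j e" using fib[OF j a] by blast
      have "app g j (app h' j a) = app p j e" using app_comp[OF h'(1) g j a] h'(2) e by simp
      then have "app (ptop g) j (pair g j (app h' j a) e) = app h' j a"
        by (rule pair(2)[OF g j app_in[OF h'(1) j a] e(1)])
      then show "app h' j a = app ?h j a"
        using pb_map_pair[OF f g h'(1,2) j a e] h'(3) h0[OF j a e] ah[OF j a] by simp
    qed
  qed
qed

text \<open>A descent datum \<open>a : X \<times>\<^sub>B E \<rightarrow> X\<close> says how to transport \<open>x\<close> into the fibre over any \<open>e\<close>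
  with \<open>p e = p (g x)\<close>.  Identifying elements that are transported to each other gives the
  object over \<open>B\<close>.\<close>

lemma descent_effective:
  assumes s: "surjective p" and g: "over g E"
    and a: "a \<in> hom S (P (p \<odot> g)) (src g)" "g \<odot> a = pr (p \<odot> g)"
    and au: "a \<odot> pb_unit S p g = Ident S (src g)"
    and am: "a \<odot> pb_map S p (p \<odot> pr (p \<odot> g)) a (p \<odot> g) =
        a \<odot> pb_map S p (p \<odot> pr (p \<odot> g)) (ptop (p \<odot> g)) (p \<odot> g)"
  shows "\<exists>f \<phi>. over f B \<and> \<phi> \<in> hom S (P f) (src g) \<and> iso S \<phi> \<and> g \<odot> \<phi> = pr f \<and>
          \<phi> \<odot> pb_map S p (p \<odot> pr f) (ptop f) f =
          a \<odot> pb_map S p (p \<odot> pr f) \<phi> (p \<odot> g)"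
proof -
  let ?X = "src g" and ?pg = "p \<odot> g"
  let ?Q = "p \<odot> pr ?pg"
  note pg = p_over[OF g] and oX = S_objs(1)[OF g] and oE = S_objs(1)[OF p_hom]
  note Q = p_over[OF pr_over[OF pg(1)]]
  have apg: "app ?pg j x = app p j (app g j x)" if "j \<in> Obj J" "x \<in> el ?X j" for j x
    using app_comp[OF g p_hom that] .
  \<comment> \<open>\<open>ok\<close> describes the elements of \<open>X \<times>\<^sub>B E\<close>, and \<open>\<alpha> j x e\<close> is \<open>x\<close> transported to the fibre
    over \<open>e\<close>.\<close>
  define ok where "ok j x e \<longleftrightarrow> j \<in> Obj J \<and> x \<in> el ?X j \<and> e \<in> el E j \<and> app p j (app g j x) = app p j e"
    for j x e
  define \<alpha> where "\<alpha> j x e = app a j (pair ?pg j x e)" for j x e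
  have pr: "pair ?pg j x e \<in> el (P ?pg) j" "app (ptop ?pg) j (pair ?pg j x e) = x"
    "app (pr ?pg) j (pair ?pg j x e) = e" if "ok j x e" for j x e
    using pair[OF pg(1), of j x e] that apg pg(2) by (auto simp: ok_def)
  have \<alpha>in: "\<alpha> j x e \<in> el ?X j" if "ok j x e" for j x e
    unfolding \<alpha>_def using app_in[OF a(1) _ pr(1)[OF that]] that by (simp add: ok_def)
  have g\<alpha>: "app g j (\<alpha> j x e) = e" if "ok j x e" for j x e
    unfolding \<alpha>_def using app_comp[OF a(1) g _ pr(1)[OF that]] pr(3)[OF that] a(2) that
    by (simp add: ok_def)
  have ok_self: "ok j x (app g j x)" if "j \<in> Obj J" "x \<in> el ?X j" for j x
    using that app_in[OF g that] by (simp add: ok_def)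
  have \<alpha>unit: "\<alpha> j x (app g j x) = x" if j: "j \<in> Obj J" and x: "x \<in> el ?X j" for j x
  proof -
    note u = pb_unit[OF g]
    have t: "ptop ?pg \<in> hom S (P ?pg) ?X" using top_hom[OF pg(1)] pg(2) by simp
    have "pair ?pg j x (app g j x) = app (pb_unit S p g) j x"
      using app_comp[OF u(1) t j x] app_comp[OF u(1) pr_hom[OF pg(1)] j x] u app_ident[OF oX j x]
      by (intro pair_proj[OF pg(1) j app_in[OF u(1) j x]]) simp_all
    then show ?thesis
      unfolding \<alpha>_def using app_comp[OF u(1) a(1) j x] au app_ident[OF oX j x] by simp
  qed
  have aQ: "a \<in> hom S (src ?Q) (src ?pg)" "?pg \<odot> a = ?Q"
    using a Q pg category_assoc[OF category_S a(1) g p_hom] by simp_all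
  have tQ: "ptop ?pg \<in> hom S (src ?Q) (src ?pg)" "?pg \<odot> ptop ?pg = ?Q"
    using top_hom[OF pg(1)] Q square[OF pg(1)] by simp_all
  have \<alpha>\<alpha>: "ok j x e' \<and> ok j (\<alpha> j x e) e' \<and> \<alpha> j (\<alpha> j x e) e' = \<alpha> j x e'"
    if e: "ok j x e" and e': "e' \<in> el E j" "app p j e = app p j e'" for j x e e'
  proof -
    have j: "j \<in> Obj J" using e by (simp add: ok_def)
    have ok1: "ok j x e'" "ok j (\<alpha> j x e) e'" using e e' g\<alpha>[OF e] \<alpha>in[OF e] by (auto simp: ok_def)
    let ?y = "pair ?pg j x e"
    note y = pr[OF e]
    have Qy: "app ?Q j ?y = app p j e'" using app_comp[OF pr_hom[OF pg(1)] p_hom j y(1)] y e' by simp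
    have yQ: "?y \<in> el (src ?Q) j" using y Q by simp
    note z = pair(1)[OF Q(1) j yQ e'(1) Qy]
    have "app a j (app (pb_map S p ?Q a ?pg) j (pair ?Q j ?y e')) =
        app a j (app (pb_map S p ?Q (ptop ?pg) ?pg) j (pair ?Q j ?y e'))"
      using app_comp[OF pb_map(1)[OF Q(1) pg(1) aQ] a(1) j z]
        app_comp[OF pb_map(1)[OF Q(1) pg(1) tQ] a(1) j z] am by simp
    then have "\<alpha> j (\<alpha> j x e) e' = \<alpha> j x e'"
      using pb_map_pair[OF Q(1) pg(1) aQ j yQ e'(1) Qy] pb_map_pair[OF Q(1) pg(1) tQ j yQ e'(1) Qy] y
      by (simp add: \<alpha>_def)
    then show ?thesis using ok1 by blast
  qed
  have \<alpha>nat: "ok l (act ?X t x) (act E t e) \<and> \<alpha> l (act ?X t x) (act E t e) = act ?X t (\<alpha> i x e)"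
    if t: "t \<in> hom J i l" and e: "ok i x e" for t i l x e
  proof -
    note il = J_objs[OF t]
    have x: "x \<in> el ?X i" "e \<in> el E i" "app p i (app g i x) = app p i e" using e by (auto simp: ok_def)
    have "app p l (app g l (act ?X t x)) = app p l (act E t e)"
      using app_natural[OF g t x(1)] app_natural[OF p_hom t app_in[OF g il(1) x(1)]]
        app_natural[OF p_hom t x(2)] x(3) by simp
    then have "ok l (act ?X t x) (act E t e)"
      using act_in[OF oX t x(1)] act_in[OF oE t x(2)] il by (simp add: ok_def)
    moreover have "\<alpha> l (act ?X t x) (act E t e) = act ?X t (\<alpha> i x e)"
      unfolding \<alpha>_def using act_pair[OF pg(1) t, of x e] x pg(2) apg[OF il(1) x(1)]
        app_natural[OF a(1) t pr(1)[OF e]] by simp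
    ultimately show ?thesis by blast
  qed
  define R where "R j x y \<longleftrightarrow> ok j x (app g j y) \<and> \<alpha> j x (app g j y) = y" for j x y
  have Rrefl: "R j x x" if "j \<in> Obj J" "x \<in> el ?X j" for j x
    unfolding R_def using ok_self[OF that] \<alpha>unit[OF that] by simp
  have Rmove: "\<alpha> j y e = \<alpha> j x e \<and> ok j x e" if "R j x y" "ok j y e" for j x y e
    using \<alpha>\<alpha>[of j x "app g j y" e] that by (auto simp: R_def ok_def)
  have Rsym: "R j y x" if j: "j \<in> Obj J" and x: "x \<in> el ?X j" and y: "y \<in> el ?X j" and r: "R j x y" for j x y
  proof -
    have "ok j y (app g j x)" using r y app_in[OF g j x] by (auto simp: R_def ok_def)
    then show ?thesis using Rmove[OF r] \<alpha>unit[OF j x] by (simp add: R_def)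
  qed
  have Rtrans: "R j x z" if "R j x y" "R j y z" for j x y z
    using Rmove[OF that(1), of "app g j z"] that(2) by (auto simp: R_def)
  have Ract: "R l (act ?X t x) (act ?X t y)"
    if t: "t \<in> hom J i l" and x: "x \<in> el ?X i" and y: "y \<in> el ?X i" and r: "R i x y" for t i l x y
    using \<alpha>nat[OF t, of x "app g i y"] app_natural[OF g t y] r by (simp add: R_def)
  obtain A q where q: "q \<in> hom S ?X A" "surjective q"
    and qR: "\<And>j x y. j \<in> Obj J \<Longrightarrow> x \<in> el ?X j \<Longrightarrow> y \<in> el ?X j \<Longrightarrow> app q j x = app q j y \<longleftrightarrow> R j x y"
    by (rule quotient_exists[of ?X R, OF oX Rrefl Rsym Rtrans Ract]) (assumption | blast)+
  have pgX: "?pg \<in> hom S ?X B" using pg by simp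
  obtain f where f0: "f \<in> hom S A B" and fq: "\<And>j x. j \<in> Obj J \<Longrightarrow> x \<in> el ?X j \<Longrightarrow> app f j (app q j x) = app ?pg j x"
  proof (rule descend_along_surjective[OF q pgX])
    fix j x y assume "j \<in> Obj J" "x \<in> el ?X j" "y \<in> el ?X j" "app q j x = app q j y"
    then show "app ?pg j x = app ?pg j y" using qR[of j x y] by (auto simp: R_def ok_def apg)
  qed blast
  have fA: "src f = A" using f0 by (simp add: in_hom_iff)
  have f: "over f B" using f0 fA by simp
  have rep: "\<exists>x. x \<in> el ?X j \<and> app q j x = app (ptop f) j y" if "j \<in> Obj J" "y \<in> el (P f) j" for j y
    using surjectiveD[OF q(2,1) that(1)] proj_in(1)[OF f that] fA by metis
  have okrep: "ok j x e" if "j \<in> Obj J" "x \<in> el ?X j" "e \<in> el E j" "app f j (app q j x) = app p j e" for j x e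
    using that fq apg by (simp add: ok_def)
  have okpr: "ok j x (app (pr f) j y)"
    if "j \<in> Obj J" "y \<in> el (P f) j" "x \<in> el ?X j" "app q j x = app (ptop f) j y" for j x y
    using okrep[OF that(1,3)] proj_in[OF f that(1,2)] that(4) by simp
  define \<phi>0 where "\<phi>0 j y = \<alpha> j (SOME x. x \<in> el ?X j \<and> app q j x = app (ptop f) j y) (app (pr f) j y)" for j y
  have \<phi>0: "\<phi>0 j y = \<alpha> j x (app (pr f) j y)"
    if j: "j \<in> Obj J" and y: "y \<in> el (P f) j" and x: "x \<in> el ?X j" "app q j x = app (ptop f) j y" for j x y
  proof -
    let ?x = "SOME x. x \<in> el ?X j \<and> app q j x = app (ptop f) j y"
    have X: "?x \<in> el ?X j" "app q j ?x = app (ptop f) j y" using someI_ex[OF rep[OF j y]] by auto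
    have "R j x ?x" using qR[OF j x(1) X(1)] X(2) x(2) by simp
    from Rmove[OF this okpr[OF j y X]] show ?thesis by (simp add: \<phi>0_def)
  qed
  have \<phi>0in: "\<phi>0 j y \<in> el ?X j" if j: "j \<in> Obj J" and y: "y \<in> el (P f) j" for j y
  proof -
    obtain x where x: "x \<in> el ?X j" "app q j x = app (ptop f) j y" using rep[OF j y] by blast
    show ?thesis unfolding \<phi>0[OF j y x] by (rule \<alpha>in[OF okpr[OF j y x]])
  qed
  note oP = S_objs(1)[OF top_hom[OF f]]
  have \<phi>0nat: "\<phi>0 l (act (P f) t y) = act ?X t (\<phi>0 i y)" if t: "t \<in> hom J i l" and y: "y \<in> el (P f) i" for t i l y
  proof -
    note il = J_objs[OF t]
    obtain x where x: "x \<in> el ?X i" "app q i x = app (ptop f) i y" using rep[OF il(1) y] by blast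
    have "app q l (act ?X t x) = app (ptop f) l (act (P f) t y)"
      using app_natural[OF q(1) t x(1)] app_natural[OF top_hom[OF f] t y] x fA by simp
    from \<phi>0[OF il(2) act_in[OF oP t y] act_in[OF oX t x(1)] this]
    show ?thesis
      using app_natural[OF pr_hom[OF f] t y] \<alpha>nat[OF t okpr[OF il(1) y x]] \<phi>0[OF il(1) y x] by simp
  qed
  let ?\<phi> = "transformation_of (P f) \<phi>0 ?X"
  have \<phi>: "?\<phi> \<in> hom S (P f) ?X" and a\<phi>: "\<And>j y. j \<in> Obj J \<Longrightarrow> y \<in> el (P f) j \<Longrightarrow> app ?\<phi> j y = \<phi>0 j y"
    by (rule transformation_of[OF oP oX \<phi>0in \<phi>0nat]; assumption)+
  have g\<phi>: "app g j (\<phi>0 j y) = app (pr f) j y" if j: "j \<in> Obj J" and y: "y \<in> el (P f) j" for j y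
  proof -
    obtain x where x: "x \<in> el ?X j" "app q j x = app (ptop f) j y" using rep[OF j y] by blast
    show ?thesis unfolding \<phi>0[OF j y x] by (rule g\<alpha>[OF okpr[OF j y x]])
  qed
  \<comment> \<open>The map \<open>([x], e) \<mapsto> \<alpha> x e\<close> has the inverse \<open>x \<mapsto> ([x], g x)\<close>.\<close>
  have iso: "iso S ?\<phi>"
    unfolding iso_S_iff[OF \<phi>]
  proof
    fix j assume j: "j \<in> Obj J"
    have pairin: "pair f j (app q j x) (app g j x) \<in> el (P f) j"
      "app (ptop f) j (pair f j (app q j x) (app g j x)) = app q j x"
      "app (pr f) j (pair f j (app q j x) (app g j x)) = app g j x" if x: "x \<in> el ?X j" for x
      using pair[OF f j, of "app q j x" "app g j x"] app_in[OF q(1) j x] app_in[OF g j x] fA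
        fq[OF j x] apg[OF j x] by simp_all
    show "bij_betw (app ?\<phi> j) (el (P f) j) (el ?X j)"
    proof (rule bij_betw_byWitness[where f' = "\<lambda>x. pair f j (app q j x) (app g j x)"])
      show "\<forall>y\<in>el (P f) j. pair f j (app q j (app ?\<phi> j y)) (app g j (app ?\<phi> j y)) = y"
      proof
        fix y assume y: "y \<in> el (P f) j"
        obtain x where x: "x \<in> el ?X j" "app q j x = app (ptop f) j y" using rep[OF j y] by blast
        note o = okpr[OF j y x]
        have "R j x (\<phi>0 j y)" unfolding R_def g\<phi>[OF j y] using o \<phi>0[OF j y x] by simp
        then have "app q j (\<phi>0 j y) = app (ptop f) j y" using qR[OF j x(1) \<phi>0in[OF j y]] x(2) by simp
        then show "pair f j (app q j (app ?\<phi> j y)) (app g j (app ?\<phi> j y)) = y"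
          unfolding a\<phi>[OF j y] g\<phi>[OF j y] by (intro pair_proj[OF f j y]) simp_all
      qed
      show "\<forall>x\<in>el ?X j. app ?\<phi> j (pair f j (app q j x) (app g j x)) = x"
        using a\<phi>[OF j pairin(1)] \<phi>0[OF j pairin(1) _ pairin(2)[symmetric]] pairin(3) \<alpha>unit[OF j] by simp
      show "app ?\<phi> j ` el (P f) j \<subseteq> el ?X j" using app_in[OF \<phi> j] by blast
      show "(\<lambda>x. pair f j (app q j x) (app g j x)) ` el ?X j \<subseteq> el (P f) j" using pairin(1) by blast
    qed
  qed
  have gphi: "g \<odot> ?\<phi> = pr f"
    by (rule transformation_eqI[OF comp_in[OF \<phi> g] pr_hom[OF f]])
      (simp add: app_comp[OF \<phi> g] a\<phi> g\<phi>)
  let ?Qf = "p \<odot> pr f"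
  note Qf = p_over[OF pr_over[OF f]]
  have tf: "ptop f \<in> hom S (src ?Qf) (src f)" "f \<odot> ptop f = ?Qf"
    using top_hom[OF f] Qf square[OF f] by simp_all
  have pf: "?\<phi> \<in> hom S (src ?Qf) (src ?pg)" "?pg \<odot> ?\<phi> = ?Qf"
    using \<phi> gphi Qf pg category_assoc[OF category_S \<phi> g p_hom] by simp_all
  note m1 = pb_map(1)[OF Qf(1) f tf] and m2 = pb_map(1)[OF Qf(1) pg(1) pf]
  have "?\<phi> \<odot> pb_map S p ?Qf (ptop f) f = a \<odot> pb_map S p ?Qf ?\<phi> ?pg"
  proof (rule transformation_eqI[OF comp_in[OF m1 \<phi>] comp_in[OF m2 a(1)]])
    fix j z assume j: "j \<in> Obj J" and z: "z \<in> el (P ?Qf) j"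
    define y e where "y = app (ptop ?Qf) j z" and "e = app (pr ?Qf) j z"
    have y: "y \<in> el (P f) j" and e: "e \<in> el E j" and ye: "app ?Qf j y = app p j e"
      using proj_in[OF Qf(1) j z] Qf(2) by (simp_all add: y_def e_def)
    have zz: "pair ?Qf j y e = z" by (rule pair_proj[OF Qf(1) j z]) (simp_all add: y_def e_def)
    have pe: "app p j (app (pr f) j y) = app p j e" using app_comp[OF pr_hom[OF f] p_hom j y] ye by simp
    obtain x where x: "x \<in> el ?X j" "app q j x = app (ptop f) j y" using rep[OF j y] by blast
    note o = okpr[OF j y x]
    have fe: "app f j (app (ptop f) j y) = app p j e" using proj_in(3)[OF f j y] pe by simp
    note y' = pair[OF f j proj_in(1)[OF f j y] e fe]
    have "app (?\<phi> \<odot> pb_map S p ?Qf (ptop f) f) j z = \<phi>0 j (pair f j (app (ptop f) j y) e)"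
      using app_comp[OF m1 \<phi> j z] canonical_datum_pair(2)[OF f j y e pe] zz a\<phi>[OF j y'(1)] by simp
    also have "\<dots> = \<alpha> j x e" using \<phi>0[OF j y'(1) x(1)] y' x(2) by simp
    also have "\<dots> = \<alpha> j (\<phi>0 j y) e" using \<alpha>\<alpha>[OF o e pe] \<phi>0[OF j y x] by simp
    also have "\<dots> = app (a \<odot> pb_map S p ?Qf ?\<phi> ?pg) j z"
      using app_comp[OF m2 a(1) j z] pb_map_pair[OF Qf(1) pg(1) pf j _ e ye] y Qf(2) zz a\<phi>[OF j y]
      by (simp add: \<alpha>_def)
    finally show "app (?\<phi> \<odot> pb_map S p ?Qf (ptop f) f) j z = app (a \<odot> pb_map S p ?Qf ?\<phi> ?pg) j z" .
  qed
  then show ?thesis using f \<phi> iso gphi by blast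
qed

lemma effective_descent_if_surjective: "surjective p \<Longrightarrow> effective_descent S p"
  by (rule effective_descentI) (rule descent_fully_faithful descent_effective; assumption)+

text \<open>Pulling back along \<open>p\<close> makes the inclusion of the image of \<open>p\<close> invertible, so the
  inclusion itself is invertible when \<open>p\<close> is of effective descent.\<close>

lemma surjective_if_effective_descent:
  assumes ed: "effective_descent S p"
  shows "surjective p"
proof -
  obtain M m where m: "m \<in> hom S M B" and el: "\<And>j. j \<in> Obj J \<Longrightarrow> el M j = app p j ` el E j"
    and am: "\<And>j x. j \<in> Obj J \<Longrightarrow> x \<in> el M j \<Longrightarrow> app m j x = x"
    using image_exists[OF p_hom] by metis
  note oB = S_objs(2)[OF m]
  let ?i = "Ident S B"
  have i: "?i \<in> hom S B B" by (rule ident_in[OF oB])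
  have d: "src m = M" "src ?i = B" using m i by (auto simp: in_hom_iff)
  have mo: "over m B" and io: "over ?i B" using m i d by simp_all
  have h: "m \<in> hom S (src m) (src ?i)" "?i \<odot> m = m"
    using m d category_ident_comp[OF category_S m] by simp_all
  note k = pb_map(1)[OF mo io h]
  have eqv: "app (pb_map S p m m ?i) j x = pair ?i j (app (ptop m) j x) (app (pr m) j x)"
    "app ?i j (app (ptop m) j x) = app p j (app (pr m) j x)" "app (ptop m) j x \<in> el B j"
    if j: "j \<in> Obj J" and x: "x \<in> el (P m) j" for j x
  proof -
    note px = proj_in[OF mo j x]
    have t: "app (ptop m) j x \<in> el M j" using px d by simp
    show tB: "app (ptop m) j x \<in> el B j" using app_in[OF m j t] am[OF j t] by simp
    show "app ?i j (app (ptop m) j x) = app p j (app (pr m) j x)"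
      using app_ident[OF oB j tB] px(3) am[OF j t] by simp
    show "app (pb_map S p m m ?i) j x = pair ?i j (app (ptop m) j x) (app (pr m) j x)"
      using pb_map_pair[OF mo io h j px] pair_proj[OF mo j x refl refl] am[OF j t] by simp
  qed
  have "iso S (pb_map S p m m ?i)"
    unfolding iso_S_iff[OF k]
  proof
    fix j assume j: "j \<in> Obj J"
    show "bij_betw (app (pb_map S p m m ?i) j) (el (P m) j) (el (P ?i) j)"
      unfolding bij_betw_def
    proof
      show "inj_on (app (pb_map S p m m ?i) j) (el (P m) j)"
      proof (rule inj_onI)
        fix x y assume x: "x \<in> el (P m) j" and y: "y \<in> el (P m) j"
          and xy: "app (pb_map S p m m ?i) j x = app (pb_map S p m m ?i) j y"
        have eq: "pair ?i j (app (ptop m) j x) (app (pr m) j x) =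
            pair ?i j (app (ptop m) j y) (app (pr m) j y)"
          using xy unfolding eqv(1)[OF j x] eqv(1)[OF j y] .
        note X = pair[OF io j _ proj_in(2)[OF mo j x] eqv(2)[OF j x], unfolded d, OF eqv(3)[OF j x]]
          and Y = pair[OF io j _ proj_in(2)[OF mo j y] eqv(2)[OF j y], unfolded d, OF eqv(3)[OF j y]]
        have "app (ptop m) j x = app (ptop m) j y"
          using arg_cong[OF eq, of "app (ptop ?i) j"] unfolding X(2) Y(2) .
        moreover have "app (pr m) j x = app (pr m) j y"
          using arg_cong[OF eq, of "app (pr ?i) j"] unfolding X(3) Y(3) .
        ultimately have "pair m j (app (ptop m) j x) (app (pr m) j x) =
            pair m j (app (ptop m) j y) (app (pr m) j y)"
          by (rule arg_cong2)
        then show "x = y" unfolding pair_proj[OF mo j x refl refl] pair_proj[OF mo j y refl refl] .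
      qed
      show "app (pb_map S p m m ?i) j ` el (P m) j = el (P ?i) j"
      proof
        show "app (pb_map S p m m ?i) j ` el (P m) j \<subseteq> el (P ?i) j" using app_in[OF k j] by blast
        show "el (P ?i) j \<subseteq> app (pb_map S p m m ?i) j ` el (P m) j"
        proof
          fix z assume z: "z \<in> el (P ?i) j"
          note pz = proj_in[OF io j z]
          have t: "app (ptop ?i) j z = app p j (app (pr ?i) j z)"
            using pz app_ident[OF oB j] d by simp
          then have tM: "app (ptop ?i) j z \<in> el M j" using pz(2) el[OF j] by simp
          have "app m j (app (ptop ?i) j z) = app p j (app (pr ?i) j z)" using am[OF j tM] t by simp
          note x = pair[OF mo j _ pz(2) this, unfolded d, OF tM]
          have "app (pb_map S p m m ?i) j (pair m j (app (ptop ?i) j z) (app (pr ?i) j z)) = z"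
            unfolding eqv(1)[OF j x(1)] x(2,3) by (rule pair_proj[OF io j z refl refl])
          then show "z \<in> app (pb_map S p m m ?i) j ` el (P m) j" using x(1) by force
        qed
      qed
    qed
  qed
  from effective_descent_reflects_iso[OF ed mo io h this]
  have "\<forall>j\<in>Obj J. bij_betw (app m j) (el M j) (el B j)" using iso_S_iff[OF m] by blast
  then have b: "app m j ` el M j = el B j" if "j \<in> Obj J" for j
    using that bij_betw_imp_surj_on by blast
  show ?thesis
  proof (rule surjectiveI[OF p_hom])
    fix j y assume j: "j \<in> Obj J" and "y \<in> el B j"
    then obtain x where "x \<in> el M j" "y = app m j x" using b[OF j] by blast
    then have "y \<in> app p j ` el E j" using am[OF j] el[OF j] by simp
    then show "\<exists>e\<in>el E j. app p j e = y" by blast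
  qed
qed

end

section \<open>Pseudo-filtered index categories\<close>

lemma in_hom_full_subcategory_iff:
  "f \<in> hom (full_subcategory C X) A B \<longleftrightarrow> f \<in> hom C A B \<and> A \<in> X \<and> B \<in> X"
  by (auto simp: full_subcategory_def hom_def)

lemma full_subcategory_simps [simp]:
  "Comp (full_subcategory C X) = Comp C" "Ident (full_subcategory C X) = Ident C"
  "Obj (full_subcategory C X) = Obj C \<inter> X"
  by (simp_all add: full_subcategory_def)

lemma iso_full_subcategory_iff:
  assumes f: "f \<in> hom (full_subcategory C X) A B"
  shows "iso (full_subcategory C X) f \<longleftrightarrow> iso C f"
proof
  assume "iso (full_subcategory C X) f"
  then obtain g where "g \<in> hom (full_subcategory C X) B A" "g \<cdot>\<^bsub>C\<^esub> f = Ident C A" "f \<cdot>\<^bsub>C\<^esub> g = Ident C B"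
    using isoE[OF _ f] by auto
  then show "iso C f" using f isoI[of f C A B g] unfolding in_hom_full_subcategory_iff by blast
next
  assume i: "iso C f"
  have fC: "f \<in> hom C A B" and AB: "A \<in> X" "B \<in> X" using f unfolding in_hom_full_subcategory_iff by auto
  obtain g where g: "g \<in> hom C B A" "g \<cdot>\<^bsub>C\<^esub> f = Ident C A" "f \<cdot>\<^bsub>C\<^esub> g = Ident C B"
    using isoE[OF i fC] .
  have "g \<in> hom (full_subcategory C X) B A" unfolding in_hom_full_subcategory_iff using g AB by blast
  from isoI[OF f this] show "iso (full_subcategory C X) f" using g by simp
qed

lemma pseudo_filtered_coequalize:
  assumes J: "pseudo_filtered J" and f: "f \<in> hom J i k" and g: "g \<in> hom J i k"
  obtains l h where "h \<in> hom J k l" "h \<cdot>\<^bsub>J\<^esub> f = h \<cdot>\<^bsub>J\<^esub> g"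
proof -
  have C: "category J" using J by (simp add: pseudo_filtered_def)
  have ik: "i \<in> Obj J" "k \<in> Obj J" using category_hom_objs[OF C f] by auto
  let ?X = "connected_objs J `` {i}"
  have X: "i \<in> ?X" "k \<in> ?X" using ik f by (auto simp: connected_objs_def)
  have "filtered (full_subcategory J ?X)" using J ik by (simp add: pseudo_filtered_def)
  then have "\<exists>l. \<exists>h\<in>hom (full_subcategory J ?X) k l. h \<cdot>\<^bsub>J\<^esub> f = h \<cdot>\<^bsub>J\<^esub> g"
    using f g X unfolding filtered_def in_hom_full_subcategory_iff[symmetric]
    by (simp add: in_hom_full_subcategory_iff)
  then obtain l h where "h \<in> hom (full_subcategory J ?X) k l" "h \<cdot>\<^bsub>J\<^esub> f = h \<cdot>\<^bsub>J\<^esub> g" by blast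
  then show thesis using that[of h l] unfolding in_hom_full_subcategory_iff by simp
qed

text \<open>The codomains of a span lie in one connected component, so they map to a common object; the
  two composites out of the vertex are then coequalized.\<close>

lemma pseudo_filtered_span:
  assumes J: "pseudo_filtered J" and f: "f \<in> hom J i k" and g: "g \<in> hom J i l"
  obtains m u v where "u \<in> hom J k m" "v \<in> hom J l m" "u \<cdot>\<^bsub>J\<^esub> f = v \<cdot>\<^bsub>J\<^esub> g"
proof -
  have C: "category J" using J by (simp add: pseudo_filtered_def)
  have ikl: "i \<in> Obj J" "k \<in> Obj J" "l \<in> Obj J"
    using category_hom_objs[OF C f] category_hom_objs[OF C g] by auto
  let ?X = "connected_objs J `` {i}"
  have X: "k \<in> ?X" "l \<in> ?X" using ikl f g by (auto simp: connected_objs_def)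
  have "filtered (full_subcategory J ?X)" using J ikl by (simp add: pseudo_filtered_def)
  then have "\<exists>Y. hom (full_subcategory J ?X) k Y \<noteq> {} \<and> hom (full_subcategory J ?X) l Y \<noteq> {}"
    using ikl X unfolding filtered_def by simp
  then obtain Y u v where u: "u \<in> hom J k Y" and v: "v \<in> hom J l Y"
    unfolding in_hom_full_subcategory_iff ex_in_conv[symmetric] by blast
  obtain m h where h: "h \<in> hom J Y m" "h \<cdot>\<^bsub>J\<^esub> (u \<cdot>\<^bsub>J\<^esub> f) = h \<cdot>\<^bsub>J\<^esub> (v \<cdot>\<^bsub>J\<^esub> g)"
    using pseudo_filtered_coequalize[OF J category_comp[OF C f u] category_comp[OF C g v]] .
  show thesis
    by (rule that[OF category_comp[OF C u h(1)] category_comp[OF C v h(1)]])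
      (simp add: category_assoc[OF C f u h(1)] category_assoc[OF C g v h(1)] h(2))
qed

section \<open>Elements that become equal\<close>

context small_index
begin

text \<open>Two elements over the same index are identified in the colimit of a pseudo-filtered
  diagram exactly when some morphism identifies them.\<close>

definition ev_eq :: "('j, 'k, 'u) diagram \<Rightarrow> 'j \<Rightarrow> 'u \<Rightarrow> 'u \<Rightarrow> bool" where
  "ev_eq F j x y \<longleftrightarrow> (\<exists>k. \<exists>f\<in>hom J j k. act F f x = act F f y)"

text \<open>The diagrams all of whose transitions are injective; in the pseudo-filtered case these are the
  ones that embed into the constant diagram on their colimit.\<close>

definition separated :: "('j, 'k, 'u) diagram \<Rightarrow> bool" where
  "separated F \<longleftrightarrow> (\<forall>j\<in>Obj J. \<forall>x\<in>el F j. \<forall>y\<in>el F j. ev_eq F j x y \<longrightarrow> x = y)"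

lemma separatedD:
  "separated F \<Longrightarrow> j \<in> Obj J \<Longrightarrow> x \<in> el F j \<Longrightarrow> y \<in> el F j \<Longrightarrow> ev_eq F j x y \<Longrightarrow> x = y"
  by (simp add: separated_def)

lemma ev_eqI: "f \<in> hom J j k \<Longrightarrow> act F f x = act F f y \<Longrightarrow> ev_eq F j x y"
  by (auto simp: ev_eq_def)

lemma ev_eqE:
  assumes "ev_eq F j x y"
  obtains k f where "f \<in> hom J j k" "act F f x = act F f y"
  using assms by (auto simp: ev_eq_def)

lemma ev_eq_refl: "j \<in> Obj J \<Longrightarrow> ev_eq F j x x"
  using category_ident[OF category_J] by (blast intro: ev_eqI)

lemma ev_eq_sym: "ev_eq F j x y \<Longrightarrow> ev_eq F j y x"
  unfolding ev_eq_def by metis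

lemma ev_eq_app:
  assumes t: "t \<in> hom S F G" and x: "x \<in> el F j" "y \<in> el F j" and e: "ev_eq F j x y"
  shows "ev_eq G j (app t j x) (app t j y)"
proof -
  obtain k f where f: "f \<in> hom J j k" "act F f x = act F f y" using ev_eqE[OF e] .
  show ?thesis
    using app_natural[OF t f(1) x(1)] app_natural[OF t f(1) x(2)] f(2) by (intro ev_eqI[OF f(1)]) simp
qed

lemma ev_eq_of_act:
  assumes F: "F \<in> Obj S" and f: "f \<in> hom J j k" and x: "x \<in> el F j" "y \<in> el F j"
    and e: "ev_eq F k (act F f x) (act F f y)"
  shows "ev_eq F j x y"
proof -
  obtain l g where g: "g \<in> hom J k l" "act F g (act F f x) = act F g (act F f y)" using ev_eqE[OF e] .
  show ?thesis
    using act_comp[OF F f g(1) x(1)] act_comp[OF F f g(1) x(2)] g(2)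
    by (intro ev_eqI[OF category_comp[OF category_J f g(1)]]) simp
qed

end

locale pseudo_filtered_index = small_index J u
  for J :: "('j, 'k) cat" and u :: "'u itself" +
  assumes pseudo_filtered_J: "pseudo_filtered J"
begin

lemma ev_eq_trans:
  assumes F: "F \<in> Obj S" and x: "x \<in> el F j" "y \<in> el F j" "z \<in> el F j"
    and e: "ev_eq F j x y" "ev_eq F j y z"
  shows "ev_eq F j x z"
proof -
  obtain k f where f: "f \<in> hom J j k" "act F f x = act F f y" using ev_eqE[OF e(1)] .
  obtain l g where g: "g \<in> hom J j l" "act F g y = act F g z" using ev_eqE[OF e(2)] .
  obtain m r s where r: "r \<in> hom J k m" and s: "s \<in> hom J l m" and rs: "r \<cdot>\<^bsub>J\<^esub> f = s \<cdot>\<^bsub>J\<^esub> g"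
    using pseudo_filtered_span[OF pseudo_filtered_J f(1) g(1)] .
  have "act F (r \<cdot>\<^bsub>J\<^esub> f) x = act F (r \<cdot>\<^bsub>J\<^esub> f) y"
    using act_comp[OF F f(1) r] x f(2) by simp
  moreover have "act F (s \<cdot>\<^bsub>J\<^esub> g) y = act F (s \<cdot>\<^bsub>J\<^esub> g) z"
    using act_comp[OF F g(1) s] x g(2) by simp
  ultimately show ?thesis
    using rs by (intro ev_eqI[OF category_comp[OF category_J f(1) r]]) simp
qed

lemma ev_eq_act:
  assumes F: "F \<in> Obj S" and f: "f \<in> hom J j k" and x: "x \<in> el F j" "y \<in> el F j"
    and e: "ev_eq F j x y"
  shows "ev_eq F k (act F f x) (act F f y)"
proof -
  obtain l g where g: "g \<in> hom J j l" "act F g x = act F g y" using ev_eqE[OF e] .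
  obtain m r s where r: "r \<in> hom J k m" and s: "s \<in> hom J l m" and rs: "r \<cdot>\<^bsub>J\<^esub> f = s \<cdot>\<^bsub>J\<^esub> g"
    using pseudo_filtered_span[OF pseudo_filtered_J f g(1)] .
  show ?thesis
  proof (rule ev_eqI[OF r])
    have "act F r (act F f z) = act F s (act F g z)" if "z \<in> el F j" for z
      using act_comp[OF F f r that] act_comp[OF F g(1) s that] rs by simp
    then show "act F r (act F f x) = act F r (act F f y)" using x g(2) by simp
  qed
qed

text \<open>The reflection inverts exactly these morphisms (\<open>E_class_iff\<close>).\<close>

definition ev_bijective :: "('j, 'k, 'u) transformation \<Rightarrow> bool" where
  "ev_bijective f \<longleftrightarrow> (\<forall>j\<in>Obj J.
     (\<forall>x\<in>el (Dom S f) j. \<forall>y\<in>el (Dom S f) j.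
        ev_eq (Cod S f) j (app f j x) (app f j y) \<longrightarrow> ev_eq (Dom S f) j x y) \<and>
     (\<forall>y\<in>el (Cod S f) j. \<exists>x\<in>el (Dom S f) j. ev_eq (Cod S f) j (app f j x) y))"

text \<open>The next two notions are the elementwise descriptions of \<open>\<E>'\<close> and \<open>\<M>\<^sup>*\<close>.\<close>

definition monotone_map :: "('j, 'k, 'u) transformation \<Rightarrow> bool" where
  "monotone_map f \<longleftrightarrow> surjective f \<and>
     (\<forall>j\<in>Obj J. \<forall>x\<in>el (Dom S f) j. \<forall>y\<in>el (Dom S f) j.
        app f j x = app f j y \<longrightarrow> ev_eq (Dom S f) j x y)"

definition light_map :: "('j, 'k, 'u) transformation \<Rightarrow> bool" where
  "light_map f \<longleftrightarrow>
     (\<forall>j\<in>Obj J. \<forall>x\<in>el (Dom S f) j. \<forall>y\<in>el (Dom S f) j.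
        app f j x = app f j y \<longrightarrow> ev_eq (Dom S f) j x y \<longrightarrow> x = y)"

lemma ev_bijective_iff:
  assumes "f \<in> hom S A B"
  shows "ev_bijective f \<longleftrightarrow> (\<forall>j\<in>Obj J.
     (\<forall>x\<in>el A j. \<forall>y\<in>el A j. ev_eq B j (app f j x) (app f j y) \<longrightarrow> ev_eq A j x y) \<and>
     (\<forall>y\<in>el B j. \<exists>x\<in>el A j. ev_eq B j (app f j x) y))"
  using assms by (auto simp: ev_bijective_def in_hom_iff)

lemma monotone_map_iff:
  assumes "f \<in> hom S A B"
  shows "monotone_map f \<longleftrightarrow> surjective f \<and>
     (\<forall>j\<in>Obj J. \<forall>x\<in>el A j. \<forall>y\<in>el A j. app f j x = app f j y \<longrightarrow> ev_eq A j x y)"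
  using assms by (auto simp: monotone_map_def in_hom_iff)

lemma light_map_iff:
  assumes "f \<in> hom S A B"
  shows "light_map f \<longleftrightarrow>
     (\<forall>j\<in>Obj J. \<forall>x\<in>el A j. \<forall>y\<in>el A j. app f j x = app f j y \<longrightarrow> ev_eq A j x y \<longrightarrow> x = y)"
  using assms by (auto simp: light_map_def in_hom_iff)

text \<open>In a square with upper side \<open>u\<close>, elements with the same image under \<open>e\<close> are eventually equal,
  hence so are their images under \<open>u\<close>; as these also agree under \<open>m\<close>, lightness makes them
  equal, and \<open>u\<close> descends along \<open>e\<close>.\<close>

lemma monotone_orthogonal_light:
  assumes e: "e \<in> hom S A B" "monotone_map e" and m: "m \<in> hom S X Y" "light_map m"
  shows "orthogonal S e m"
proof -
  have d: "Dom S e = A" "Cod S e = B" "Dom S m = X" "Cod S m = Y"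
    using e m by (auto simp: in_hom_iff)
  have s: "surjective e" using e(2) by (simp add: monotone_map_def)
  show ?thesis
    unfolding orthogonal_def d
  proof (intro ballI impI)
    fix u v assume u: "u \<in> hom S A X" and v: "v \<in> hom S B Y" and sq: "v \<odot> e = m \<odot> u"
    have sq': "app v j (app e j x) = app m j (app u j x)" if "j \<in> Obj J" "x \<in> el A j" for j x
      using app_comp[OF e(1) v that] app_comp[OF u m(1) that] sq by simp
    obtain w where w: "w \<in> hom S B X" "w \<odot> e = u"
    proof (rule descend_along_surjective[OF e(1) s u])
      fix j x y assume jxy: "j \<in> Obj J" "x \<in> el A j" "y \<in> el A j" and eq: "app e j x = app e j y"
      have "app m j (app u j x) = app m j (app u j y)"
        using sq'[OF jxy(1,2)] sq'[OF jxy(1,3)] eq by simp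
      moreover have "ev_eq X j (app u j x) (app u j y)"
        using e jxy eq by (intro ev_eq_app[OF u]) (auto simp: monotone_map_iff[OF e(1)])
      ultimately show "app u j x = app u j y"
        using m(2) jxy app_in[OF u] unfolding light_map_iff[OF m(1)] by blast
    qed blast
    have "m \<odot> w = v"
    proof (rule surjective_epi[OF e(1) s comp_in[OF w(1) m(1)] v])
      show "(m \<odot> w) \<odot> e = v \<odot> e"
        using category_assoc[OF category_S e(1) w(1) m(1)] w(2) sq by simp
    qed
    then have ww: "w \<in> hom S B X \<and> w \<odot> e = u \<and> m \<odot> w = v" using w by blast
    show "\<exists>!w. w \<in> hom S B X \<and> w \<odot> e = u \<and> m \<odot> w = v"
    proof (rule ex1I)
      show "w \<in> hom S B X \<and> w \<odot> e = u \<and> m \<odot> w = v" by (rule ww)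
      fix w' assume w': "w' \<in> hom S B X \<and> w' \<odot> e = u \<and> m \<odot> w' = v"
      show "w' = w"
        by (rule surjective_epi[OF e(1) s conjunct1[OF w'] w(1)]) (metis w' w(2))
    qed
  qed
qed

text \<open>For separated objects eventual equality is equality, so a morphism that is bijective up
  to eventual equality behaves like an isomorphism towards them.\<close>

lemma ev_bijective_orthogonal_separated:
  assumes e: "e \<in> hom S A B" "ev_bijective e" and m: "m \<in> hom S X Y"
    and X: "separated X" and Y: "separated Y"
  shows "orthogonal S e m"
proof -
  have d: "Dom S e = A" "Cod S e = B" "Dom S m = X" "Cod S m = Y"
    using e m by (auto simp: in_hom_iff)
  have inj: "ev_eq A j x y" if "j \<in> Obj J" "x \<in> el A j" "y \<in> el A j" "ev_eq B j (app e j x) (app e j y)" for j x y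
    using e(2) that unfolding ev_bijective_iff[OF e(1)] by blast
  have dense: "\<exists>x. x \<in> el A j \<and> ev_eq B j (app e j x) y" if "j \<in> Obj J" "y \<in> el B j" for j y
    using e(2) that unfolding ev_bijective_iff[OF e(1)] by blast
  note oA = S_objs(1)[OF e(1)] and oB = S_objs(2)[OF e(1)] and oX = S_objs(1)[OF m]
  have epi: "w = w'"
    if w: "w \<in> hom S B Z" "w' \<in> hom S B Z" and Z: "separated Z" and we: "w \<odot> e = w' \<odot> e" for w w' Z
  proof (rule transformation_eqI[OF w])
    fix j y assume j: "j \<in> Obj J" and y: "y \<in> el B j"
    obtain x where x: "x \<in> el A j" "ev_eq B j (app e j x) y" using dense[OF j y] by blast
    note ex = app_in[OF e(1) j x(1)]
    have "app t j (app e j x) = app t j y" if t: "t \<in> hom S B Z" for t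
      by (rule separatedD[OF Z j app_in[OF t j ex] app_in[OF t j y] ev_eq_app[OF t ex y x(2)]])
    moreover have "app w j (app e j x) = app w' j (app e j x)"
      using app_comp[OF e(1) w(1) j x(1)] app_comp[OF e(1) w(2) j x(1)] we by simp
    ultimately show "app w j y = app w' j y" using w by metis
  qed
  show ?thesis
    unfolding orthogonal_def d
  proof (intro ballI impI)
    fix u v assume u: "u \<in> hom S A X" and v: "v \<in> hom S B Y" and sq: "v \<odot> e = m \<odot> u"
    define w0 where "w0 j y = app u j (SOME x. x \<in> el A j \<and> ev_eq B j (app e j x) y)" for j y
    have w0: "\<exists>x. x \<in> el A j \<and> ev_eq B j (app e j x) y \<and> w0 j y = app u j x" if "j \<in> Obj J" "y \<in> el B j" for j y
      using someI_ex[OF dense[OF that]] unfolding w0_def by blast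
    have w0u: "w0 j y = app u j x"
      if j: "j \<in> Obj J" and y: "y \<in> el B j" and x: "x \<in> el A j" "ev_eq B j (app e j x) y" for j x y
    proof -
      obtain x' where x': "x' \<in> el A j" "ev_eq B j (app e j x') y" "w0 j y = app u j x'"
        using w0[OF j y] by blast
      note ex = app_in[OF e(1) j x(1)] and ex' = app_in[OF e(1) j x'(1)]
      have "ev_eq A j x' x"
        using inj[OF j x'(1) x(1)] ev_eq_trans[OF oB ex' y ex x'(2) ev_eq_sym[OF x(2)]] .
      from separatedD[OF X j app_in[OF u j x'(1)] app_in[OF u j x(1)] ev_eq_app[OF u x'(1) x(1) this]]
      show ?thesis using x'(3) by simp
    qed
    have w0in: "w0 j y \<in> el X j" if "j \<in> Obj J" "y \<in> el B j" for j y
      using w0[OF that] app_in[OF u that(1)] by auto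
    have w0nat: "w0 k (act B f y) = act X f (w0 i y)" if f: "f \<in> hom J i k" and y: "y \<in> el B i" for f i k y
    proof -
      note ik = J_objs[OF f]
      obtain x where x: "x \<in> el A i" "ev_eq B i (app e i x) y" "w0 i y = app u i x"
        using w0[OF ik(1) y] by blast
      note ex = app_in[OF e(1) ik(1) x(1)]
      have "ev_eq B k (app e k (act A f x)) (act B f y)"
        using ev_eq_act[OF oB f ex y x(2)] app_natural[OF e(1) f x(1)] by simp
      from w0u[OF ik(2) act_in[OF oB f y] act_in[OF oA f x(1)] this]
      show ?thesis using app_natural[OF u f x(1)] x(3) by simp
    qed
    let ?w = "transformation_of B w0 X"
    have w: "?w \<in> hom S B X" and aw: "\<And>j y. j \<in> Obj J \<Longrightarrow> y \<in> el B j \<Longrightarrow> app ?w j y = w0 j y"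
      by (rule transformation_of[OF oB oX w0in w0nat]; assumption)+
    have we: "?w \<odot> e = u"
    proof (rule transformation_eqI[OF comp_in[OF e(1) w] u])
      fix j x assume j: "j \<in> Obj J" and x: "x \<in> el A j"
      show "app (?w \<odot> e) j x = app u j x"
        using app_comp[OF e(1) w j x] aw[OF j app_in[OF e(1) j x]]
          w0u[OF j app_in[OF e(1) j x] x ev_eq_refl[OF j]] by simp
    qed
    have "(m \<odot> ?w) \<odot> e = v \<odot> e"
      using category_assoc[OF category_S e(1) w m] we sq by simp
    then have mw: "m \<odot> ?w = v" by (rule epi[OF comp_in[OF w m] v Y])
    show "\<exists>!w. w \<in> hom S B X \<and> w \<odot> e = u \<and> m \<odot> w = v"
    proof (rule ex1I[of _ ?w])
      show "?w \<in> hom S B X \<and> ?w \<odot> e = u \<and> m \<odot> ?w = v" using w we mw by blast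
      fix w' assume "w' \<in> hom S B X \<and> w' \<odot> e = u \<and> m \<odot> w' = v"
      then show "w' = ?w" using we by (intro epi[OF _ w X]) simp_all
    qed
  qed
qed

lemma light_into_separated:
  assumes m: "m \<in> hom S X Y" "light_map m" and Y: "separated Y"
  shows "separated X"
  unfolding separated_def
proof (intro ballI impI)
  fix j x y assume j: "j \<in> Obj J" and x: "x \<in> el X j" and y: "y \<in> el X j" and e: "ev_eq X j x y"
  have "app m j x = app m j y"
    by (rule separatedD[OF Y j app_in[OF m(1) j x] app_in[OF m(1) j y] ev_eq_app[OF m(1) x y e]])
  then show "x = y" using m(2) j x y e unfolding light_map_iff[OF m(1)] by blast
qed

text \<open>Eventually equal classes of the quotient are represented by elements that were eventually
  equal before, so a second division would change nothing: this is lightness of the second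
  factor.\<close>

lemma monotone_light_factorization:
  assumes f: "f \<in> hom S A B"
  obtains Q e m where "e \<in> hom S A Q" "monotone_map e" "m \<in> hom S Q B" "light_map m" "f = m \<odot> e"
proof -
  note oA = S_objs(1)[OF f]
  let ?R = "\<lambda>j x y. app f j x = app f j y \<and> ev_eq A j x y"
  obtain Q e where e: "e \<in> hom S A Q" "surjective e"
    and eR: "\<And>j x y. j \<in> Obj J \<Longrightarrow> x \<in> el A j \<Longrightarrow> y \<in> el A j \<Longrightarrow> app e j x = app e j y \<longleftrightarrow> ?R j x y"
  proof (rule quotient_exists[of A ?R, OF oA])
    show "?R k (act A h x) (act A h y)" if "h \<in> hom J i k" "x \<in> el A i" "y \<in> el A i" "?R i x y" for h i k x y
      using that app_natural[OF f that(1)] ev_eq_act[OF oA that(1)] by simp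
    show "?R j x z" if "x \<in> el A j" "y \<in> el A j" "z \<in> el A j" "?R j x y" "?R j y z" for j x y z
      using that ev_eq_trans[OF oA that(1-3)] by simp
  qed (auto intro: ev_eq_refl ev_eq_sym)
  obtain m where m: "m \<in> hom S Q B" "m \<odot> e = f"
    and me: "\<And>j x. j \<in> Obj J \<Longrightarrow> x \<in> el A j \<Longrightarrow> app m j (app e j x) = app f j x"
    by (rule descend_along_surjective[OF e f]) (use eR in blast)+
  have "light_map m"
    unfolding light_map_iff[OF m(1)]
  proof (intro ballI impI)
    fix j x y assume j: "j \<in> Obj J" and x: "x \<in> el Q j" and y: "y \<in> el Q j"
      and mxy: "app m j x = app m j y" and ev: "ev_eq Q j x y"
    obtain a where a: "a \<in> el A j" "app e j a = x" using surjectiveD[OF e(2,1) j x] .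
    obtain b where b: "b \<in> el A j" "app e j b = y" using surjectiveD[OF e(2,1) j y] .
    obtain k h where h: "h \<in> hom J j k" "act Q h x = act Q h y" using ev_eqE[OF ev] .
    have "app e k (act A h a) = app e k (act A h b)"
      using app_natural[OF e(1) h(1) a(1)] app_natural[OF e(1) h(1) b(1)] a b h(2) by simp
    then have "ev_eq A k (act A h a) (act A h b)"
      using eR[OF J_objs(2)[OF h(1)] act_in[OF oA h(1) a(1)] act_in[OF oA h(1) b(1)]] by blast
    then have "ev_eq A j a b" by (rule ev_eq_of_act[OF oA h(1) a(1) b(1)])
    moreover have "app f j a = app f j b" using me[OF j a(1)] me[OF j b(1)] a b mxy by simp
    ultimately show "x = y" using eR[OF j a(1) b(1)] a b by simp
  qed
  moreover have "monotone_map e" unfolding monotone_map_iff[OF e(1)] using e(2) eR by blast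
  ultimately show thesis using that[OF e(1) _ m(1)] m(2) by blast
qed

end

section \<open>The colimit and the reflection\<close>

text \<open>The factor is the transpose \<open>\<epsilon>\<^sub>B \<circ> F t\<close>.\<close>

lemma adjunction_unit_factor:
  assumes adj: "adjunction C D F G \<eta> \<epsilon>" and A: "A \<in> Obj C" and B: "B \<in> Obj D"
    and t: "t \<in> hom C A (omap G B)"
  obtains h where "h \<in> hom D (omap F A) B" "t = amap G h \<cdot>\<^bsub>C\<^esub> \<eta> A"
proof -
  have F: "is_functor C D F" and G: "is_functor D C G" and C: "category C" and D: "category D"
    and \<eta>: "nat_trans C C id_func (comp_func G F) \<eta>" and \<epsilon>: "nat_trans D D (comp_func F G) id_func \<epsilon>"
    and tri: "amap G (\<epsilon> B) \<cdot>\<^bsub>C\<^esub> \<eta> (omap G B) = Ident C (omap G B)"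
    using adj B functor_categories unfolding adjunction_def by blast+
  have eA: "\<eta> A \<in> hom C A (omap G (omap F A))" using nat_trans_hom[OF \<eta> A] by simp
  have eG: "\<eta> (omap G B) \<in> hom C (omap G B) (omap G (omap F (omap G B)))"
    using nat_trans_hom[OF \<eta> functor_obj[OF G B]] by simp
  have e: "\<epsilon> B \<in> hom D (omap F (omap G B)) B" using nat_trans_hom[OF \<epsilon> B] by simp
  have Ft: "amap F t \<in> hom D (omap F A) (omap F (omap G B))" using functor_hom[OF F t] .
  have h: "\<epsilon> B \<cdot>\<^bsub>D\<^esub> amap F t \<in> hom D (omap F A) B" using category_comp[OF D Ft e] .
  have nat: "\<eta> (omap G B) \<cdot>\<^bsub>C\<^esub> t = amap G (amap F t) \<cdot>\<^bsub>C\<^esub> \<eta> A"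
    using nat_trans_natural[OF \<eta> t] by simp
  have "amap G (\<epsilon> B \<cdot>\<^bsub>D\<^esub> amap F t) \<cdot>\<^bsub>C\<^esub> \<eta> A = amap G (\<epsilon> B) \<cdot>\<^bsub>C\<^esub> (\<eta> (omap G B) \<cdot>\<^bsub>C\<^esub> t)"
    using functor_comp[OF G Ft e] category_assoc[OF C eA functor_hom[OF G Ft] functor_hom[OF G e]] nat
    by simp
  also have "\<dots> = t"
    using category_assoc[OF C t eG functor_hom[OF G e]] tri category_ident_comp[OF C t] by simp
  finally show thesis using that[OF h] by simp
qed

context pseudo_filtered_index
begin

text \<open>One half holds because the transitions of a constant diagram are identities.  For the
  other, the elements having a common image with \<open>x\<close> are closed under transitions in both
  directions, so their characteristic function is a cocone with values in a two-element set;
  it must factor through the colimit.\<close>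

lemma colim_unit_eq_iff:
  fixes \<epsilon> :: "'u set \<Rightarrow> 'u mapping"
  assumes adj: "adjunction S set_cat Colim (diagonal J set_cat) \<theta> \<epsilon>"
    and M: "M \<in> Obj S" and j: "j \<in> Obj J" and x: "x \<in> el M j" and y: "y \<in> el M j"
  shows "app (\<theta> M) j x = app (\<theta> M) j y \<longleftrightarrow> ev_eq M j x y"
proof -
  let ?\<Delta> = "diagonal J set_cat :: ('u set, 'u mapping, ('j, 'k, 'u) diagram, ('j, 'k, 'u) transformation) func"
  have \<Delta>: "is_functor set_cat S ?\<Delta>" and C: "is_functor S set_cat Colim"
    and \<theta>: "nat_trans S S id_func (comp_func ?\<Delta> Colim) \<theta>"
    using adj unfolding adjunction_def by auto
  have el\<Delta>: "el (omap ?\<Delta> Z) i = Z" if "i \<in> Obj J" for i Z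
    using that by (simp add: diagonal_def Let_def)
  have act\<Delta>: "act (omap ?\<Delta> Z) f z = z" if "f \<in> hom J i k" "z \<in> Z" for f i k z Z
    using that by (simp add: diagonal_def Let_def act_def in_hom_iff)
  have t: "\<theta> M \<in> hom S M (omap ?\<Delta> (omap Colim M))" using nat_trans_hom[OF \<theta> M] by simp
  show ?thesis
  proof
    assume "ev_eq M j x y"
    then obtain k f where f: "f \<in> hom J j k" "act M f x = act M f y" by (rule ev_eqE)
    have "app (\<theta> M) k (act M f z) = app (\<theta> M) j z" if z: "z \<in> el M j" for z
      using app_natural[OF t f(1) z] act\<Delta>[OF f(1)] app_in[OF t j z] el\<Delta>[OF j] by simp
    then show "app (\<theta> M) j x = app (\<theta> M) j y" using x y f(2) by metis
  next
    assume eq: "app (\<theta> M) j x = app (\<theta> M) j y"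
    obtain a b :: 'u where ab: "a \<noteq> b"
    proof -
      have "infinite (UNIV :: 'u set)" using universe by (simp add: set_universe_def)
      then have "\<not> (UNIV :: 'u set) \<subseteq> {undefined}" using finite_subset by blast
      then show thesis using that by blast
    qed
    have Z: "{a, b} \<in> Obj set_cat"
      using finite_ordLess_infinite[OF card_of_Well_order card_of_Well_order, of "{a, b}" "UNIV :: 'u set"]
        universe by (simp add: small_def set_universe_def Field_card_of)
    define U where "U i z \<longleftrightarrow> (\<exists>l f g. f \<in> hom J i l \<and> g \<in> hom J j l \<and> act M f z = act M g x)" for i z
    have U: "U k (act M h z) \<longleftrightarrow> U i z" if h: "h \<in> hom J i k" and z: "z \<in> el M i" for h i k z
    proof
      assume "U k (act M h z)"
      then obtain l f g where fg: "f \<in> hom J k l" "g \<in> hom J j l" "act M f (act M h z) = act M g x"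
        unfolding U_def by blast
      then show "U i z"
        unfolding U_def using act_comp[OF M h fg(1) z] category_comp[OF category_J h fg(1)] by metis
    next
      assume "U i z"
      then obtain l f g where fg: "f \<in> hom J i l" "g \<in> hom J j l" "act M f z = act M g x"
        unfolding U_def by blast
      obtain m r s where r: "r \<in> hom J l m" and s: "s \<in> hom J k m" and rs: "r \<cdot>\<^bsub>J\<^esub> f = s \<cdot>\<^bsub>J\<^esub> h"
        using pseudo_filtered_span[OF pseudo_filtered_J fg(1) h] .
      have "act M s (act M h z) = act M (r \<cdot>\<^bsub>J\<^esub> g) x"
        using act_comp[OF M h s z] act_comp[OF M fg(1) r z] act_comp[OF M fg(2) r x] rs fg(3) by simp
      then show "U k (act M h z)"
        unfolding U_def using s category_comp[OF category_J fg(2) r] by blast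
    qed
    let ?\<chi> = "transformation_of M (\<lambda>i z. if U i z then a else b) (omap ?\<Delta> {a, b})"
    have \<chi>: "?\<chi> \<in> hom S M (omap ?\<Delta> {a, b})"
      and a\<chi>: "\<And>i z. i \<in> Obj J \<Longrightarrow> z \<in> el M i \<Longrightarrow> app ?\<chi> i z = (if U i z then a else b)"
      by (rule transformation_of[OF M functor_obj[OF \<Delta> Z]]; simp add: el\<Delta> act\<Delta> U)+
    obtain h where h: "h \<in> hom set_cat (omap Colim M) {a, b}" "?\<chi> = amap ?\<Delta> h \<odot> \<theta> M"
      using adjunction_unit_factor[OF adj M Z \<chi>] .
    have "app ?\<chi> j x = app ?\<chi> j y"
      unfolding h(2) using app_comp[OF t functor_hom[OF \<Delta> h(1)] j] x y eq by simp
    moreover have "U j x" unfolding U_def using category_ident[OF category_J j] by blast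
    ultimately have "U j y" using a\<chi>[OF j] x y ab by (simp split: if_splits)
    then obtain l f g where fg: "f \<in> hom J j l" "g \<in> hom J j l" "act M f y = act M g x"
      unfolding U_def by blast
    obtain m r where r: "r \<in> hom J l m" "r \<cdot>\<^bsub>J\<^esub> f = r \<cdot>\<^bsub>J\<^esub> g"
      using pseudo_filtered_coequalize[OF pseudo_filtered_J fg(1,2)] .
    show "ev_eq M j x y"
      using act_comp[OF M fg(1) r(1) y] act_comp[OF M fg(2) r(1) x] r(2) fg(3)
      by (intro ev_eqI[OF category_comp[OF category_J fg(1) r(1)]]) simp
  qed
qed

lemma reflection_unit:
  fixes \<epsilon> :: "'u set \<Rightarrow> 'u mapping"
  assumes adj: "adjunction S set_cat Colim (diagonal J set_cat) \<theta> \<epsilon>"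
    and refl: "derived_reflection J Colim \<theta> I \<eta>" and M: "M \<in> Obj S"
  shows "\<eta> M \<in> hom S M (omap I M)" "surjective (\<eta> M)"
    and "\<And>j x y. j \<in> Obj J \<Longrightarrow> x \<in> el M j \<Longrightarrow> y \<in> el M j \<Longrightarrow>
      app (\<eta> M) j x = app (\<eta> M) j y \<longleftrightarrow> ev_eq M j x y"
proof -
  obtain \<epsilon>' where adj': "adjunction S (mono_colim J \<theta>) I id_func \<eta> \<epsilon>'"
    using refl unfolding derived_reflection_def by blast
  obtain \<mu> where \<mu>: "\<mu> M \<in> hom S (omap I M) (omap (diagonal J set_cat) (omap Colim M))"
      "\<theta> M = \<mu> M \<odot> \<eta> M" "componentwise surj_mapping J (\<eta> M)" "componentwise inj_mapping J (\<mu> M)"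
    using refl M unfolding derived_reflection_def by blast
  have "nat_trans S S id_func (comp_func id_func I) \<eta>" using adj' by (simp add: adjunction_def)
  from nat_trans_hom[OF this M] show \<eta>: "\<eta> M \<in> hom S M (omap I M)" by simp
  have comp: "componentwise Q J t \<longleftrightarrow> (\<forall>j\<in>Obj J. Q (fst (snd t) j))" for Q and t :: "('j, 'k, 'u) transformation"
    by (simp add: componentwise_def case_prod_unfold)
  have surj: "app (\<eta> M) j ` el M j = el (omap I M) j" if "j \<in> Obj J" for j
  proof -
    have "surj_mapping (fst (snd (\<eta> M)) j)" using \<mu>(3) that unfolding comp by blast
    then show ?thesis unfolding component_eq(1)[OF \<eta> that] by (simp add: surj_mapping_def)
  qed
  have inj: "inj_on (app (\<mu> M) j) (el (omap I M) j)" if "j \<in> Obj J" for j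
  proof -
    have "inj_mapping (fst (snd (\<mu> M)) j)" using \<mu>(4) that unfolding comp by blast
    then show ?thesis unfolding component_eq(1)[OF \<mu>(1) that] by (simp add: inj_mapping_def)
  qed
  show "surjective (\<eta> M)" using surj \<eta> by (auto simp: surjective_def in_hom_iff)
  fix j x y assume j: "j \<in> Obj J" and x: "x \<in> el M j" and y: "y \<in> el M j"
  have "app (\<eta> M) j x = app (\<eta> M) j y \<longleftrightarrow> app (\<theta> M) j x = app (\<theta> M) j y"
    unfolding \<mu>(2) app_comp[OF \<eta> \<mu>(1) j x] app_comp[OF \<eta> \<mu>(1) j y]
    using inj_on_eq_iff[OF inj[OF j] app_in[OF \<eta> j x] app_in[OF \<eta> j y]] by blast
  then show "app (\<eta> M) j x = app (\<eta> M) j y \<longleftrightarrow> ev_eq M j x y"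
    using colim_unit_eq_iff[OF adj M j x y] by blast
qed

text \<open>The unit of the reflection divides out eventual equality, so bijectivity of \<open>I f\<close> on the
  quotients is bijectivity of \<open>f\<close> up to eventual equality.\<close>

lemma E_class_iff:
  fixes \<epsilon> :: "'u set \<Rightarrow> 'u mapping"
  assumes adj: "adjunction S set_cat Colim (diagonal J set_cat) \<theta> \<epsilon>"
    and refl: "derived_reflection J Colim \<theta> I \<eta>" and f: "f \<in> hom S A B"
  shows "f \<in> E_class S (mono_colim J \<theta>) I \<longleftrightarrow> ev_bijective f"
proof -
  obtain \<epsilon>' where adj': "adjunction S (mono_colim J \<theta>) I id_func \<eta> \<epsilon>'"
    using refl unfolding derived_reflection_def by blast
  then have IF: "is_functor S (mono_colim J \<theta>) I"
    and nt: "nat_trans S S id_func (comp_func id_func I) \<eta>" by (simp_all add: adjunction_def)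
  note oA = S_objs(1)[OF f] and oB = S_objs(2)[OF f]
  have If': "amap I f \<in> hom (mono_colim J \<theta>) (omap I A) (omap I B)" by (rule functor_hom[OF IF f])
  then have If: "amap I f \<in> hom S (omap I A) (omap I B)"
    unfolding mono_colim_def in_hom_full_subcategory_iff by blast
  have nat: "\<eta> B \<odot> f = amap I f \<odot> \<eta> A" using nat_trans_natural[OF nt f] by simp
  note A = reflection_unit[OF adj refl oA] and B = reflection_unit[OF adj refl oB]
  have nat': "app (amap I f) j (app (\<eta> A) j x) = app (\<eta> B) j (app f j x)" if "j \<in> Obj J" "x \<in> el A j" for j x
    using app_comp[OF f B(1) that] app_comp[OF A(1) If that] nat by simp
  have "f \<in> E_class S (mono_colim J \<theta>) I \<longleftrightarrow> iso (mono_colim J \<theta>) (amap I f)"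
    using f by (simp add: E_class_def in_hom_iff)
  also have "\<dots> \<longleftrightarrow> iso S (amap I f)"
    unfolding mono_colim_def by (rule iso_full_subcategory_iff[OF If'[unfolded mono_colim_def]])
  also have "\<dots> \<longleftrightarrow> (\<forall>j\<in>Obj J. bij_betw (app (amap I f) j) (el (omap I A) j) (el (omap I B) j))"
    by (rule iso_S_iff[OF If])
  also have "\<dots> \<longleftrightarrow> ev_bijective f"
    unfolding ev_bijective_iff[OF f]
  proof (rule ball_cong[OF HOL.refl])
    fix j assume j: "j \<in> Obj J"
    have sA: "el (omap I A) j = app (\<eta> A) j ` el A j"
      and sB: "el (omap I B) j = app (\<eta> B) j ` el B j"
      using A(1,2) B(1,2) j by (auto simp: surjective_def in_hom_iff)
    have fx: "app f j x \<in> el B j" if "x \<in> el A j" for x using app_in[OF f j that] .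
    have "inj_on (app (amap I f) j) (el (omap I A) j) \<longleftrightarrow>
        (\<forall>x\<in>el A j. \<forall>y\<in>el A j. ev_eq B j (app f j x) (app f j y) \<longrightarrow> ev_eq A j x y)"
      unfolding inj_on_def sA by (simp add: nat'[OF j] A(3)[OF j] B(3)[OF j] fx)
    moreover have "app (amap I f) j ` el (omap I A) j = el (omap I B) j \<longleftrightarrow>
        (\<forall>y\<in>el B j. \<exists>x\<in>el A j. ev_eq B j (app f j x) y)"
    proof
      assume e: "app (amap I f) j ` el (omap I A) j = el (omap I B) j"
      show "\<forall>y\<in>el B j. \<exists>x\<in>el A j. ev_eq B j (app f j x) y"
      proof
        fix y assume y: "y \<in> el B j"
        then have "app (\<eta> B) j y \<in> el (omap I B) j" unfolding sB by (rule imageI)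
        then have "app (\<eta> B) j y \<in> app (amap I f) j ` app (\<eta> A) j ` el A j" using e sA by simp
        then obtain x where x: "x \<in> el A j" "app (\<eta> B) j y = app (amap I f) j (app (\<eta> A) j x)" by blast
        have "ev_eq B j (app f j x) y" using B(3)[OF j fx[OF x(1)] y] nat'[OF j x(1)] x(2) by simp
        then show "\<exists>x\<in>el A j. ev_eq B j (app f j x) y" using x(1) by blast
      qed
    next
      assume d: "\<forall>y\<in>el B j. \<exists>x\<in>el A j. ev_eq B j (app f j x) y"
      have "app (\<eta> B) j y \<in> app (amap I f) j ` el (omap I A) j" if y: "y \<in> el B j" for y
      proof -
        obtain x where x: "x \<in> el A j" "ev_eq B j (app f j x) y" using d y by blast
        have "app (\<eta> B) j y = app (amap I f) j (app (\<eta> A) j x)"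
          using B(3)[OF j fx[OF x(1)] y] nat'[OF j x(1)] x(2) by simp
        moreover have "app (\<eta> A) j x \<in> el (omap I A) j" unfolding sA using x(1) by (rule imageI)
        ultimately show ?thesis by (rule image_eqI)
      qed
      then have "el (omap I B) j \<subseteq> app (amap I f) j ` el (omap I A) j"
        unfolding sB by (rule image_subsetI)
      moreover have "app (amap I f) j ` el (omap I A) j \<subseteq> el (omap I B) j"
        by (rule image_subsetI) (rule app_in[OF If j])
      ultimately show "app (amap I f) j ` el (omap I A) j = el (omap I B) j" by (rule equalityI[rotated])
    qed
    ultimately show "bij_betw (app (amap I f) j) (el (omap I A) j) (el (omap I B) j) \<longleftrightarrow>
      (\<forall>x\<in>el A j. \<forall>y\<in>el A j. ev_eq B j (app f j x) (app f j y) \<longrightarrow> ev_eq A j x y) \<and>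
      (\<forall>y\<in>el B j. \<exists>x\<in>el A j. ev_eq B j (app f j x) y)"
      unfolding bij_betw_def by blast
  qed
  finally show ?thesis .
qed

section \<open>Covers by separated diagrams\<close>

text \<open>The cover is the coproduct of representables indexed by the elements of \<open>B\<close>.  Its
  transitions compose with a morphism of the index category, hence are injective when all
  these are monic.\<close>

lemma separated_cover:
  assumes mono: "\<forall>f\<in>Arr J. monic J f" and B: "B \<in> Obj S"
  obtains E p where "p \<in> hom S E B" "surjective p" "separated E"
proof -
  let ?X = "\<lambda>k. SIGMA f:{f \<in> Arr J. Cod J f = k}. el B (Dom J f)"
  let ?a = "\<lambda>h (f, b). (h \<cdot>\<^bsub>J\<^esub> f, b)"
  have arr: "f \<in> hom J (Dom J f) k" "Dom J f \<in> Obj J" if "f \<in> Arr J" "Cod J f = k" for f k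
    using that J_objs(1)[of f "Dom J f" k] by (auto simp: in_hom_iff)
  have "small TYPE('u) {f \<in> Arr J. Cod J f = k}" for k
    by (rule small_subset[of "Arr J"]) (use small_J in \<open>auto simp: small_category_def small_def\<close>)
  then have sm: "small TYPE('u) (?X k)" for k
    by (rule small_Sigma) (use small_el[OF B] arr in auto)
  have comp: "h \<cdot>\<^bsub>J\<^esub> f \<in> Arr J" "Cod J (h \<cdot>\<^bsub>J\<^esub> f) = k" "Dom J (h \<cdot>\<^bsub>J\<^esub> f) = Dom J f"
    if "h \<in> hom J i k" "f \<in> Arr J" "Cod J f = i" for h i k f
    using category_comp[OF category_J arr(1)[OF that(2,3)] that(1)] by (auto simp: in_hom_iff)
  have cl: "?a h x \<in> ?X k" if "h \<in> hom J i k" "x \<in> ?X i" for h i k x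
    using that comp[OF that(1)] by auto
  have id': "?a (Ident J i) x = x" if "i \<in> Obj J" "x \<in> ?X i" for i x
    using that category_ident_comp[OF category_J arr(1)] by auto
  have co: "?a (h' \<cdot>\<^bsub>J\<^esub> h) x = ?a h' (?a h x)"
    if "h \<in> hom J i k" "h' \<in> hom J k l" "x \<in> ?X i" for h h' i k l x
    using that category_assoc[OF category_J arr(1) that(1,2)] by auto
  obtain E \<phi> \<psi> where E: "E \<in> Obj S"
    and \<phi>: "\<And>j x. j \<in> Obj J \<Longrightarrow> x \<in> ?X j \<Longrightarrow> \<phi> j x \<in> el E j"
    and \<psi>: "\<And>j y. j \<in> Obj J \<Longrightarrow> y \<in> el E j \<Longrightarrow> \<psi> j y \<in> ?X j"
    and \<psi>\<phi>: "\<And>j x. j \<in> Obj J \<Longrightarrow> x \<in> ?X j \<Longrightarrow> \<psi> j (\<phi> j x) = x"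
    and \<phi>\<psi>: "\<And>j y. j \<in> Obj J \<Longrightarrow> y \<in> el E j \<Longrightarrow> \<phi> j (\<psi> j y) = y"
    and ac: "\<And>h i k y. h \<in> hom J i k \<Longrightarrow> y \<in> el E i \<Longrightarrow> \<psi> k (act E h y) = ?a h (\<psi> i y)"
    by (rule realization[of ?X ?a, OF sm cl id' co]) (assumption | blast)+
  define p0 where "p0 j y = act B (fst (\<psi> j y)) (snd (\<psi> j y))" for j y
  have \<psi>': "fst (\<psi> j y) \<in> Arr J" "Cod J (fst (\<psi> j y)) = j" "snd (\<psi> j y) \<in> el B (Dom J (fst (\<psi> j y)))"
    if "j \<in> Obj J" "y \<in> el E j" for j y
    using \<psi>[OF that] by (auto simp: mem_Sigma_iff)
  have p0in: "p0 j y \<in> el B j" if "j \<in> Obj J" "y \<in> el E j" for j y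
    unfolding p0_def using act_in[OF B arr(1)[OF \<psi>'(1,2)[OF that]] \<psi>'(3)[OF that]] .
  have p0nat: "p0 k (act E h y) = act B h (p0 i y)" if h: "h \<in> hom J i k" and y: "y \<in> el E i" for h i k y
  proof -
    note P = \<psi>'[OF J_objs(1)[OF h] y]
    show ?thesis
      unfolding p0_def using ac[OF h y] act_comp[OF B arr(1)[OF P(1,2)] h P(3)]
      by (simp add: case_prod_unfold)
  qed
  let ?p = "transformation_of E p0 B"
  have p: "?p \<in> hom S E B" and ap: "\<And>j y. j \<in> Obj J \<Longrightarrow> y \<in> el E j \<Longrightarrow> app ?p j y = p0 j y"
    by (rule transformation_of[OF E B p0in p0nat]; assumption)+
  have "surjective ?p"
  proof (rule surjectiveI[OF p])
    fix j b assume j: "j \<in> Obj J" and b: "b \<in> el B j"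
    have X: "(Ident J j, b) \<in> ?X j" using category_ident[OF category_J j] b by (auto simp: in_hom_iff)
    show "\<exists>y\<in>el E j. app ?p j y = b"
      using \<phi>[OF j X] ap[OF j \<phi>[OF j X]] \<psi>\<phi>[OF j X] act_ident[OF B j b] by (auto simp: p0_def)
  qed
  moreover have "separated E"
    unfolding separated_def
  proof (intro ballI impI)
    fix j x y assume j: "j \<in> Obj J" and x: "x \<in> el E j" and y: "y \<in> el E j" and e: "ev_eq E j x y"
    obtain k h where h: "h \<in> hom J j k" "act E h x = act E h y" using ev_eqE[OF e] .
    note X = \<psi>'[OF j x] and Y = \<psi>'[OF j y]
    have eq: "h \<cdot>\<^bsub>J\<^esub> fst (\<psi> j x) = h \<cdot>\<^bsub>J\<^esub> fst (\<psi> j y)" "snd (\<psi> j x) = snd (\<psi> j y)"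
      using ac[OF h(1) x] ac[OF h(1) y] h(2) by (simp_all add: case_prod_unfold)
    have "Dom J (fst (\<psi> j x)) = Dom J (fst (\<psi> j y))"
      using comp(3)[OF h(1) X(1,2)] comp(3)[OF h(1) Y(1,2)] eq(1) by simp
    moreover have "monic J h" "Dom J h = j" using mono h(1) by (auto simp: in_hom_iff)
    ultimately have "fst (\<psi> j x) = fst (\<psi> j y)"
      using X Y eq(1) unfolding monic_def by blast
    then have "\<psi> j x = \<psi> j y" using eq(2) by (rule prod_eqI)
    then show "x = y" using \<phi>\<psi>[OF j x] \<phi>\<psi>[OF j y] by metis
  qed
  ultimately show thesis using that p by blast
qed

lemma fibred_elementsD:
  assumes pb: "is_pullback S f g p q" and f: "f \<in> hom S A B" and g: "g \<in> hom S E B"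
  shows "p \<in> hom S (Dom S p) A" "q \<in> hom S (Dom S p) E"
    and "\<And>j x. j \<in> Obj J \<Longrightarrow> x \<in> el (Dom S p) j \<Longrightarrow> app f j (app p j x) = app g j (app q j x)"
    and "\<And>j a e. j \<in> Obj J \<Longrightarrow> a \<in> el A j \<Longrightarrow> e \<in> el E j \<Longrightarrow> app f j a = app g j e \<Longrightarrow>
      \<exists>!x. x \<in> el (Dom S p) j \<and> app p j x = a \<and> app q j x = e"
proof -
  have d: "Dom S f = A" "Dom S g = E" using f g by (auto simp: in_hom_iff)
  show "p \<in> hom S (Dom S p) A" "q \<in> hom S (Dom S p) E"
    using pb d unfolding is_pullback_def by (auto simp: in_hom_iff)
  show "app f j (app p j x) = app g j (app q j x)" if "j \<in> Obj J" "x \<in> el (Dom S p) j" for j x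
    using pullback_fibred_elements[OF pb] that unfolding fibred_elements_def by blast
  show "\<exists>!x. x \<in> el (Dom S p) j \<and> app p j x = a \<and> app q j x = e"
    if "j \<in> Obj J" "a \<in> el A j" "e \<in> el E j" "app f j a = app g j e" for j a e
    using pullback_fibred_elements[OF pb] that unfolding fibred_elements_def d by blast
qed

lemma pullback_elements_eqI:
  assumes pb: "is_pullback S f g p q" and f: "f \<in> hom S A B" and g: "g \<in> hom S E B"
    and j: "j \<in> Obj J" and x: "x \<in> el (Dom S p) j" and y: "y \<in> el (Dom S p) j"
    and eq: "app p j x = app p j y" "app q j x = app q j y"
  shows "x = y"
proof -
  note F = fibred_elementsD[OF pb f g]
  from F(4)[OF j app_in[OF F(1) j x] app_in[OF F(2) j x] F(3)[OF j x]]
  show ?thesis using x y eq by metis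
qed

text \<open>Pulling \<open>f\<close> back along a separated cover detects the fibres of \<open>f\<close> one element at a
  time, since distinct elements of the cover are not eventually equal.\<close>

lemma monotone_map_if_stable:
  assumes f: "f \<in> hom S A B" and c: "c \<in> hom S E B" "surjective c" "separated E"
    and pb: "is_pullback S f c p q" and q: "ev_bijective q"
  shows "monotone_map f"
proof -
  note F = fibred_elementsD[OF pb f c(1)]
  let ?P = "Dom S p"
  have inj: "ev_eq ?P j x y"
    if "j \<in> Obj J" "x \<in> el ?P j" "y \<in> el ?P j" "ev_eq E j (app q j x) (app q j y)" for j x y
    using q that unfolding ev_bijective_iff[OF F(2)] by blast
  have onto: "\<exists>x\<in>el ?P j. app q j x = e" if j: "j \<in> Obj J" and e: "e \<in> el E j" for j e
  proof -
    obtain x where x: "x \<in> el ?P j" "ev_eq E j (app q j x) e"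
      using q j e unfolding ev_bijective_iff[OF F(2)] by blast
    show ?thesis using separatedD[OF c(3) j app_in[OF F(2) j x(1)] e x(2)] x(1) by blast
  qed
  show ?thesis
    unfolding monotone_map_iff[OF f]
  proof (intro conjI ballI impI)
    show "surjective f"
    proof (rule surjectiveI[OF f])
      fix j b assume j: "j \<in> Obj J" and b: "b \<in> el B j"
      obtain e where e: "e \<in> el E j" "app c j e = b" using surjectiveD[OF c(2,1) j b] .
      obtain x where x: "x \<in> el ?P j" "app q j x = e" using onto[OF j e(1)] by blast
      show "\<exists>a\<in>el A j. app f j a = b" using F(3)[OF j x(1)] app_in[OF F(1) j x(1)] x e by auto
    qed
    fix j a a' assume j: "j \<in> Obj J" and a: "a \<in> el A j" and a': "a' \<in> el A j" and eq: "app f j a = app f j a'"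
    obtain e where e: "e \<in> el E j" "app c j e = app f j a" using surjectiveD[OF c(2,1) j app_in[OF f j a]] .
    obtain x where x: "x \<in> el ?P j" "app p j x = a" "app q j x = e" using F(4)[OF j a e(1)] e(2) by auto
    obtain x' where x': "x' \<in> el ?P j" "app p j x' = a'" "app q j x' = e" using F(4)[OF j a' e(1)] e(2) eq by auto
    have "ev_eq ?P j x x'" using inj[OF j x(1) x'(1)] x(3) x'(3) ev_eq_refl[OF j] by simp
    from ev_eq_app[OF F(1) x(1) x'(1) this] show "ev_eq A j a a'" using x(2) x'(2) by simp
  qed
qed

text \<open>If \<open>f x\<close> and \<open>f y\<close> become equal after a transition, then the transported \<open>x\<close> and \<open>y\<close> lie in a
  common fibre and become equal after one more.\<close>

lemma ev_bijective_if_monotone: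
  assumes f: "f \<in> hom S A B" "monotone_map f"
  shows "ev_bijective f"
  unfolding ev_bijective_iff[OF f(1)]
proof (intro ballI conjI impI)
  note oA = S_objs(1)[OF f(1)]
  have s: "surjective f" and fib: "\<And>j x y. j \<in> Obj J \<Longrightarrow> x \<in> el A j \<Longrightarrow> y \<in> el A j \<Longrightarrow>
      app f j x = app f j y \<Longrightarrow> ev_eq A j x y"
    using f(2) unfolding monotone_map_iff[OF f(1)] by blast+
  fix j assume j: "j \<in> Obj J"
  show "\<exists>x\<in>el A j. ev_eq B j (app f j x) y" if y: "y \<in> el B j" for y
  proof -
    obtain x where "x \<in> el A j" "app f j x = y" using surjectiveD[OF s f(1) j y] .
    then show ?thesis using ev_eq_refl[OF j] by blast
  qed
  fix x y assume x: "x \<in> el A j" and y: "y \<in> el A j" and ev: "ev_eq B j (app f j x) (app f j y)"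
  obtain k h where h: "h \<in> hom J j k" "act B h (app f j x) = act B h (app f j y)" using ev_eqE[OF ev] .
  have "ev_eq A k (act A h x) (act A h y)"
    using app_natural[OF f(1) h(1) x] app_natural[OF f(1) h(1) y] h(2)
    by (intro fib[OF J_objs(2)[OF h(1)] act_in[OF oA h(1) x] act_in[OF oA h(1) y]]) simp
  then show "ev_eq A j x y" by (rule ev_eq_of_act[OF oA h(1) x y])
qed

lemma monotone_map_pullback:
  assumes f: "f \<in> hom S A B" "monotone_map f" and g: "g \<in> hom S E B"
    and pb: "is_pullback S f g p q"
  shows "monotone_map q"
proof -
  note F = fibred_elementsD[OF pb f(1) g]
  let ?P = "Dom S p"
  note oP = S_objs(1)[OF F(1)]
  have s: "surjective f" and fib: "\<And>j x y. j \<in> Obj J \<Longrightarrow> x \<in> el A j \<Longrightarrow> y \<in> el A j \<Longrightarrow>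
      app f j x = app f j y \<Longrightarrow> ev_eq A j x y"
    using f(2) unfolding monotone_map_iff[OF f(1)] by blast+
  show ?thesis
    unfolding monotone_map_iff[OF F(2)]
  proof (intro conjI ballI impI)
    show "surjective q"
    proof (rule surjectiveI[OF F(2)])
      fix j e assume j: "j \<in> Obj J" and e: "e \<in> el E j"
      obtain a where a: "a \<in> el A j" "app f j a = app g j e"
        using surjectiveD[OF s f(1) j app_in[OF g j e]] .
      show "\<exists>x\<in>el ?P j. app q j x = e" using F(4)[OF j a(1) e a(2)] by blast
    qed
    fix j x y assume j: "j \<in> Obj J" and x: "x \<in> el ?P j" and y: "y \<in> el ?P j"
      and eq: "app q j x = app q j y"
    have "app f j (app p j x) = app f j (app p j y)" using F(3)[OF j x] F(3)[OF j y] eq by simp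
    then have "ev_eq A j (app p j x) (app p j y)"
      by (rule fib[OF j app_in[OF F(1) j x] app_in[OF F(1) j y]])
    then obtain k h where h: "h \<in> hom J j k" "act A h (app p j x) = act A h (app p j y)" by (rule ev_eqE)
    have "act ?P h x = act ?P h y"
    proof (rule pullback_elements_eqI[OF pb f(1) g J_objs(2)[OF h(1)] act_in[OF oP h(1) x] act_in[OF oP h(1) y]])
      show "app p k (act ?P h x) = app p k (act ?P h y)"
        using app_natural[OF F(1) h(1) x] app_natural[OF F(1) h(1) y] h(2) by simp
      show "app q k (act ?P h x) = app q k (act ?P h y)"
        using app_natural[OF F(2) h(1) x] app_natural[OF F(2) h(1) y] eq by simp
    qed
    then show "ev_eq ?P j x y" by (rule ev_eqI[OF h(1)])
  qed
qed

lemma light_map_pullback: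
  assumes f: "f \<in> hom S A B" "light_map f" and g: "g \<in> hom S E B" and pb: "is_pullback S f g p q"
  shows "light_map q"
proof -
  note F = fibred_elementsD[OF pb f(1) g]
  show ?thesis
    unfolding light_map_iff[OF F(2)]
  proof (intro ballI impI)
    fix j x y assume j: "j \<in> Obj J" and x: "x \<in> el (Dom S p) j" and y: "y \<in> el (Dom S p) j"
      and eq: "app q j x = app q j y" and ev: "ev_eq (Dom S p) j x y"
    have "app f j (app p j x) = app f j (app p j y)" using F(3)[OF j x] F(3)[OF j y] eq by simp
    then have "app p j x = app p j y"
      using f(2) ev_eq_app[OF F(1) x y ev] app_in[OF F(1) j x] app_in[OF F(1) j y] j
      unfolding light_map_iff[OF f(1)] by blast
    then show "x = y" by (rule pullback_elements_eqI[OF pb f(1) g j x y _ eq])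
  qed
qed

text \<open>Two eventually equal elements of a fibre of \<open>f\<close> lift to the pullback with the same second
  coordinate, and the lifts are again eventually equal.\<close>

lemma light_map_if_pullback:
  assumes f: "f \<in> hom S A B" and c: "c \<in> hom S E B" "surjective c"
    and pb: "is_pullback S f c p q" and q: "light_map q"
  shows "light_map f"
proof -
  note F = fibred_elementsD[OF pb f c(1)] and oA = S_objs(1)[OF f] and oE = S_objs(1)[OF c(1)]
  let ?P = "Dom S p"
  note oP = S_objs(1)[OF F(1)]
  show ?thesis
    unfolding light_map_iff[OF f]
  proof (intro ballI impI)
    fix j a a' assume j: "j \<in> Obj J" and a: "a \<in> el A j" and a': "a' \<in> el A j"
      and eq: "app f j a = app f j a'" and ev: "ev_eq A j a a'"
    obtain e where e: "e \<in> el E j" "app c j e = app f j a" using surjectiveD[OF c(2,1) j app_in[OF f j a]] .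
    obtain x where x: "x \<in> el ?P j" "app p j x = a" "app q j x = e" using F(4)[OF j a e(1)] e(2) by auto
    obtain x' where x': "x' \<in> el ?P j" "app p j x' = a'" "app q j x' = e" using F(4)[OF j a' e(1)] e(2) eq by auto
    obtain k h where h: "h \<in> hom J j k" "act A h a = act A h a'" using ev_eqE[OF ev] .
    have "act ?P h x = act ?P h x'"
    proof (rule pullback_elements_eqI[OF pb f c(1) J_objs(2)[OF h(1)] act_in[OF oP h(1) x(1)] act_in[OF oP h(1) x'(1)]])
      show "app p k (act ?P h x) = app p k (act ?P h x')"
        using app_natural[OF F(1) h(1) x(1)] app_natural[OF F(1) h(1) x'(1)] x x' h(2) by simp
      show "app q k (act ?P h x) = app q k (act ?P h x')"
        using app_natural[OF F(2) h(1) x(1)] app_natural[OF F(2) h(1) x'(1)] x x' by simp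
    qed
    then have "ev_eq ?P j x x'" by (rule ev_eqI[OF h(1)])
    moreover have "app q j x = app q j x'" using x(3) x'(3) by simp
    ultimately have "x = x'" using q x(1) x'(1) j unfolding light_map_iff[OF F(2)] by blast
    then show "a = a'" using x(2) x'(2) by simp
  qed
qed

end

section \<open>Factorization systems from orthogonality and factorizations\<close>

lemma orthogonalE:
  assumes "orthogonal C e m" "e \<in> hom C A B" "m \<in> hom C X Y" "u \<in> hom C A X" "v \<in> hom C B Y"
    "v \<cdot>\<^bsub>C\<^esub> e = m \<cdot>\<^bsub>C\<^esub> u"
  obtains w where "w \<in> hom C B X" "w \<cdot>\<^bsub>C\<^esub> e = u" "m \<cdot>\<^bsub>C\<^esub> w = v"
    "\<And>w'. w' \<in> hom C B X \<Longrightarrow> w' \<cdot>\<^bsub>C\<^esub> e = u \<Longrightarrow> m \<cdot>\<^bsub>C\<^esub> w' = v \<Longrightarrow> w' = w"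
proof -
  have d: "Dom C e = A" "Cod C e = B" "Dom C m = X" "Cod C m = Y"
    using assms(2,3) by (auto simp: in_hom_iff)
  have "\<exists>!w. w \<in> hom C B X \<and> w \<cdot>\<^bsub>C\<^esub> e = u \<and> m \<cdot>\<^bsub>C\<^esub> w = v"
    using assms unfolding orthogonal_def d by blast
  then show thesis using that by (elim ex1E conjE) metis
qed

text \<open>A morphism orthogonal to all of \<open>M\<close> is orthogonal to the \<open>M\<close>-part of its own
  factorization, which is therefore invertible; dually for \<open>E\<close>.\<close>

lemma factorization_systemI:
  assumes C: "category C" and EA: "E \<subseteq> Arr C" and MA: "M \<subseteq> Arr C"
    and orth: "\<And>e m. e \<in> E \<Longrightarrow> m \<in> M \<Longrightarrow> orthogonal C e m"
    and fact: "\<And>f. f \<in> Arr C \<Longrightarrow> \<exists>e\<in>E. \<exists>m\<in>M. Cod C e = Dom C m \<and> f = m \<cdot>\<^bsub>C\<^esub> e"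
    and Eiso: "\<And>e i. e \<in> E \<Longrightarrow> iso C i \<Longrightarrow> Dom C i = Cod C e \<Longrightarrow> i \<cdot>\<^bsub>C\<^esub> e \<in> E"
    and Miso: "\<And>m i. m \<in> M \<Longrightarrow> iso C i \<Longrightarrow> Cod C i = Dom C m \<Longrightarrow> m \<cdot>\<^bsub>C\<^esub> i \<in> M"
  shows "factorization_system C E M"
proof -
  have fact': "\<exists>e m Q. e \<in> E \<and> m \<in> M \<and> e \<in> hom C A Q \<and> m \<in> hom C Q B \<and> f = m \<cdot>\<^bsub>C\<^esub> e"
    if f: "f \<in> hom C A B" for f A B
  proof -
    obtain e m where em: "e \<in> E" "m \<in> M" "Cod C e = Dom C m" "f = m \<cdot>\<^bsub>C\<^esub> e"
      using fact[of f] f by (auto simp: in_hom_iff)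
    have e: "e \<in> hom C (Dom C e) (Cod C e)" and m: "m \<in> hom C (Cod C e) (Cod C m)"
      using em EA MA by (auto simp: in_hom_iff)
    have "Dom C e = A" "Cod C m = B" using category_comp[OF C e m] f em(4) by (auto simp: in_hom_iff)
    then show ?thesis using e m em by blast
  qed
  have "e \<in> E" if e: "e \<in> Arr C" and o: "\<forall>m\<in>M. orthogonal C e m" for e
  proof -
    let ?A = "Dom C e" and ?B = "Cod C e"
    have eh: "e \<in> hom C ?A ?B" using e by (simp add: in_hom_iff)
    have B: "?B \<in> Obj C" using category_hom_objs[OF C eh] by blast
    obtain e1 m Q where E1: "e1 \<in> E" "m \<in> M" and e1: "e1 \<in> hom C ?A Q" and m: "m \<in> hom C Q ?B"
      and eq: "e = m \<cdot>\<^bsub>C\<^esub> e1" using fact'[OF eh] by blast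
    have Q: "Q \<in> Obj C" using category_hom_objs[OF C m] by blast
    have sq: "Ident C ?B \<cdot>\<^bsub>C\<^esub> e = m \<cdot>\<^bsub>C\<^esub> e1" using category_ident_comp[OF C eh] eq by simp
    obtain w where w: "w \<in> hom C ?B Q" "w \<cdot>\<^bsub>C\<^esub> e = e1" "m \<cdot>\<^bsub>C\<^esub> w = Ident C ?B"
      using orthogonalE[OF _ eh m e1 category_ident[OF C B] sq] o E1(2) by blast
    obtain z where z: "\<And>w'. w' \<in> hom C Q Q \<Longrightarrow> w' \<cdot>\<^bsub>C\<^esub> e1 = e1 \<Longrightarrow> m \<cdot>\<^bsub>C\<^esub> w' = m \<Longrightarrow> w' = z"
      using orthogonalE[OF orth[OF E1] e1 m e1 m HOL.refl] by blast
    have wm: "w \<cdot>\<^bsub>C\<^esub> m \<in> hom C Q Q" by (rule category_comp[OF C m w(1)])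
    have "w \<cdot>\<^bsub>C\<^esub> m = z"
    proof (rule z[OF wm])
      show "(w \<cdot>\<^bsub>C\<^esub> m) \<cdot>\<^bsub>C\<^esub> e1 = e1" using category_assoc[OF C e1 m w(1)] w(2) eq by simp
      show "m \<cdot>\<^bsub>C\<^esub> (w \<cdot>\<^bsub>C\<^esub> m) = m"
        using category_assoc[OF C m w(1) m] w(3) category_ident_comp[OF C m] by simp
    qed
    moreover have "Ident C Q = z"
      using z[OF category_ident[OF C Q]] category_ident_comp[OF C e1] category_comp_ident[OF C m] by simp
    ultimately have "iso C m" using isoI[OF m w(1)] w(3) by simp
    then show "e \<in> E" using Eiso[OF E1(1)] e1 m eq by (simp add: in_hom_iff)
  qed
  moreover have "f \<in> M" if f: "f \<in> Arr C" and o: "\<forall>e\<in>E. orthogonal C e f" for f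
  proof -
    let ?A = "Dom C f" and ?B = "Cod C f"
    have fh: "f \<in> hom C ?A ?B" using f by (simp add: in_hom_iff)
    have A: "?A \<in> Obj C" using category_hom_objs[OF C fh] by blast
    obtain e m Q where E1: "e \<in> E" "m \<in> M" and e: "e \<in> hom C ?A Q" and m: "m \<in> hom C Q ?B"
      and eq: "f = m \<cdot>\<^bsub>C\<^esub> e" using fact'[OF fh] by blast
    have Q: "Q \<in> Obj C" using category_hom_objs[OF C m] by blast
    have sq: "m \<cdot>\<^bsub>C\<^esub> e = f \<cdot>\<^bsub>C\<^esub> Ident C ?A" using category_comp_ident[OF C fh] eq by simp
    obtain w where w: "w \<in> hom C Q ?A" "w \<cdot>\<^bsub>C\<^esub> e = Ident C ?A" "f \<cdot>\<^bsub>C\<^esub> w = m"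
      using orthogonalE[OF _ e fh category_ident[OF C A] m sq] o E1(1) by blast
    obtain z where z: "\<And>w'. w' \<in> hom C Q Q \<Longrightarrow> w' \<cdot>\<^bsub>C\<^esub> e = e \<Longrightarrow> m \<cdot>\<^bsub>C\<^esub> w' = m \<Longrightarrow> w' = z"
      using orthogonalE[OF orth[OF E1] e m e m HOL.refl] by blast
    have ew: "e \<cdot>\<^bsub>C\<^esub> w \<in> hom C Q Q" by (rule category_comp[OF C w(1) e])
    have "e \<cdot>\<^bsub>C\<^esub> w = z"
    proof (rule z[OF ew])
      show "(e \<cdot>\<^bsub>C\<^esub> w) \<cdot>\<^bsub>C\<^esub> e = e"
        using category_assoc[OF C e w(1) e] w(2) category_comp_ident[OF C e] by simp
      show "m \<cdot>\<^bsub>C\<^esub> (e \<cdot>\<^bsub>C\<^esub> w) = m" using category_assoc[OF C w(1) e m] w(3) eq by simp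
    qed
    moreover have "Ident C Q = z"
      using z[OF category_ident[OF C Q]] category_ident_comp[OF C e] category_comp_ident[OF C m] by simp
    ultimately have "iso C e" using isoI[OF e w(1) w(2)] by simp
    then show "f \<in> M" using Miso[OF E1(2)] e m eq by (simp add: in_hom_iff)
  qed
  ultimately show ?thesis
    unfolding factorization_system_def using EA MA orth fact by blast
qed

section \<open>The monotone-light factorization system\<close>

context pseudo_filtered_index
begin

lemma iso_S_surjective: "i \<in> hom S A B \<Longrightarrow> iso S i \<Longrightarrow> surjective i"
  using iso_S_iff[of i A B] by (auto simp: surjective_def in_hom_iff bij_betw_def)

lemma iso_S_inj:
  "i \<in> hom S A B \<Longrightarrow> iso S i \<Longrightarrow> j \<in> Obj J \<Longrightarrow> x \<in> el A j \<Longrightarrow> y \<in> el A j \<Longrightarrow>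
     app i j x = app i j y \<Longrightarrow> x = y"
  using iso_S_iff[of i A B] by (metis bij_betw_imp_inj_on inj_onD)

lemma monotone_light_factorization_system_maps:
  "factorization_system S {f \<in> Arr S. monotone_map f} {f \<in> Arr S. light_map f}"
proof (rule factorization_systemI[OF category_S])
  have arr: "f \<in> hom S (Dom S f) (Cod S f)" if "f \<in> Arr S" for f
    using that by (simp add: in_hom_iff)
  show "orthogonal S e m" if "e \<in> {f \<in> Arr S. monotone_map f}" "m \<in> {f \<in> Arr S. light_map f}" for e m
    using monotone_orthogonal_light arr that by blast
  show "\<exists>e\<in>{f \<in> Arr S. monotone_map f}. \<exists>m\<in>{f \<in> Arr S. light_map f}. Cod S e = Dom S m \<and> f = m \<odot> e"
    if f: "f \<in> Arr S" for f
  proof -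
    obtain Q e m where "e \<in> hom S (Dom S f) Q" "monotone_map e" "m \<in> hom S Q (Cod S f)" "light_map m"
      and fme: "f = m \<odot> e" using monotone_light_factorization[OF arr[OF f]] .
    then have "e \<in> {f \<in> Arr S. monotone_map f}" "m \<in> {f \<in> Arr S. light_map f}" "Cod S e = Dom S m"
      unfolding in_hom_iff by simp_all
    then show ?thesis using fme by blast
  qed
  show "i \<odot> e \<in> {f \<in> Arr S. monotone_map f}"
    if "e \<in> {f \<in> Arr S. monotone_map f}" "iso S i" "Dom S i = Cod S e" for e i
  proof -
    let ?A = "Dom S e" and ?B = "Cod S e" and ?D = "Cod S i"
    have e: "e \<in> hom S ?A ?B" "monotone_map e" and i: "i \<in> hom S ?B ?D"
      using that by (auto simp: in_hom_iff iso_def)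
    note ie = comp_in[OF e(1) i]
    have "surjective (i \<odot> e)"
    proof (rule surjectiveI[OF ie])
      fix j z assume j: "j \<in> Obj J" and z: "z \<in> el ?D j"
      obtain y where y: "y \<in> el ?B j" "app i j y = z"
        using surjectiveD[OF iso_S_surjective[OF i \<open>iso S i\<close>] i j z] .
      obtain x where x: "x \<in> el ?A j" "app e j x = y"
        using surjectiveD[OF _ e(1) j y(1)] e(2) by (auto simp: monotone_map_def)
      show "\<exists>x\<in>el ?A j. app (i \<odot> e) j x = z" using app_comp[OF e(1) i j x(1)] x y by auto
    qed
    moreover have "ev_eq ?A j x y"
      if j: "j \<in> Obj J" and x: "x \<in> el ?A j" and y: "y \<in> el ?A j"
        and eq: "app (i \<odot> e) j x = app (i \<odot> e) j y" for j x y
    proof -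
      have "app e j x = app e j y"
        using iso_S_inj[OF i \<open>iso S i\<close> j app_in[OF e(1) j x] app_in[OF e(1) j y]]
          app_comp[OF e(1) i j x] app_comp[OF e(1) i j y] eq by simp
      then show ?thesis using e(2) j x y unfolding monotone_map_iff[OF e(1)] by blast
    qed
    ultimately have "monotone_map (i \<odot> e)" unfolding monotone_map_iff[OF ie] by blast
    then show ?thesis using ie by (simp add: in_hom_iff)
  qed
  show "m \<odot> i \<in> {f \<in> Arr S. light_map f}"
    if "m \<in> {f \<in> Arr S. light_map f}" "iso S i" "Cod S i = Dom S m" for m i
  proof -
    let ?A = "Dom S i" and ?B = "Dom S m" and ?D = "Cod S m"
    have m: "m \<in> hom S ?B ?D" "light_map m" and i: "i \<in> hom S ?A ?B"
      using that by (auto simp: in_hom_iff iso_def)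
    note mi = comp_in[OF i m(1)]
    have "light_map (m \<odot> i)"
      unfolding light_map_iff[OF mi]
    proof (intro ballI impI)
      fix j x y assume j: "j \<in> Obj J" and x: "x \<in> el ?A j" and y: "y \<in> el ?A j"
        and eq: "app (m \<odot> i) j x = app (m \<odot> i) j y" and ev: "ev_eq ?A j x y"
      have "app m j (app i j x) = app m j (app i j y)"
        using app_comp[OF i m(1) j x] app_comp[OF i m(1) j y] eq by simp
      then have "app i j x = app i j y"
        using m(2) j app_in[OF i j x] app_in[OF i j y] ev_eq_app[OF i x y ev]
        unfolding light_map_iff[OF m(1)] by blast
      then show "x = y" by (rule iso_S_inj[OF i \<open>iso S i\<close> j x y])
    qed
    then show ?thesis using mi by (simp add: in_hom_iff)
  qed
qed auto

lemma diagram_base_changeI: "p \<in> hom S E B \<Longrightarrow> diagram_base_change J u p E B"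
  by (simp add: diagram_base_change_def diagram_base_change_axioms_def small_index_axioms)

lemma effective_descent_iff:
  assumes "p \<in> hom S E B"
  shows "effective_descent S p \<longleftrightarrow> surjective p"
  using diagram_base_change.effective_descent_if_surjective[OF diagram_base_changeI[OF assms]]
    diagram_base_change.surjective_if_effective_descent[OF diagram_base_changeI[OF assms]] by blast

lemma chosen_pullback_S:
  assumes "p \<in> hom S E B" "f \<in> hom S A B"
  shows "is_pullback S f p (pb_top S p f) (pb_proj S p f)"
proof -
  interpret bc: diagram_base_change J u p E B by (rule diagram_base_changeI[OF assms(1)])
  show ?thesis using bc.chosen[of f] assms(2) by (simp add: in_hom_iff)
qed

end

theorem theorem3p2:
  fixes J :: "('j, 'k) cat"
    and Colim :: "(('j, 'k, 'u) diagram, ('j, 'k, 'u) transformation, 'u set, 'u mapping) func"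
    and \<theta> :: "('j, 'k, 'u) diagram \<Rightarrow> ('j, 'k, 'u) transformation"
    and \<epsilon> :: "'u set \<Rightarrow> 'u mapping"
    and I :: "(('j, 'k, 'u) diagram, ('j, 'k, 'u) transformation,
               ('j, 'k, 'u) diagram, ('j, 'k, 'u) transformation) func"
    and \<eta> :: "('j, 'k, 'u) diagram \<Rightarrow> ('j, 'k, 'u) transformation"
  assumes "set_universe TYPE('u)"
    and "small_category TYPE('u) J"
    and "pseudo_filtered J"
    and "\<forall>f\<in>Arr J. monic J f"
    and "adjunction (set_functors J) set_cat Colim (diagonal J set_cat) \<theta> \<epsilon>"
    and "derived_reflection J Colim \<theta> I \<eta>"
  shows "monotone_light_factorization_system (set_functors J) (mono_colim J \<theta>) I"
proof -
  interpret pseudo_filtered_index J "TYPE('u)"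
    by unfold_locales (fact assms)+
  note E_iff = E_class_iff[OF assms(5,6)]
  let ?D = "mono_colim J \<theta>"
  have arr: "f \<in> hom S (Dom S f) (Cod S f)" if "f \<in> Arr S" for f
    using that by (simp add: in_hom_iff)
  have E_class: "f \<in> E_class S ?D I \<longleftrightarrow> f \<in> Arr S \<and> ev_bijective f" for f
  proof (cases "f \<in> Arr S")
    case True
    then show ?thesis using E_iff[OF arr] by blast
  next
    case False
    then show ?thesis by (simp add: E_class_def)
  qed
  have stable: "f \<in> stable_E_class S ?D I \<longleftrightarrow> f \<in> Arr S \<and> monotone_map f" for f
  proof
    assume f: "f \<in> stable_E_class S ?D I"
    then have fA: "f \<in> hom S (Dom S f) (Cod S f)" using arr by (simp add: stable_E_class_def)
    obtain E c where c: "c \<in> hom S E (Cod S f)" "surjective c" "separated E"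
      using separated_cover[OF assms(4) S_objs(2)[OF fA]] .
    note pb = chosen_pullback_S[OF c(1) fA]
    have "ev_bijective (pb_proj S c f)" using f pb E_class unfolding stable_E_class_def by blast
    from monotone_map_if_stable[OF fA c pb this] show "f \<in> Arr S \<and> monotone_map f"
      using fA by (simp add: in_hom_iff)
  next
    assume f: "f \<in> Arr S \<and> monotone_map f"
    then have fA: "f \<in> hom S (Dom S f) (Cod S f)" and fm: "monotone_map f" using arr by blast+
    have "q \<in> E_class S ?D I" if pb: "is_pullback S f g p q" for g p q
    proof -
      have g: "g \<in> hom S (Dom S g) (Cod S f)" and q: "q \<in> Arr S"
        using pb by (auto simp: is_pullback_def in_hom_iff)
      from ev_bijective_if_monotone[OF arr[OF q] monotone_map_pullback[OF fA fm g pb]]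
      show ?thesis using E_class q by blast
    qed
    then show "f \<in> stable_E_class S ?D I" using f by (simp add: stable_E_class_def)
  qed
  have local_eq: "f \<in> local_M_class S ?D I \<longleftrightarrow> f \<in> Arr S \<and> light_map f" for f
  proof
    assume "f \<in> local_M_class S ?D I"
    then obtain p where fA: "f \<in> hom S (Dom S f) (Cod S f)" and ed: "effective_descent S p"
      and cod: "Cod S p = Cod S f" and M: "pb_proj S p f \<in> M_class S ?D I"
      using arr unfolding local_M_class_def pullback_functor_simps by auto
    have p: "p \<in> hom S (Dom S p) (Cod S f)" using ed cod by (simp add: effective_descent_def in_hom_iff)
    have s: "surjective p" using ed effective_descent_iff[OF p] by blast
    note pb = chosen_pullback_S[OF p fA]
    let ?q = "pb_proj S p f"
    have q: "?q \<in> hom S (Dom S ?q) (Cod S ?q)" using M arr by (simp add: M_class_def)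
    obtain Q e m where e: "e \<in> hom S (Dom S ?q) Q" "monotone_map e"
      and m: "m \<in> hom S Q (Cod S ?q)" "light_map m" and qme: "?q = m \<odot> e"
      using monotone_light_factorization[OF q] .
    \<comment> \<open>The square formed by \<open>e\<close>, \<open>?q\<close>, an identity and \<open>m\<close> has a diagonal, which is a retraction
      of \<open>e\<close>. So \<open>e\<close> is injective, and \<open>?q\<close> inherits lightness from \<open>m\<close>.\<close>
    have "e \<in> E_class S ?D I"
      using E_class ev_bijective_if_monotone[OF e] e(1) by (simp add: in_hom_iff)
    then have orth: "orthogonal S e ?q" using M by (simp add: M_class_def)
    have sq: "m \<odot> e = ?q \<odot> Ident S (Dom S ?q)"
      using qme category_comp_ident[OF category_S q] by simp
    obtain w where w: "w \<in> hom S Q (Dom S ?q)" "w \<odot> e = Ident S (Dom S ?q)"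
      by (rule orthogonalE[OF orth e(1) q ident_in[OF S_objs(1)[OF q]] m(1) sq])
    have "light_map ?q"
      unfolding light_map_iff[OF q]
    proof (intro ballI impI)
      fix j x y assume j: "j \<in> Obj J" and x: "x \<in> el (Dom S ?q) j" and y: "y \<in> el (Dom S ?q) j"
        and eq: "app ?q j x = app ?q j y" and ev: "ev_eq (Dom S ?q) j x y"
      have "app m j (app e j x) = app m j (app e j y)"
        using app_comp[OF e(1) m(1) j x] app_comp[OF e(1) m(1) j y] eq unfolding qme[symmetric] by simp
      then have exy: "app e j x = app e j y"
        using m(2) j app_in[OF e(1) j x] app_in[OF e(1) j y] ev_eq_app[OF e(1) x y ev]
        unfolding light_map_iff[OF m(1)] by blast
      have "app w j (app e j z) = z" if z: "z \<in> el (Dom S ?q) j" for z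
        using app_comp[OF e(1) w(1) j z] w(2) app_ident[OF S_objs(1)[OF q] j z] by simp
      from this[OF x] this[OF y] show "x = y" unfolding exy by (rule subst)
    qed
    from light_map_if_pullback[OF fA p s pb this] show "f \<in> Arr S \<and> light_map f"
      using fA by (simp add: in_hom_iff)
  next
    assume f: "f \<in> Arr S \<and> light_map f"
    then have fA: "f \<in> hom S (Dom S f) (Cod S f)" using arr by blast
    obtain E c where c: "c \<in> hom S E (Cod S f)" "surjective c" "separated E"
      using separated_cover[OF assms(4) S_objs(2)[OF fA]] .
    note pb = chosen_pullback_S[OF c(1) fA]
    let ?q = "pb_proj S c f"
    have q: "?q \<in> hom S (Dom S (pb_top S c f)) E" by (rule fibred_elementsD(2)[OF pb fA c(1)])
    have l: "light_map ?q" using light_map_pullback[OF fA _ c(1) pb] f by blast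
    have "orthogonal S e ?q" if e: "e \<in> E_class S ?D I" for e
    proof -
      have "e \<in> Arr S" "ev_bijective e" using e E_class by blast+
      then show ?thesis
        using ev_bijective_orthogonal_separated[OF arr _ q light_into_separated[OF q l c(3)] c(3)] by blast
    qed
    then have "?q \<in> M_class S ?D I" using q by (simp add: M_class_def in_hom_iff)
    then show "f \<in> local_M_class S ?D I"
      unfolding local_M_class_def pullback_functor_simps
      using f c(1,2) effective_descent_iff[OF c(1)] unfolding in_hom_iff by blast
  qed
  have "stable_E_class S ?D I = {f \<in> Arr S. monotone_map f}" using stable by blast
  moreover have "local_M_class S ?D I = {f \<in> Arr S. light_map f}" using local_eq by blast
  ultimately show ?thesis
    unfolding monotone_light_factorization_system_def
    using monotone_light_factorization_system_maps by simp
qed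

end
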